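(* Assume a curvature estimate of the form \[ \| (\mathrm{id} - P_{C})(C-\tilde C) \| \le \frac{c}{\hat\sigma} \| C - \tilde C \|^2 \quad\text{for all }C\in \mathcal{M}_{\mathrm{c}}\text{ and }\tilde C\in\overline{\mathcal{M}_{\mathrm{c}}}, \] where $\hat\sigma = \mathrm{dist}(C,\overline{\mathcal{M}_{\mathrm{c}}} \setminus \mathcal{M}_{\mathrm{c}})$ and where $c>0$ is independent of $C, \tilde C$. Let $X,Y \in \mathcal M$ with corresponding tangent space projections $P_X$ and $P_Y$. Then \[ \| (\mathrm{id} - P_X)(X-Y) \|_{\ell_2(\mathbb N^d)}\le \sqrt{\frac{c^2}{\sigma^2}+\sum_{\mu = 1}^d \frac{1}{(\sigma^\mu_{r_\mu})^2}}\; \| X - Y \|_{\ell_2(\mathbb N^d)}^2 \le \frac{\sqrt{d+c^2}}{\sigma}\| X - Y \|_{\ell_2(\mathbb N^d)} ^2 \] where $\sigma = \mathrm{dist}(X,\overline{\mathcal M}^w \setminus \mathcal M)$ and $\sigma^\mu_{r_\mu}$ is the smallest (positive) singular value of the $\mu$-th matricization of $X$.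
   Context: Let $d,r_1,\dots,r_d$ be positive integers. $\mathbb R^{r_1\times\dots\times r_d}_*$ denotes the open set of tensors with full multilinear rank $(r_1,\dots,r_d)$. $\times_\mu$ denotes left multiplication of a matrix (possibly with infinitely many rows) onto the $\mu$-th mode of a tensor; $\|\cdot\|$ without subscript is the Frobenius norm. $\mathcal M_{\mathrm c}\subset\mathbb R^{r_1\times\dots\times r_d}_*$ is a smooth (embedded) submanifold satisfying $C\times_1T^1\times_2\cdots\times_dT^d\in\mathcal M_{\mathrm c}$ for all $C\in\mathcal M_{\mathrm c}$ and all invertible $T^\mu\in\mathbb R^{r_\mu\times r_\mu}$; $\overline{\mathcal M_{\mathrm c}}$ is its closure in $\mathbb R^{r_1\times\dots\times r_d}$ and $P_C$ is the orthogonal projection of $\mathbb R^{r_1\times\dots\times r_d}$ onto the tangent space $T_C\mathcal M_{\mathrm c}$. Elements $U^\mu\in(\ell_2(\mathbb N))^{r_\mu}$ are treated as matrices with $r_\mu$ columns in $\ell_2(\mathbb N)$, and \[\mathcal M=\{X=C\times_1U^1\times_2\cdots\times_dU^d:\ C\in\mathcal M_{\mathrm c},\ U^\mu\in(\ell_2(\mathbb N))^{r_\mu},\ (U^\mu)^{\mathsf T}U^\mu\text{ invertible}\}\subset\ell_2(\mathbb N^d).\] $\overline{\mathcal M}^w$ is the weak closure of $\mathcal M$ in $\ell_2(\mathbb N^d)$; distances are in the $\ell_2(\mathbb N^d)$ norm for $\mathcal M$ and in the Frobenius norm for $\mathcal M_{\mathrm c}$. The $\mu$-th matricization of $X$ is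 $X$ regarded as an element of $\ell_2(\mathbb N)\otimes\ell_2(\mathbb N^{d-1})$ (mode $\mu$ versus the remaining modes); for $X\in\mathcal M$ it has rank $r_\mu$ and singular values $\sigma^\mu_1\ge\dots\ge\sigma^\mu_{r_\mu}>0$. $P_X$ is the orthogonal projection of $\ell_2(\mathbb N^d)$ onto the tangent space $T_X\mathcal M$, which consists of all $\dot C\times_1U^1\times_2\cdots\times_dU^d+C\times_1\dot U^1\times_2\cdots\times_dU^d+\dots+C\times_1U^1\times_2\cdots\times_d\dot U^d$ with $\dot C\in T_C\mathcal M_{\mathrm c}$, $\dot U^\mu\in(\ell_2(\mathbb N))^{r_\mu}$, $(U^\mu)^{\mathsf T}\dot U^\mu=0$. *)

theory Defs
  imports "HOL-Analysis.Analysis"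
begin

section \<open>Square-summable families as a real inner product space\<close>

typedef 'i ell2 = "{f :: 'i \<Rightarrow> real. (\<lambda>i. (f i)\<^sup>2) summable_on UNIV}"
  morphisms ell2_nth Abs_ell2
  by (rule exI[of _ "\<lambda>_. 0"]) simp

lemma ell2_summable: "(\<lambda>i. (ell2_nth x i)\<^sup>2) summable_on UNIV"
  using ell2_nth[of x] by simp

lemma ell2_nth_Abs:
  "(\<lambda>i. (f i)\<^sup>2) summable_on UNIV \<Longrightarrow> ell2_nth (Abs_ell2 f) = f"
  by (simp add: Abs_ell2_inverse)

lemma ell2_eqI: "(\<And>i. ell2_nth x i = ell2_nth y i) \<Longrightarrow> x = y"
  by (metis ell2_nth_inject ext)

lemma square_summable_add:
  fixes f g :: "'i \<Rightarrow> real"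
  assumes "(\<lambda>i. (f i)\<^sup>2) summable_on UNIV" "(\<lambda>i. (g i)\<^sup>2) summable_on UNIV"
  shows "(\<lambda>i. (f i + g i)\<^sup>2) summable_on UNIV"
proof (rule summable_on_comparison_test)
  show "(\<lambda>i. 2 * (f i)\<^sup>2 + 2 * (g i)\<^sup>2) summable_on UNIV"
    by (intro summable_on_add summable_on_cmult_right assms)
  show "(f i + g i)\<^sup>2 \<le> 2 * (f i)\<^sup>2 + 2 * (g i)\<^sup>2" for i
    using sum_squares_bound[of "f i" "g i"] by (simp add: power2_sum)
qed simp

lemma square_summable_scale:
  fixes f :: "'i \<Rightarrow> real"
  assumes "(\<lambda>i. (f i)\<^sup>2) summable_on UNIV"
  shows "(\<lambda>i. (a * f i)\<^sup>2) summable_on UNIV"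
  unfolding power_mult_distrib by (rule summable_on_cmult_right[OF assms])

lemma ell2_mult_summable: "(\<lambda>i. ell2_nth x i * ell2_nth y i) summable_on UNIV"
proof -
  have "(\<lambda>i. (ell2_nth x i + ell2_nth y i)\<^sup>2 + (- 1) * ((ell2_nth x i)\<^sup>2 + (ell2_nth y i)\<^sup>2))
          summable_on UNIV"
    by (intro summable_on_add summable_on_cmult_right square_summable_add ell2_summable)
  then have "(\<lambda>i. (1/2) * ((ell2_nth x i + ell2_nth y i)\<^sup>2
               + (- 1) * ((ell2_nth x i)\<^sup>2 + (ell2_nth y i)\<^sup>2))) summable_on UNIV"
    by (rule summable_on_cmult_right)
  then show ?thesis by (simp add: power2_sum)
qed

instantiation ell2 :: (type) real_inner
begin

definition "0 = Abs_ell2 (\<lambda>_. 0)"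
definition "x + y = Abs_ell2 (\<lambda>i. ell2_nth x i + ell2_nth y i)"
definition "- x = Abs_ell2 (\<lambda>i. - ell2_nth x i)" for x :: "'a ell2"
definition "x - y = Abs_ell2 (\<lambda>i. ell2_nth x i - ell2_nth y i)"
definition "a *\<^sub>R x = Abs_ell2 (\<lambda>i. a * ell2_nth x i)"
definition "inner x y = (\<Sum>\<^sub>\<infinity>i. ell2_nth x i * ell2_nth y i)"
definition "norm x = sqrt (inner x x)" for x :: "'a ell2"
definition "dist x y = norm (x - y)" for x y :: "'a ell2"
definition "sgn x = inverse (norm x) *\<^sub>R x" for x :: "'a ell2"
definition "uniformity = (INF e\<in>{0<..}. principal {(x :: 'a ell2, y). dist x y < e})"
definition "open U = (\<forall>x\<in>U. eventually (\<lambda>(x', y). x' = x \<longrightarrow> y \<in> U) uniformity)"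
  for U :: "'a ell2 set"

lemma ell2_nth_zero: "ell2_nth 0 i = 0"
  by (simp add: zero_ell2_def ell2_nth_Abs)

lemma ell2_nth_add: "ell2_nth (x + y) i = ell2_nth x i + ell2_nth y i"
  by (simp add: plus_ell2_def ell2_nth_Abs square_summable_add ell2_summable)

lemma ell2_nth_scaleR: "ell2_nth (a *\<^sub>R x) i = a * ell2_nth x i"
  by (simp add: scaleR_ell2_def ell2_nth_Abs square_summable_scale ell2_summable)

lemma ell2_nth_uminus: "ell2_nth (- x) i = - ell2_nth x i"
  by (simp add: uminus_ell2_def ell2_nth_Abs ell2_summable)

lemma ell2_nth_diff: "ell2_nth (x - y) i = ell2_nth x i - ell2_nth y i"
proof -
  have "(\<lambda>i. (ell2_nth x i + (- 1) * ell2_nth y i)\<^sup>2) summable_on UNIV"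
    by (intro square_summable_add square_summable_scale ell2_summable)
  then show ?thesis
    by (simp add: minus_ell2_def ell2_nth_Abs)
qed

lemmas ell2_nth_simps =
  ell2_nth_zero ell2_nth_add ell2_nth_scaleR ell2_nth_uminus ell2_nth_diff

instance
proof
  fix x y z :: "'a ell2" and a b :: real
  show "x + y + z = x + (y + z)" "x + y = y + x" "0 + x = x" "- x + x = 0" "x - y = x + - y"
    "a *\<^sub>R (x + y) = a *\<^sub>R x + a *\<^sub>R y" "(a + b) *\<^sub>R x = a *\<^sub>R x + b *\<^sub>R x"
    "a *\<^sub>R b *\<^sub>R x = (a * b) *\<^sub>R x" "1 *\<^sub>R x = x"
    by (rule ell2_eqI; simp add: ell2_nth_simps algebra_simps)+
  show "dist x y = norm (x - y)" by (rule dist_ell2_def)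
  show "sgn x = inverse (norm x) *\<^sub>R x" by (rule sgn_ell2_def)
  show "uniformity = (INF e\<in>{0<..}. principal {(x :: 'a ell2, y). dist x y < e})"
    by (rule uniformity_ell2_def)
  show "open U = (\<forall>x\<in>U. eventually (\<lambda>(x', y). x' = x \<longrightarrow> y \<in> U) uniformity)"
    for U :: "'a ell2 set"
    by (rule open_ell2_def)
  show "inner x y = inner y x"
    by (simp add: inner_ell2_def mult.commute)
  show "inner (x + y) z = inner x z + inner y z"
    by (simp add: inner_ell2_def ell2_nth_simps distrib_right infsum_add ell2_mult_summable)
  show "inner (a *\<^sub>R x) y = a * inner x y"
    by (simp add: inner_ell2_def ell2_nth_simps mult.assoc infsum_cmult_right ell2_mult_summable)
  show "0 \<le> inner x x"
    by (simp add: inner_ell2_def infsum_nonneg)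
  show "(inner x x = 0) = (x = 0)"
  proof
    assume "inner x x = 0"
    then have "ell2_nth x i * ell2_nth x i = 0" for i
      using nonneg_infsum_le_0D[of "\<lambda>i. ell2_nth x i * ell2_nth x i" UNIV i]
      by (simp add: inner_ell2_def ell2_mult_summable)
    then show "x = 0"
      by (intro ell2_eqI) (simp add: ell2_nth_simps)
  qed (simp add: inner_ell2_def ell2_nth_simps)
  show "norm x = sqrt (inner x x)" by (rule norm_ell2_def)
qed

end

lemma ell2_nth_sum: "ell2_nth (sum f A) i = (\<Sum>a\<in>A. ell2_nth (f a) i)"
  by (induction A rule: infinite_finite_induct) (simp_all add: ell2_nth_simps)


section \<open>Weak closure and orthogonal projection\<close>

definition weak_topology :: "'a::real_normed_vector topology" where
  "weak_topology = topology_generated_by {blinfun_apply f -` U | (f :: 'a \<Rightarrow>\<^sub>L real) U. open U}"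

definition weak_closure :: "'a::real_normed_vector set \<Rightarrow> 'a set" where
  "weak_closure S = weak_topology closure_of S"

text \<open>The description determines at most one point; that point exists for every complete
  subspace \<open>S\<close>.\<close>
definition orth_proj :: "'a::real_inner set \<Rightarrow> 'a \<Rightarrow> 'a" where
  "orth_proj S x = (THE y. y \<in> S \<and> (\<forall>s\<in>S. inner (x - y) s = 0))"


section \<open>Smooth submanifolds of Euclidean space\<close>

text \<open>\<open>Ck_on\<close> and \<open>smooth_on\<close> are meant for open \<open>S\<close>.\<close>
primrec Ck_on ::
  "nat \<Rightarrow> 'a::euclidean_space set \<Rightarrow> ('a \<Rightarrow> 'b::euclidean_space) \<Rightarrow> bool" where
  "Ck_on 0 S f \<longleftrightarrow> continuous_on S f"
| "Ck_on (Suc n) S f \<longleftrightarrow> (\<forall>x\<in>S. f differentiable (at x)) \<and>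
     (\<forall>v. Ck_on n S (\<lambda>x. frechet_derivative f (at x) v))"

definition smooth_on ::
  "'a::euclidean_space set \<Rightarrow> ('a \<Rightarrow> 'b::euclidean_space) \<Rightarrow> bool" where
  "smooth_on S f \<longleftrightarrow> (\<forall>n. Ck_on n S f)"

text \<open>Around each of its points, an embedded submanifold is flattened by a diffeomorphism between
  open subsets of the ambient space to a linear subspace of a fixed dimension.\<close>
definition smooth_submanifold :: "'a::euclidean_space set \<Rightarrow> bool" where
  "smooth_submanifold M \<longleftrightarrow> (\<exists>m. \<forall>x\<in>M. \<exists>U V (\<phi> :: 'a \<Rightarrow> 'a) \<psi> W.
     open U \<and> x \<in> U \<and> open V \<and>
     homeomorphism U V \<phi> \<psi> \<and> smooth_on U \<phi> \<and> smooth_on V \<psi> \<and>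
     subspace W \<and> dim W = m \<and> \<phi> ` (M \<inter> U) = W \<inter> V)"

definition tangent_space :: "'a::euclidean_space set \<Rightarrow> 'a \<Rightarrow> 'a set" where
  "tangent_space M x = {v. \<exists>\<epsilon>>0. \<exists>\<gamma> :: real \<Rightarrow> 'a.
     smooth_on {-\<epsilon><..<\<epsilon>} \<gamma> \<and> \<gamma> ` {-\<epsilon><..<\<epsilon>} \<subseteq> M \<and>
     \<gamma> 0 = x \<and> (\<gamma> has_vector_derivative v) (at 0)}"


section \<open>Tensors\<close>

text \<open>Modes are the elements of a finite type \<open>'d\<close>, and entries are counted from \<open>0\<close>; a multi-index
  is a function \<open>'d \<Rightarrow> nat\<close>. A tensor of size \<open>r\<close> (that is, r(1) x ... x r(d)) is an element of
  \<open>real ^ 'n\<close> whose coordinates are labelled by the multi-indices below \<open>r\<close> through a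
  bijection \<open>p\<close>; its Frobenius norm is then the norm of \<open>real ^ 'n\<close>.\<close>

definition tensor_labelling :: "('d::finite \<Rightarrow> nat) \<Rightarrow> ('n::finite \<Rightarrow> 'd \<Rightarrow> nat) \<Rightarrow> bool" where
  "tensor_labelling r p \<longleftrightarrow> bij_betw p UNIV {i. \<forall>\<mu>. i \<mu> < r \<mu>}"

definition entry ::
  "('n::finite \<Rightarrow> 'd::finite \<Rightarrow> nat) \<Rightarrow> real ^ 'n \<Rightarrow> ('d \<Rightarrow> nat) \<Rightarrow> real" where
  "entry p C i = C $ inv p i"

text \<open>In the matricization with respect to mode \<open>\<mu>\<close>, a column is labelled by the
  multi-index that has the indices of the remaining modes and a \<open>0\<close> in mode \<open>\<mu>\<close>; columns with
  any other label are zero.\<close>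

definition core_matricization_row ::
  "('n::finite \<Rightarrow> 'd::finite \<Rightarrow> nat) \<Rightarrow> 'd \<Rightarrow> real ^ 'n \<Rightarrow> nat \<Rightarrow> real ^ 'n" where
  "core_matricization_row p \<mu> C j =
     (\<chi> k. if p k \<mu> = 0 then entry p C ((p k)(\<mu> := j)) else 0)"

definition multilinear_rank ::
  "('d::finite \<Rightarrow> nat) \<Rightarrow> ('n::finite \<Rightarrow> 'd \<Rightarrow> nat) \<Rightarrow> real ^ 'n \<Rightarrow> 'd \<Rightarrow> nat" where
  "multilinear_rank r p C \<mu> = dim (core_matricization_row p \<mu> C ` {..<r \<mu>})"

definition full_rank_tensors ::
  "('d::finite \<Rightarrow> nat) \<Rightarrow> ('n::finite \<Rightarrow> 'd \<Rightarrow> nat) \<Rightarrow> (real ^ 'n) set" where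
  "full_rank_tensors r p = {C. multilinear_rank r p C = r}"

definition matricization ::
  "'d::finite \<Rightarrow> ('d \<Rightarrow> nat) ell2 \<Rightarrow> nat \<Rightarrow> ('d \<Rightarrow> nat) \<Rightarrow> real" where
  "matricization \<mu> X j i = (if i \<mu> = 0 then ell2_nth X (i(\<mu> := j)) else 0)"

text \<open>The positive singular values of a possibly infinite matrix: \<open>A v = s u\<close> and
  \<open>A\<^sup>T u = s v\<close> with unit vectors \<open>u\<close>, \<open>v\<close>.\<close>
definition positive_singular_values :: "('a \<Rightarrow> 'b \<Rightarrow> real) \<Rightarrow> real set" where
  "positive_singular_values A = {s. s > 0 \<and> (\<exists>(u :: 'a ell2) (v :: 'b ell2).
     norm u = 1 \<and> norm v = 1 \<and>
     (\<forall>a. (\<Sum>\<^sub>\<infinity>b. A a b * ell2_nth v b) = s * ell2_nth u a) \<and>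
     (\<forall>b. (\<Sum>\<^sub>\<infinity>a. A a b * ell2_nth u a) = s * ell2_nth v b))}"

text \<open>For a matricization of finite rank the set is finite.\<close>
definition smallest_singular_value ::
  "'d::finite \<Rightarrow> ('d \<Rightarrow> nat) ell2 \<Rightarrow> real" where
  "smallest_singular_value \<mu> X = Min (positive_singular_values (matricization \<mu> X))"

definition invertible_square :: "nat \<Rightarrow> (nat \<Rightarrow> nat \<Rightarrow> real) \<Rightarrow> bool" where
  "invertible_square n A \<longleftrightarrow> (\<exists>B. \<forall>i<n. \<forall>j<n.
     (\<Sum>k<n. A i k * B k j) = of_bool (i = j) \<and> (\<Sum>k<n. B i k * A k j) = of_bool (i = j))"

text \<open>The product of \<open>C\<close> with \<open>T \<mu>\<close> in every mode \<open>\<mu>\<close>, written out entrywise.\<close>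
definition core_mult ::
  "('n::finite \<Rightarrow> 'd::finite \<Rightarrow> nat) \<Rightarrow> real ^ 'n \<Rightarrow> ('d \<Rightarrow> nat \<Rightarrow> nat \<Rightarrow> real) \<Rightarrow> real ^ 'n" where
  "core_mult p C T = (\<chi> i. \<Sum>k\<in>UNIV. C $ k * (\<Prod>\<mu>\<in>UNIV. T \<mu> (p i \<mu>) (p k \<mu>)))"

definition elementary_tensor :: "('d::finite \<Rightarrow> nat ell2) \<Rightarrow> ('d \<Rightarrow> nat) ell2" where
  "elementary_tensor u = Abs_ell2 (\<lambda>i. \<Prod>\<mu>\<in>UNIV. ell2_nth (u \<mu>) (i \<mu>))"

text \<open>The matrices with infinitely many rows are given by their columns: \<open>U \<mu> k\<close> is column \<open>k\<close> of
  the factor in mode \<open>\<mu>\<close>. Only the columns \<open>k < r \<mu>\<close> matter.\<close>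
definition tucker ::
  "('n::finite \<Rightarrow> 'd::finite \<Rightarrow> nat) \<Rightarrow> real ^ 'n \<Rightarrow> ('d \<Rightarrow> nat \<Rightarrow> nat ell2) \<Rightarrow> ('d \<Rightarrow> nat) ell2" where
  "tucker p C U = (\<Sum>k\<in>UNIV. C $ k *\<^sub>R elementary_tensor (\<lambda>\<mu>. U \<mu> (p k \<mu>)))"

lemma elementary_tensor_nth:
  "ell2_nth (elementary_tensor u) i = (\<Prod>\<mu>\<in>UNIV. ell2_nth (u \<mu>) (i \<mu>))"
proof -
  have "(\<lambda>i. \<Prod>\<mu>\<in>UNIV. (ell2_nth (u \<mu>) (i \<mu>))\<^sup>2) summable_on UNIV"
  proof (rule nonneg_bdd_above_summable_on)
    show "bdd_above (sum (\<lambda>i. \<Prod>\<mu>\<in>UNIV. (ell2_nth (u \<mu>) (i \<mu>))\<^sup>2) ` {F. F \<subseteq> UNIV \<and> finite F})"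
    proof (rule bdd_aboveI2)
      fix F :: "('a \<Rightarrow> nat) set"
      assume "F \<in> {F. F \<subseteq> UNIV \<and> finite F}"
      then have F: "finite F" by simp
      define B where "B \<mu> = (\<lambda>i. i \<mu>) ` F" for \<mu>
      have B: "finite (B \<mu>)" for \<mu> using F by (simp add: B_def)
      have "(\<Sum>i\<in>F. \<Prod>\<mu>\<in>UNIV. (ell2_nth (u \<mu>) (i \<mu>))\<^sup>2)
              \<le> (\<Sum>i\<in>PiE UNIV B. \<Prod>\<mu>\<in>UNIV. (ell2_nth (u \<mu>) (i \<mu>))\<^sup>2)"
        by (intro sum_mono2 finite_PiE B) (auto simp: B_def prod_nonneg)
      also have "\<dots> = (\<Prod>\<mu>\<in>UNIV. \<Sum>a\<in>B \<mu>. (ell2_nth (u \<mu>) a)\<^sup>2)"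
        by (rule prod_sum_PiE[symmetric]) (simp_all add: B)
      also have "\<dots> \<le> (\<Prod>\<mu>\<in>UNIV. \<Sum>\<^sub>\<infinity>a. (ell2_nth (u \<mu>) a)\<^sup>2)"
        by (intro prod_mono conjI sum_nonneg finite_sum_le_infsum ell2_summable B) auto
      finally show "(\<Sum>i\<in>F. \<Prod>\<mu>\<in>UNIV. (ell2_nth (u \<mu>) (i \<mu>))\<^sup>2)
              \<le> (\<Prod>\<mu>\<in>UNIV. \<Sum>\<^sub>\<infinity>a. (ell2_nth (u \<mu>) a)\<^sup>2)" .
    qed
  qed (simp add: prod_nonneg)
  then show ?thesis
    by (simp add: elementary_tensor_def ell2_nth_Abs flip: prod_power_distrib)
qed

lemma tucker_nth:
  "ell2_nth (tucker p C U) i =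
     (\<Sum>k\<in>UNIV. C $ k * (\<Prod>\<mu>\<in>UNIV. ell2_nth (U \<mu> (p k \<mu>)) (i \<mu>)))"
  by (simp add: tucker_def ell2_nth_sum ell2_nth_scaleR elementary_tensor_nth)


section \<open>The tensor manifold generated by a manifold of core tensors\<close>

definition core_manifold ::
  "('d::finite \<Rightarrow> nat) \<Rightarrow> ('n::finite \<Rightarrow> 'd \<Rightarrow> nat) \<Rightarrow> (real ^ 'n) set \<Rightarrow> bool" where
  "core_manifold r p Mc \<longleftrightarrow>
     smooth_submanifold Mc \<and> Mc \<subseteq> full_rank_tensors r p \<and>
     (\<forall>C\<in>Mc. \<forall>T. (\<forall>\<mu>. invertible_square (r \<mu>) (T \<mu>)) \<longrightarrow> core_mult p C T \<in> Mc)"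

definition regular_factors ::
  "('d::finite \<Rightarrow> nat) \<Rightarrow> ('d \<Rightarrow> nat \<Rightarrow> nat ell2) \<Rightarrow> bool" where
  "regular_factors r U \<longleftrightarrow> (\<forall>\<mu>. invertible_square (r \<mu>) (\<lambda>k l. inner (U \<mu> k) (U \<mu> l)))"

definition tensor_manifold ::
  "('d::finite \<Rightarrow> nat) \<Rightarrow> ('n::finite \<Rightarrow> 'd \<Rightarrow> nat) \<Rightarrow> (real ^ 'n) set \<Rightarrow> ('d \<Rightarrow> nat) ell2 set" where
  "tensor_manifold r p Mc = {tucker p C U | C U. C \<in> Mc \<and> regular_factors r U}"

text \<open>The tangent vectors at \<open>X\<close> obtained from one representation \<open>X = tucker p C U\<close> do not depend
  on the representation, so it is harmless that \<open>C\<close> and \<open>U\<close> are bound inside the set.\<close>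
definition tensor_tangent_space ::
  "('d::finite \<Rightarrow> nat) \<Rightarrow> ('n::finite \<Rightarrow> 'd \<Rightarrow> nat) \<Rightarrow> (real ^ 'n) set \<Rightarrow>
    ('d \<Rightarrow> nat) ell2 \<Rightarrow> ('d \<Rightarrow> nat) ell2 set" where
  "tensor_tangent_space r p Mc X =
     {tucker p C' U + (\<Sum>\<mu>\<in>UNIV. tucker p C (U(\<mu> := U' \<mu>))) | C U C' U'.
        C \<in> Mc \<and> regular_factors r U \<and> X = tucker p C U \<and>
        C' \<in> tangent_space Mc C \<and>
        (\<forall>\<mu>. \<forall>k<r \<mu>. \<forall>l<r \<mu>. inner (U \<mu> k) (U' \<mu> l) = 0)}"

end

theory Submission
  imports Defs "Jordan_Normal_Form.Char_Poly"
begin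

text \<open>Write \<open>X = C \<times> U\<close> and \<open>Y = D \<times> V\<close>, where the columns of every \<open>U \<mu>\<close> are orthonormal. Then
  \<open>C \<mapsto> C \<times> U\<close> is an isometry, and the tangent space at \<open>X\<close> is the orthogonal sum of the tensors
  \<open>C' \<times> U\<close> with \<open>C'\<close> tangent to \<open>Mc\<close> and, for every mode \<open>\<mu>\<close>, of the tensors obtained from \<open>X\<close> by
  replacing \<open>U \<mu>\<close> by factors orthogonal to \<open>U \<mu>\<close>. In every mode choose an orthonormal basis that
  starts with the columns of \<open>U \<mu>\<close> and spans those of \<open>V \<mu>\<close>. The coefficients of
  \<open>(id - P)(X - Y)\<close> are then of two kinds.

  If all indices belong to \<open>U\<close>, they are the coefficients of the core residual of \<open>C\<close> against the
  compression of \<open>Y\<close> to the columns of \<open>U\<close>. That compression is \<open>D\<close> multiplied by square matrices,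
  hence a limit of elements of \<open>Mc\<close>, because invertible matrices are dense
  (\<open>core_mult_in_closure\<close>); so the curvature hypothesis bounds this part by
  \<open>c / \<sigma>\<^sub>c * norm (X - Y)\<^sup>2\<close>, with \<open>\<sigma>\<^sub>c\<close> the distance from \<open>C\<close> to \<open>closure Mc - Mc\<close>.

  The coefficients whose \<open>\<mu>\<close>-th index lies outside \<open>U \<mu>\<close> form, up to sign, the matrix
  \<open>(1 - Q) B (1 - \<Pi>)\<close>, where \<open>B\<close> is the \<open>\<mu>\<close>-th matricization of \<open>Y\<close>, and \<open>Q\<close> and \<open>\<Pi>\<close> are the projections
  onto the column and row space of that of \<open>X\<close>. Both matricizations have rank \<open>r \<mu>\<close>, and for matrices
  of equal rank this product is quadratically small: \<open>low_rank_perturbation\<close> gives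
  \<open>norm (X - Y)\<^sup>2 / s \<mu>\<close> with the smallest singular value \<open>s \<mu>\<close> of \<open>X\<close>. Adding squares yields the
  first inequality with \<open>\<sigma>\<^sub>c\<close> in place of \<open>\<sigma>\<close>.

  It remains to prove \<open>0 < \<sigma> \<le> \<sigma>\<^sub>c \<le> s \<mu>\<close> (\<open>distance_to_boundary\<close>). Multiplication by \<open>U\<close> maps boundary
  cores isometrically to boundary tensors, so \<open>\<sigma> \<le> \<sigma>\<^sub>c\<close>; removing the smallest singular component of
  a matricization of \<open>C\<close> gives a boundary core at distance \<open>s \<mu>\<close>. Positivity of \<open>\<sigma>\<close> is
  indispensable, since \<open>c\<^sup>2 / \<sigma>\<^sup>2\<close> is \<open>0\<close> for \<open>\<sigma> = 0\<close>. It says that a point \<open>Z\<close> of the weak closure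
  close to \<open>X\<close> lies in the manifold. The compression of \<open>Z\<close> is weakly continuous with values in a
  finite-dimensional space, so it lies in \<open>closure Mc\<close> and, since \<open>Mc\<close> is locally closed, in \<open>Mc\<close>.
  For tensors of the manifold with nondegenerate compression the factors solve linear systems
  whose coefficients are weakly continuous, so the factorization survives in the limit
  (\<open>weak_limit_tucker\<close>), even for unbounded nets.\<close>

section \<open>Square matrices indexed by natural numbers\<close>

lemma det_nonzero_iff_inj:
  fixes A :: "nat \<Rightarrow> nat \<Rightarrow> real"
  shows "Determinant.det (Matrix.mat n n (\<lambda>(i, j). A i j)) \<noteq> 0 \<longleftrightarrow>
    (\<forall>x. (\<forall>i<n. (\<Sum>k<n. A i k * x k) = 0) \<longrightarrow> (\<forall>k<n. x k = 0))"
proof -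
  let ?A = "Matrix.mat n n (\<lambda>(i, j). A i j)"
  have A: "?A \<in> carrier_mat n n" by simp
  have mv: "?A *\<^sub>v Matrix.vec n x = Matrix.vec n (\<lambda>i. \<Sum>k<n. A i k * x k)" for x
    by (intro eq_vecI) (auto simp: scalar_prod_def lessThan_atLeast0)
  have "(\<exists>v. v \<in> carrier_vec n \<and> v \<noteq> 0\<^sub>v n \<and> ?A *\<^sub>v v = 0\<^sub>v n)
      \<longleftrightarrow> (\<exists>x. Matrix.vec n x \<noteq> 0\<^sub>v n \<and> ?A *\<^sub>v Matrix.vec n x = 0\<^sub>v n)"
  proof safe
    fix v assume v: "v \<in> carrier_vec n" "v \<noteq> 0\<^sub>v n" "?A *\<^sub>v v = 0\<^sub>v n"
    have "v = Matrix.vec n (vec_index v)" using v(1) by auto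
    with v show "\<exists>x. Matrix.vec n x \<noteq> 0\<^sub>v n \<and> ?A *\<^sub>v Matrix.vec n x = 0\<^sub>v n" by metis
  next
    fix x assume "Matrix.vec n x \<noteq> 0\<^sub>v n" "?A *\<^sub>v Matrix.vec n x = 0\<^sub>v n"
    then show "\<exists>v. v \<in> carrier_vec n \<and> v \<noteq> 0\<^sub>v n \<and> ?A *\<^sub>v v = 0\<^sub>v n"
      by (intro exI[of _ "Matrix.vec n x"]) simp
  qed
  also have "\<dots> \<longleftrightarrow> (\<exists>x. (\<exists>k<n. x k \<noteq> 0) \<and> (\<forall>i<n. (\<Sum>k<n. A i k * x k) = 0))"
    unfolding mv by (auto simp: vec_eq_iff)
  finally show ?thesis
    using det_0_iff_vec_prod_zero_field[OF A] by blast
qed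

lemma invertible_square_iff_det:
  "invertible_square n A \<longleftrightarrow> Determinant.det (Matrix.mat n n (\<lambda>(i, j). A i j)) \<noteq> 0"
proof
  assume "invertible_square n A"
  then obtain B where B: "\<And>i j. i < n \<Longrightarrow> j < n \<Longrightarrow> (\<Sum>k<n. B i k * A k j) = of_bool (i = j)"
    unfolding invertible_square_def by blast
  show "Determinant.det (Matrix.mat n n (\<lambda>(i, j). A i j)) \<noteq> 0"
    unfolding det_nonzero_iff_inj
  proof (intro allI impI)
    fix x k assume x: "\<forall>i<n. (\<Sum>k<n. A i k * x k) = 0" and k: "k < n"
    have "x k = (\<Sum>j<n. of_bool (k = j) * x j)" using k by simp
    also have "\<dots> = (\<Sum>j<n. (\<Sum>i<n. B k i * A i j) * x j)"
      using k by (intro sum.cong) (auto simp: B)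
    also have "\<dots> = (\<Sum>i<n. B k i * (\<Sum>j<n. A i j * x j))"
      unfolding sum_distrib_left sum_distrib_right by (subst sum.swap) (simp add: mult.assoc)
    finally show "x k = 0" using x by simp
  qed
next
  let ?A = "Matrix.mat n n (\<lambda>(i, j). A i j)"
  assume "Determinant.det ?A \<noteq> 0"
  then obtain B where B: "B \<in> carrier_mat n n" "B * ?A = 1\<^sub>m n" "?A * B = 1\<^sub>m n"
    using det_non_zero_imp_unit[of ?A n "()"] by (auto simp: Units_def ring_mat_def)
  have "(\<Sum>k<n. A i k * B $$ (k, j)) = of_bool (i = j)" if "i < n" "j < n" for i j
    using arg_cong[OF B(3), of "\<lambda>M. M $$ (i, j)"] that B(1)
    by (simp add: scalar_prod_def lessThan_atLeast0 of_bool_def)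
  moreover have "(\<Sum>k<n. B $$ (i, k) * A k j) = of_bool (i = j)" if "i < n" "j < n" for i j
    using arg_cong[OF B(2), of "\<lambda>M. M $$ (i, j)"] that B(1)
    by (simp add: scalar_prod_def lessThan_atLeast0 of_bool_def)
  ultimately show "invertible_square n A"
    unfolding invertible_square_def by (intro exI[of _ "\<lambda>i j. B $$ (i, j)"]) simp
qed

lemma invertible_square_iff_inj:
  "invertible_square n A \<longleftrightarrow>
    (\<forall>x. (\<forall>i<n. (\<Sum>k<n. A i k * x k) = 0) \<longrightarrow> (\<forall>k<n. x k = 0))"
  by (simp only: invertible_square_iff_det det_nonzero_iff_inj)

lemma invertible_square_transpose:
  "invertible_square n A \<Longrightarrow> invertible_square n (\<lambda>i j. A j i)"
proof -
  assume "invertible_square n A"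
  then obtain B where B: "\<And>i j. i < n \<Longrightarrow> j < n \<Longrightarrow>
      (\<Sum>k<n. A i k * B k j) = of_bool (i = j) \<and> (\<Sum>k<n. B i k * A k j) = of_bool (i = j)"
    unfolding invertible_square_def by blast
  have "(\<Sum>k<n. A k i * B j k) = of_bool (i = j) \<and> (\<Sum>k<n. B k i * A j k) = of_bool (i = j)"
    if "i < n" "j < n" for i j
    using B[OF that(2,1)] by (simp add: mult.commute eq_commute)
  then show "invertible_square n (\<lambda>i j. A j i)"
    unfolding invertible_square_def by (intro exI[of _ "\<lambda>i j. B j i"]) simp
qed

lemma invertible_square_iff_left_inj:
  "invertible_square n A \<longleftrightarrow>
    (\<forall>x. (\<forall>k<n. (\<Sum>i<n. x i * A i k) = 0) \<longrightarrow> (\<forall>i<n. x i = 0))"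
  using invertible_square_transpose[of n A] invertible_square_transpose[of n "\<lambda>i j. A j i"]
    invertible_square_iff_inj[of n "\<lambda>i j. A j i"]
  by (auto simp: mult.commute)

lemma invertible_square_surj:
  assumes "invertible_square n A"
  obtains x where "\<And>i. i < n \<Longrightarrow> (\<Sum>k<n. A i k * x k) = y i"
proof -
  obtain B where B: "\<And>i j. i < n \<Longrightarrow> j < n \<Longrightarrow> (\<Sum>k<n. A i k * B k j) = of_bool (i = j)"
    using assms unfolding invertible_square_def by blast
  show thesis
  proof (rule that[of "\<lambda>k. \<Sum>j<n. B k j * y j"])
    fix i assume i: "i < n"
    have "(\<Sum>k<n. A i k * (\<Sum>j<n. B k j * y j)) = (\<Sum>j<n. (\<Sum>k<n. A i k * B k j) * y j)"
      unfolding sum_distrib_left sum_distrib_right by (subst sum.swap) (simp add: mult.assoc)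
    also have "\<dots> = (\<Sum>j<n. of_bool (i = j) * y j)" using i by (intro sum.cong) (auto simp: B)
    finally show "(\<Sum>k<n. A i k * (\<Sum>j<n. B k j * y j)) = y i" using i by simp
  qed
qed

text \<open>The exceptional shifts are the negatives of the roots of the characteristic polynomial. This
  finiteness is used twice: it makes the invertible matrices dense, and it bounds the number of
  singular values of a matrix of finite rank.\<close>
lemma finite_singular_shifts:
  "finite {t. \<not> invertible_square n (\<lambda>i j. A i j + t * of_bool (i = j))}"
proof -
  let ?A = "Matrix.mat n n (\<lambda>(i, j). A i j)"
  have A: "?A \<in> carrier_mat n n" by simp
  have "\<not> invertible_square n (\<lambda>i j. A i j + t * of_bool (i = j)) \<longleftrightarrow> poly (char_poly ?A) (- t) = 0"
    for t
  proof -
    have "char_matrix ?A (- t) = Matrix.mat n n (\<lambda>(i, j). A i j + t * of_bool (i = j))"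
      unfolding char_matrix_def by (intro eq_matI) auto
    then show ?thesis
      using eigenvalue_root_char_poly[OF A, of "- t"] eigenvalue_det[OF A, of "- t"]
      by (simp add: invertible_square_iff_det)
  qed
  then have "{t. \<not> invertible_square n (\<lambda>i j. A i j + t * of_bool (i = j))}
      = uminus ` {x. poly (char_poly ?A) x = 0}"
    by (force simp: image_iff)
  moreover have "char_poly ?A \<noteq> 0"
    using degree_monic_char_poly[OF A] by auto
  ultimately show ?thesis by (simp add: poly_roots_finite)
qed

lemma tendsto_det:
  fixes A :: "'a \<Rightarrow> nat \<Rightarrow> nat \<Rightarrow> real"
  assumes "\<And>i j. i < n \<Longrightarrow> j < n \<Longrightarrow> ((\<lambda>w. A w i j) \<longlongrightarrow> A0 i j) F"
  shows "((\<lambda>w. Determinant.det (Matrix.mat n n (\<lambda>(i, j). A w i j)))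
           \<longlongrightarrow> Determinant.det (Matrix.mat n n (\<lambda>(i, j). A0 i j))) F"
proof -
  have "Determinant.det (Matrix.mat n n (\<lambda>(i, j). B i j)) =
      (\<Sum>p | p permutes {0..<n}. of_int (sign p) * (\<Prod>i=0..<n. B i (p i)))"
    for B :: "nat \<Rightarrow> nat \<Rightarrow> real"
    unfolding Determinant.det_def
    by (auto intro!: sum.cong prod.cong dest: permutes_in_image)
  then show ?thesis
    by (auto intro!: tendsto_sum tendsto_mult tendsto_const tendsto_prod assms dest: permutes_in_image)
qed

text \<open>By Cramer's rule the solution is a quotient of determinants.\<close>
text \<open>By Cramer's rule the solution is a quotient of determinants, which depend continuously on the
  entries.\<close>
lemma tendsto_linear_solution:
  fixes A :: "'a \<Rightarrow> nat \<Rightarrow> nat \<Rightarrow> real"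
  assumes A: "\<And>i j. i < n \<Longrightarrow> j < n \<Longrightarrow> ((\<lambda>w. A w i j) \<longlongrightarrow> A0 i j) F"
    and A0: "invertible_square n A0"
    and y: "\<And>i. i < n \<Longrightarrow> ((\<lambda>w. y w i) \<longlongrightarrow> y0 i) F"
    and sol: "eventually (\<lambda>w. \<forall>i<n. (\<Sum>k<n. A w i k * x w k) = y w i) F"
    and sol0: "\<And>i. i < n \<Longrightarrow> (\<Sum>k<n. A0 i k * x0 k) = y0 i"
    and k: "k < n"
  shows "((\<lambda>w. x w k) \<longlongrightarrow> x0 k) F"
proof -
  let ?d = "\<lambda>A. Determinant.det (Matrix.mat n n (\<lambda>(i, j). A i j))"
  let ?R = "\<lambda>A y i j. if j = k then y i else A i j"
  have cramer: "?d (?R B z) = v k * ?d B" if "\<And>i. i < n \<Longrightarrow> (\<Sum>k<n. B i k * v k) = z i"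
    for B :: "nat \<Rightarrow> nat \<Rightarrow> real" and v z
  proof -
    let ?B = "Matrix.mat n n (\<lambda>(i, j). B i j)"
    have "replace_col ?B (?B *\<^sub>v Matrix.vec n v) k = Matrix.mat n n (\<lambda>(i, j). ?R B z i j)"
      unfolding replace_col_def using that k
      by (intro eq_matI) (auto simp: scalar_prod_def lessThan_atLeast0)
    then show ?thesis using cramer_lemma_mat[of ?B n "Matrix.vec n v" k] k by simp
  qed
  have d0: "?d A0 \<noteq> 0" using A0 by (simp add: invertible_square_iff_det)
  have d: "((\<lambda>w. ?d (A w)) \<longlongrightarrow> ?d A0) F" by (rule tendsto_det[OF A])
  have "((\<lambda>w. ?d (?R (A w) (y w)) / ?d (A w)) \<longlongrightarrow> ?d (?R A0 y0) / ?d A0) F"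
    by (intro tendsto_divide tendsto_det d d0) (auto intro: A y)
  moreover have "?d (?R A0 y0) / ?d A0 = x0 k"
    using cramer[of A0 x0 y0] sol0 d0 by simp
  moreover have "eventually (\<lambda>w. ?d (?R (A w) (y w)) / ?d (A w) = x w k) F"
    using sol tendsto_imp_eventually_ne[OF d d0]
  proof eventually_elim
    case (elim w)
    then show ?case using cramer[of "A w" "x w" "y w"] by simp
  qed
  ultimately show ?thesis by (simp add: filterlim_cong[OF refl refl, symmetric] Lim_transform_eventually)
qed

lemma sum_of_bool_scaleR:
  fixes f :: "'i \<Rightarrow> 'a::real_vector"
  assumes "finite I" "j \<in> I"
  shows "(\<Sum>i\<in>I. of_bool (i = j) *\<^sub>R f i) = f j"
proof -
  have "(\<Sum>i\<in>I - {j}. of_bool (i = j) *\<^sub>R f i) = 0" by (intro sum.neutral) auto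
  then show ?thesis using assms by (simp add: sum.remove[of I j])
qed

lemma invertible_square_cong:
  assumes "\<And>i j. i < n \<Longrightarrow> j < n \<Longrightarrow> A i j = B i j"
  shows "invertible_square n A \<longleftrightarrow> invertible_square n B"
proof -
  have "(\<Sum>k<n. A i k * x k) = (\<Sum>k<n. B i k * x k)" if "i < n" for i x
    using assms that by (intro sum.cong) auto
  then show ?thesis unfolding invertible_square_iff_inj by simp
qed

lemma invertible_square_id: "invertible_square n (\<lambda>i j. of_bool (i = j))"
  unfolding invertible_square_iff_inj by simp

lemma combination_inverse:
  fixes F :: "nat \<Rightarrow> 'a::real_vector"
  assumes "\<And>l. l < n \<Longrightarrow> (\<Sum>k<n. P l k * Q k j) = of_bool (l = j)" "j < n"
  shows "(\<Sum>k<n. Q k j *\<^sub>R (\<Sum>l<n. P l k *\<^sub>R F l)) = F j"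
proof -
  have "(\<Sum>k<n. Q k j *\<^sub>R (\<Sum>l<n. P l k *\<^sub>R F l)) = (\<Sum>l<n. (\<Sum>k<n. P l k * Q k j) *\<^sub>R F l)"
    unfolding scaleR_sum_right scaleR_sum_left by (subst sum.swap) (simp add: mult.commute)
  also have "\<dots> = (\<Sum>l<n. of_bool (l = j) *\<^sub>R F l)" by (intro sum.cong) (auto simp: assms(1))
  also have "\<dots> = F j" using assms(2) by (simp add: sum_of_bool_scaleR)
  finally show ?thesis .
qed

text \<open>A family whose image spans as many dimensions as there are indices is injective and its image is
  a basis of its span.\<close>
lemma full_dim_imp_independent:
  fixes f :: "nat \<Rightarrow> 'a::euclidean_space"
  assumes "dim (f ` {..<n}) = n" "(\<Sum>m<n. x m *\<^sub>R f m) = 0" "m < n"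
  shows "x m = 0"
proof -
  let ?S = "f ` {..<n}"
  have "n \<le> card ?S" using assms(1) dim_le_card'[of ?S] by simp
  then have card: "card ?S = n" using card_image_le[of "{..<n}" f] by simp
  then have inj: "inj_on f {..<n}" by (intro eq_card_imp_inj_on) auto
  obtain B where B: "B \<subseteq> ?S" "independent B" "?S \<subseteq> span B" "card B = dim ?S"
    using basis_exists[of ?S] by blast
  then have "B = ?S" using card assms(1) by (intro card_subset_eq) auto
  with B have ind: "independent ?S" by simp
  have "(\<Sum>v\<in>?S. x (inv_into {..<n} f v) *\<^sub>R v) = 0"
    using assms(2) inj by (simp add: sum.reindex)
  then have "x (inv_into {..<n} f (f m)) = 0"
    using independentD[OF ind, of ?S "\<lambda>v. x (inv_into {..<n} f v)" "f m"] assms(3) by simp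
  then show ?thesis using inj assms(3) by simp
qed

no_notation vec_index (infixl "$" 100)

section \<open>Finite orthonormal systems\<close>

definition ons :: "nat \<Rightarrow> (nat \<Rightarrow> 'a::real_inner) \<Rightarrow> bool" where
  "ons n b \<longleftrightarrow> (\<forall>i<n. \<forall>j<n. inner (b i) (b j) = of_bool (i = j))"

lemma onsD: "ons n b \<Longrightarrow> i < n \<Longrightarrow> j < n \<Longrightarrow> inner (b i) (b j) = of_bool (i = j)"
  by (simp add: ons_def)

lemma orthonormal_sum:
  fixes b :: "'i \<Rightarrow> 'a::real_inner"
  assumes "finite I" "\<And>i j. i \<in> I \<Longrightarrow> j \<in> I \<Longrightarrow> inner (b i) (b j) = of_bool (i = j)"
    and f: "f = (\<Sum>i\<in>I. c i *\<^sub>R b i)"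
  shows "\<And>i. i \<in> I \<Longrightarrow> inner f (b i) = c i" "(norm f)\<^sup>2 = (\<Sum>i\<in>I. (c i)\<^sup>2)"
proof -
  show *: "inner f (b i) = c i" if "i \<in> I" for i
  proof -
    have "inner f (b i) = (\<Sum>j\<in>I. c j * of_bool (j = i))"
      unfolding f inner_sum_left using that assms(2) by (intro sum.cong) auto
    then show ?thesis using that assms(1) by simp
  qed
  have "(norm f)\<^sup>2 = inner f f" by (simp add: power2_norm_eq_inner)
  also have "\<dots> = (\<Sum>i\<in>I. c i * inner f (b i))"
    by (subst (2) f) (simp add: inner_sum_right)
  finally show "(norm f)\<^sup>2 = (\<Sum>i\<in>I. (c i)\<^sup>2)" by (simp add: * power2_eq_square)
qed

lemma bessel:
  fixes b :: "'i \<Rightarrow> 'a::real_inner"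
  assumes "finite I" "\<And>i j. i \<in> I \<Longrightarrow> j \<in> I \<Longrightarrow> inner (b i) (b j) = of_bool (i = j)"
  shows "(\<Sum>i\<in>I. (inner f (b i))\<^sup>2) \<le> (norm f)\<^sup>2"
proof -
  define g where "g = (\<Sum>i\<in>I. inner f (b i) *\<^sub>R b i)"
  have "(norm g)\<^sup>2 = (\<Sum>i\<in>I. (inner f (b i))\<^sup>2)" using orthonormal_sum(2)[OF assms g_def] .
  moreover have "inner f g = (\<Sum>i\<in>I. (inner f (b i))\<^sup>2)"
    by (simp add: g_def inner_sum_right power2_eq_square)
  moreover have "0 \<le> (norm (f - g))\<^sup>2" by simp
  moreover have "(norm (f - g))\<^sup>2 = (norm f)\<^sup>2 - 2 * inner f g + (norm g)\<^sup>2"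
    by (simp add: power2_norm_eq_inner inner_diff inner_commute)
  ultimately show ?thesis by simp
qed

text \<open>The bound on \<open>n\<close> is what lets \<open>orthonormalize_independent\<close> produce exactly as many vectors as were
  given.\<close>
lemma gram_schmidt_extend:
  fixes b :: "nat \<Rightarrow> 'a::real_inner"
  assumes "ons m b"
  shows "\<exists>n b'. m \<le> n \<and> n \<le> m + q \<and> ons n b' \<and> (\<forall>i<m. b' i = b i) \<and>
     (\<forall>k<q. v k = (\<Sum>l<n. inner (b' l) (v k) *\<^sub>R b' l))"
proof (induction q)
  case 0
  show ?case using assms by (intro exI[of _ m] exI[of _ b]) simp
next
  case (Suc q)
  then obtain n b' where n: "m \<le> n" "n \<le> m + q" "ons n b'" "\<forall>i<m. b' i = b i"
    and v: "\<forall>k<q. v k = (\<Sum>l<n. inner (b' l) (v k) *\<^sub>R b' l)" by auto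
  \<comment> \<open>the component of the new vector orthogonal to the system built so far\<close>
  define w where "w = v q - (\<Sum>l<n. inner (b' l) (v q) *\<^sub>R b' l)"
  have w_orth: "inner (b' i) w = 0" if "i < n" for i
  proof -
    have "(\<Sum>l<n. inner (b' l) (v q) * inner (b' i) (b' l)) = (\<Sum>l<n. inner (b' l) (v q) * of_bool (i = l))"
      using that by (intro sum.cong) (auto simp: onsD[OF n(3)])
    then show ?thesis using that by (simp add: w_def inner_diff_right inner_sum_right)
  qed
  show ?case
  proof (cases "w = 0")
    case True
    then have "v q = (\<Sum>l<n. inner (b' l) (v q) *\<^sub>R b' l)" by (simp add: w_def)
    then show ?thesis using n v by (intro exI[of _ n] exI[of _ b']) (auto simp: less_Suc_eq)
  next
    case False
    define b'' where "b'' = b'(n := w /\<^sub>R norm w)"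
    have lt: "b'' i = b' i" if "i < n" for i using that by (simp add: b''_def)
    have bn: "b'' n = w /\<^sub>R norm w" by (simp add: b''_def)
    have ons: "ons (Suc n) b''"
      unfolding ons_def
    proof (intro allI impI)
      fix i j assume "i < Suc n" "j < Suc n"
      then consider "i < n" "j < n" | "i = n" "j < n" | "i < n" "j = n" | "i = n" "j = n"
        by (auto simp: less_Suc_eq)
      then show "inner (b'' i) (b'' j) = of_bool (i = j)"
      proof cases
        case 4
        then show ?thesis using False by (simp add: bn dot_square_norm power2_eq_square)
      qed (auto simp: lt bn onsD[OF n(3)] w_orth inner_commute[of w])
    qed
    have old: "(\<Sum>l<Suc n. inner (b'' l) x *\<^sub>R b'' l)
        = (\<Sum>l<n. inner (b' l) x *\<^sub>R b' l) + inner (b'' n) x *\<^sub>R b'' n" for x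
      by (simp add: lt)
    have "v k = (\<Sum>l<Suc n. inner (b'' l) (v k) *\<^sub>R b'' l)" if k: "k < Suc q" for k
    proof (cases "k < q")
      case True
      then have vk: "v k = (\<Sum>l<n. inner (b' l) (v k) *\<^sub>R b' l)" using v by simp
      have "inner w (v k) = 0"
        by (subst vk) (simp add: inner_sum_right w_orth inner_commute[of w])
      then show ?thesis using vk by (simp only: old) (simp add: bn)
    next
      case False
      then have [simp]: "k = q" using k by simp
      have "inner w (v q) = inner w w"
        by (subst (3) w_def) (simp add: inner_diff_right inner_sum_right w_orth inner_commute[of w])
      then have "inner (b'' n) (v q) *\<^sub>R b'' n = w"
        using \<open>w \<noteq> 0\<close> by (simp add: bn dot_square_norm power2_eq_square field_simps)
      then show ?thesis by (simp only: old \<open>k = q\<close>) (simp add: w_def)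
    qed
    then show ?thesis using n ons lt
      by (intro exI[of _ "Suc n"] exI[of _ b'']) auto
  qed
qed

lemma orthonormal_span_expansion:
  fixes b :: "'i \<Rightarrow> 'a::real_inner"
  assumes I: "finite I" "\<And>i j. i \<in> I \<Longrightarrow> j \<in> I \<Longrightarrow> inner (b i) (b j) = of_bool (i = j)"
    and x: "x \<in> span (b ` I)"
  shows "x = (\<Sum>i\<in>I. inner x (b i) *\<^sub>R b i)"
proof -
  let ?S = "{x. x = (\<Sum>i\<in>I. inner x (b i) *\<^sub>R b i)}"
  have "subspace ?S"
  proof (rule subspaceI)
    fix x y assume xS: "x \<in> ?S" and yS: "y \<in> ?S"
    from xS have x: "x = (\<Sum>i\<in>I. inner x (b i) *\<^sub>R b i)" by (rule CollectD)
    from yS have y: "y = (\<Sum>i\<in>I. inner y (b i) *\<^sub>R b i)" by (rule CollectD)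
    have "(\<Sum>i\<in>I. inner (x + y) (b i) *\<^sub>R b i)
        = (\<Sum>i\<in>I. inner x (b i) *\<^sub>R b i) + (\<Sum>i\<in>I. inner y (b i) *\<^sub>R b i)"
      by (simp add: inner_add_left scaleR_add_left sum.distrib)
    also have "\<dots> = x + y" by (rule arg_cong2[where f = "(+)", OF x[symmetric] y[symmetric]])
    finally have "x + y = (\<Sum>i\<in>I. inner (x + y) (b i) *\<^sub>R b i)" by (rule sym)
    then show "x + y \<in> ?S" by (rule CollectI)
  next
    fix c :: real and x assume "x \<in> ?S"
    then have x: "x = (\<Sum>i\<in>I. inner x (b i) *\<^sub>R b i)" by (rule CollectD)
    have "(\<Sum>i\<in>I. inner (c *\<^sub>R x) (b i) *\<^sub>R b i) = c *\<^sub>R (\<Sum>i\<in>I. inner x (b i) *\<^sub>R b i)"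
      by (simp add: scaleR_sum_right)
    also have "\<dots> = c *\<^sub>R x" by (rule arg_cong[OF x[symmetric]])
    finally have "c *\<^sub>R x = (\<Sum>i\<in>I. inner (c *\<^sub>R x) (b i) *\<^sub>R b i)" by (rule sym)
    then show "c *\<^sub>R x \<in> ?S" by (rule CollectI)
  qed simp
  moreover have "b ` I \<subseteq> ?S"
  proof safe
    fix j assume j: "j \<in> I"
    have "(\<Sum>i\<in>I. inner (b j) (b i) *\<^sub>R b i) = (\<Sum>i\<in>I. of_bool (i = j) *\<^sub>R b i)"
      using j by (intro sum.cong) (auto simp: I)
    also have "\<dots> = b j" using I(1) j by (rule sum_of_bool_scaleR)
    finally show "b j = (\<Sum>i\<in>I. inner (b j) (b i) *\<^sub>R b i)" by simp
  qed
  ultimately have "span (b ` I) \<subseteq> ?S" by (intro span_minimal)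
  then show ?thesis using x by blast
qed

lemma parseval:
  fixes b :: "'i \<Rightarrow> 'a::real_inner"
  assumes I: "finite I" "\<And>i j. i \<in> I \<Longrightarrow> j \<in> I \<Longrightarrow> inner (b i) (b j) = of_bool (i = j)"
    and x: "x \<in> span (b ` I)"
  shows "inner y x = (\<Sum>i\<in>I. inner y (b i) * inner x (b i))"
    and "(norm x)\<^sup>2 = (\<Sum>i\<in>I. (inner x (b i))\<^sup>2)"
proof -
  have "inner y x = inner y (\<Sum>i\<in>I. inner x (b i) *\<^sub>R b i)" for y
    using orthonormal_span_expansion[OF I x] by simp
  then show *: "inner y x = (\<Sum>i\<in>I. inner y (b i) * inner x (b i))" for y
    by (simp add: inner_sum_right mult.commute)
  show "(norm x)\<^sup>2 = (\<Sum>i\<in>I. (inner x (b i))\<^sup>2)"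
    unfolding power2_norm_eq_inner * by (simp add: power2_eq_square)
qed

text \<open>Gram-Schmidt yields at most \<open>n\<close> vectors. With fewer, the square coefficient matrix would have a
  zero row, although the independence of \<open>V\<close> makes it invertible.\<close>
lemma orthonormalize_independent:
  fixes V :: "nat \<Rightarrow> 'a::real_inner"
  assumes indep: "\<And>x k. (\<Sum>k<n. x k *\<^sub>R V k) = 0 \<Longrightarrow> k < n \<Longrightarrow> x k = 0"
  shows "\<exists>b. ons n b \<and> (\<forall>k<n. V k = (\<Sum>l<n. inner (b l) (V k) *\<^sub>R b l)) \<and>
    invertible_square n (\<lambda>l k. inner (b l) (V k))"
proof -
  have "ons 0 (\<lambda>_::nat. 0 :: 'a)" by (simp add: ons_def)
  from gram_schmidt_extend[OF this, of n V] obtain m b where m: "m \<le> n" and b: "ons m b"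
    and V: "\<And>k. k < n \<Longrightarrow> V k = (\<Sum>l<m. inner (b l) (V k) *\<^sub>R b l)" by auto
  define B where "B l k = (if l < m then inner (b l) (V k) else 0)" for l k
  have inv: "invertible_square n B"
    unfolding invertible_square_iff_inj
  proof (intro allI impI)
    fix x k assume x: "\<forall>i<n. (\<Sum>k<n. B i k * x k) = 0" and k: "k < n"
    have "(\<Sum>k<n. x k *\<^sub>R V k) = (\<Sum>k<n. x k *\<^sub>R (\<Sum>l<m. inner (b l) (V k) *\<^sub>R b l))"
      by (intro sum.cong refl arg_cong[where f = "\<lambda>v. _ *\<^sub>R v"] V) simp
    also have "\<dots> = (\<Sum>l<m. (\<Sum>k<n. B l k * x k) *\<^sub>R b l)"
      unfolding scaleR_sum_right scaleR_sum_left by (subst sum.swap) (simp add: mult.commute B_def)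
    also have "\<dots> = 0" using x m by simp
    finally show "x k = 0" using indep k by blast
  qed
  have "m = n"
  proof (rule ccontr)
    assume "m \<noteq> n"
    then have "m < n" using m by simp
    obtain x where "\<And>i. i < n \<Longrightarrow> (\<Sum>k<n. B i k * x k) = 1"
      using invertible_square_surj[OF inv, of "\<lambda>_. 1"] by blast
    from this[OF \<open>m < n\<close>] show False by (simp add: B_def)
  qed
  then show ?thesis using b V inv invertible_square_cong[of n B "\<lambda>l k. inner (b l) (V k)"]
    by (intro exI[of _ b]) (auto simp: B_def)
qed

text \<open>The coefficients solve the normal equations, whose Gram matrix is invertible because the \<open>a m\<close> are
  independent.\<close>
lemma orthogonal_residuals:
  fixes a d :: "nat \<Rightarrow> 'k::real_inner"
  assumes "\<And>x m. (\<Sum>m<r. x m *\<^sub>R a m) = 0 \<Longrightarrow> m < r \<Longrightarrow> x m = 0"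
  shows "\<exists>\<gamma>. \<forall>k. \<forall>m<r. inner (d k - (\<Sum>j<r. \<gamma> k j *\<^sub>R a j)) (a m) = 0"
proof -
  have inv: "invertible_square r (\<lambda>i j. inner (a i) (a j))"
    unfolding invertible_square_iff_inj
  proof (intro allI impI)
    fix x k assume x: "\<forall>i<r. (\<Sum>k<r. inner (a i) (a k) * x k) = 0" and k: "k < r"
    have "inner (a i) (\<Sum>m<r. x m *\<^sub>R a m) = 0" if "i < r" for i
      using x that by (simp add: inner_sum_right mult.commute)
    then have "inner (\<Sum>m<r. x m *\<^sub>R a m) (\<Sum>m<r. x m *\<^sub>R a m) = 0"
      by (subst inner_sum_left) simp
    then show "x k = 0" using assms k by simp
  qed
  have "\<exists>y. \<forall>m<r. inner (d k - (\<Sum>j<r. y j *\<^sub>R a j)) (a m) = 0" for k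
  proof -
    obtain y where y: "\<And>m. m < r \<Longrightarrow> (\<Sum>j<r. inner (a m) (a j) * y j) = inner (a m) (d k)"
      using invertible_square_surj[OF inv, of "\<lambda>m. inner (a m) (d k)"] by blast
    have "inner (d k - (\<Sum>j<r. y j *\<^sub>R a j)) (a m) = 0" if "m < r" for m
      using y[OF that]
      by (simp add: inner_diff_right inner_sum_right inner_commute[of _ "a m"] mult.commute)
    then show ?thesis by blast
  qed
  then show ?thesis by (intro choice allI)
qed

section \<open>The smallest singular value\<close>

lemma norm_sum_scaleR_sq:
  fixes a :: "nat \<Rightarrow> 'k::real_inner"
  shows "(norm (\<Sum>m<r. x m *\<^sub>R a m))\<^sup>2 = (\<Sum>m<r. x m * inner (\<Sum>m<r. x m *\<^sub>R a m) (a m))"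
  by (simp add: power2_norm_eq_inner inner_sum_right)

text \<open>The quadratic form \<open>x \<mapsto> (norm (\<Sum> x m a m))\<^sup>2\<close> attains its minimum on the unit sphere, and the
  minimiser is an eigenvector of the Gram matrix of \<open>a\<close>, by the first-order condition.\<close>
lemma minimal_combination:
  fixes a :: "nat \<Rightarrow> 'k::real_inner"
  assumes r: "0 < r"
  shows "\<exists>x. (\<Sum>m<r. (x m)\<^sup>2) = (1::real) \<and>
    (\<forall>y. (norm (\<Sum>m<r. x m *\<^sub>R a m))\<^sup>2 * (\<Sum>m<r. (y m)\<^sup>2) \<le> (norm (\<Sum>m<r. y m *\<^sub>R a m))\<^sup>2) \<and>
    (\<forall>m<r. inner (\<Sum>m<r. x m *\<^sub>R a m) (a m) = (norm (\<Sum>m<r. x m *\<^sub>R a m))\<^sup>2 * x m)"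
proof -
  \<comment> \<open>vectors of length \<open>r\<close> are functions on \<open>nat\<close> that vanish from \<open>r\<close> on, so that the unit sphere is
      compact in the product topology\<close>
  define B where "B = PiE UNIV (\<lambda>i. if i < r then {-1..1} else {0::real})"
  define K where "K = B \<inter> {x. (\<Sum>m<r. (x m)\<^sup>2) = 1}"
  define q where "q x = (norm (\<Sum>m<r. x m *\<^sub>R a m))\<^sup>2" for x
  have cont: "continuous_on UNIV (\<lambda>x::nat \<Rightarrow> real. x i)" for i
    by (rule continuous_on_product_coordinates)
  have "compactin (product_topology (\<lambda>_. euclidean) UNIV) B"
    unfolding B_def compactin_PiE by (auto simp: compactin_euclidean_iff)
  then have "compact B" by (simp add: euclidean_product_topology compactin_euclidean_iff)
  moreover have "closed {x::nat \<Rightarrow> real. (\<Sum>m<r. (x m)\<^sup>2) = 1}"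
    by (intro closed_Collect_eq continuous_intros cont)
  ultimately have K: "compact K" unfolding K_def by (rule compact_Int_closed)
  have sq: "(\<Sum>m<r. (of_bool (m = 0) :: real)\<^sup>2) = 1"
    using r by (simp add: power2_eq_square)
  then have "(\<lambda>i. of_bool (i = 0)) \<in> K" using r by (auto simp: K_def B_def)
  then have "K \<noteq> {}" by blast
  moreover have "continuous_on K q"
    unfolding q_def by (intro continuous_intros continuous_on_subset[OF cont] subset_UNIV)
  ultimately obtain x where x: "x \<in> K" "\<And>y. y \<in> K \<Longrightarrow> q x \<le> q y"
    using continuous_attains_inf[OF K, of q] by blast
  have x1: "(\<Sum>m<r. (x m)\<^sup>2) = 1" using x(1) by (simp add: K_def)
  have hom: "q (\<lambda>m. c * y m) = c\<^sup>2 * q y" for c y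
  proof -
    have "(\<Sum>m<r. (c * y m) *\<^sub>R a m) = c *\<^sub>R (\<Sum>m<r. y m *\<^sub>R a m)" by (simp add: scaleR_sum_right)
    then show ?thesis by (simp add: q_def power_mult_distrib)
  qed
  have min: "q x * (\<Sum>m<r. (y m)\<^sup>2) \<le> q y" for y
  proof (cases "(\<Sum>m<r. (y m)\<^sup>2) = 0")
    case True
    then show ?thesis by (simp add: q_def)
  next
    case False
    define N where "N = (\<Sum>m<r. (y m)\<^sup>2)"
    have N: "N > 0" using False by (simp add: N_def less_le sum_nonneg)
    define z where "z m = (if m < r then y m / sqrt N else 0)" for m
    have z1: "(\<Sum>m<r. (z m)\<^sup>2) = 1"
      using N by (simp add: z_def power_divide flip: sum_divide_distrib) (simp add: N_def)
    have "\<bar>z m\<bar> \<le> 1" if "m < r" for m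
    proof -
      have "(z m)\<^sup>2 \<le> (\<Sum>m<r. (z m)\<^sup>2)" using that by (intro member_le_sum) auto
      then show ?thesis using z1 by (simp add: abs_square_le_1)
    qed
    then have "- 1 \<le> z m" "z m \<le> 1" if "m < r" for m using that by (auto simp: abs_le_iff minus_le_iff)
    moreover have "z m = 0" if "\<not> m < r" for m using that by (simp add: z_def)
    ultimately have "z \<in> B" unfolding B_def PiE_iff by auto
    then have "z \<in> K" using z1 by (simp add: K_def)
    then have "q x \<le> q z" by (rule x(2))
    also have "q z = q (\<lambda>m. (1 / sqrt N) * y m)" by (simp add: q_def z_def)
    also have "\<dots> = q y / N" unfolding hom using N by (simp add: power_divide)
    finally show ?thesis using N by (simp add: field_simps N_def)
  qed
  have eig: "inner (\<Sum>m<r. x m *\<^sub>R a m) (a j) = q x * x j" if j: "j < r" for j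
  proof -
    let ?w = "\<Sum>m<r. x m *\<^sub>R a m"
    define g where "g = inner ?w (a j) - q x * x j"
    define M where "M = (norm (a j))\<^sup>2 - q x"
    have quad: "0 \<le> 2 * t * g + t\<^sup>2 * M" for t
    proof -
      \<comment> \<open>minimality at \<open>x\<close>, tested in the direction of the \<open>j\<close>-th unit vector\<close>
      define y where "y m = x m + t * of_bool (m = j)" for m
      have "(\<Sum>m<r. y m *\<^sub>R a m) = ?w + (\<Sum>m<r. (t * of_bool (m = j)) *\<^sub>R a m)"
        by (simp add: y_def scaleR_add_left sum.distrib)
      also have "(\<Sum>m<r. (t * of_bool (m = j)) *\<^sub>R a m) = t *\<^sub>R a j"
        using j by (subst sum.remove[of _ j]) auto
      finally have qy: "q y = q x + 2 * t * inner ?w (a j) + t\<^sup>2 * (norm (a j))\<^sup>2"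
        unfolding q_def power2_norm_eq_inner
        by (simp add: inner_add inner_commute power2_eq_square algebra_simps)
      have "(\<Sum>m<r. (y m)\<^sup>2) = (\<Sum>m<r. (x m)\<^sup>2 + (if m = j then 2 * t * x j + t\<^sup>2 else 0))"
        by (intro sum.cong) (auto simp: y_def power2_eq_square algebra_simps)
      also have "\<dots> = 1 + 2 * t * x j + t\<^sup>2" using j by (simp add: sum.distrib x1)
      finally show ?thesis using min[of y] by (simp add: qy g_def M_def algebra_simps)
    qed
    have "g = 0"
    proof (rule ccontr)
      assume g: "g \<noteq> 0"
      \<comment> \<open>a nonzero linear term would win for small \<open>t\<close> of the opposite sign\<close>
      define t where "t = - g / (\<bar>M\<bar> + 1)"
      have t: "t * (\<bar>M\<bar> + 1) = - g" by (simp add: t_def add_nonneg_eq_0_iff)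
      have "2 * t * g + t\<^sup>2 * M \<le> 2 * t * g + t\<^sup>2 * (\<bar>M\<bar> + 1)"
        by (intro add_left_mono mult_left_mono) auto
      also have "\<dots> = t * g" by (simp only: power2_eq_square mult.assoc t)
      also have "\<dots> = - (g\<^sup>2 / (\<bar>M\<bar> + 1))" by (simp add: t_def power2_eq_square)
      also have "\<dots> < 0" using g by (simp add: divide_pos_pos)
      finally show False using quad[of t] by simp
    qed
    then show ?thesis by (simp add: g_def)
  qed
  show ?thesis using x1 min eig unfolding q_def by (intro exI[of _ x] conjI) auto
qed

lemma inner_eq_infsum: "(\<Sum>\<^sub>\<infinity>i. ell2_nth x i * ell2_nth y i) = inner x y"
  by (simp add: inner_ell2_def)

text \<open>Passing to coordinates with respect to \<open>u\<close> turns singular pairs of \<open>A\<close> into unit eigenvectors of the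
  Gram matrix of \<open>a\<close>, whose eigenvalues are the squares of the singular values. The least of them is
  the minimum found in \<open>minimal_combination\<close>.\<close>
lemma singular_values_of_expansion:
  fixes u :: "nat \<Rightarrow> 'a ell2" and a :: "nat \<Rightarrow> 'b ell2"
  assumes u: "ons r u" and r: "0 < r"
    and A: "\<And>i j. A i j = (\<Sum>m<r. ell2_nth (u m) i * ell2_nth (a m) j)"
    and indep: "\<And>x m. (\<Sum>m<r. x m *\<^sub>R a m) = 0 \<Longrightarrow> m < r \<Longrightarrow> x m = 0"
  defines "s \<equiv> Min (positive_singular_values A)"
  shows "s > 0"
    and "\<And>x. s\<^sup>2 * (\<Sum>m<r. (x m)\<^sup>2) \<le> (norm (\<Sum>m<r. x m *\<^sub>R a m))\<^sup>2"
    and "\<exists>x. (\<Sum>m<r. (x m)\<^sup>2) = 1 \<and> (norm (\<Sum>m<r. x m *\<^sub>R a m))\<^sup>2 = s\<^sup>2"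
proof -
  have row: "(\<lambda>b. A i b) = ell2_nth (\<Sum>m<r. ell2_nth (u m) i *\<^sub>R a m)" for i
    by (rule ext) (simp add: A ell2_nth_sum ell2_nth_scaleR)
  have col: "(\<lambda>i. A i b) = ell2_nth (\<Sum>m<r. ell2_nth (a m) b *\<^sub>R u m)" for b
    by (rule ext) (simp add: A ell2_nth_sum ell2_nth_scaleR mult.commute)
  have Av: "(\<Sum>\<^sub>\<infinity>b. A i b * ell2_nth v b) = ell2_nth (\<Sum>m<r. inner (a m) v *\<^sub>R u m) i" for i v
    using fun_cong[OF row[of i]] inner_eq_infsum[of "\<Sum>m<r. ell2_nth (u m) i *\<^sub>R a m" v]
    by (simp add: inner_sum_left ell2_nth_sum ell2_nth_scaleR mult.commute)
  have Au: "(\<Sum>\<^sub>\<infinity>i. A i b * ell2_nth w i) = ell2_nth (\<Sum>m<r. inner (u m) w *\<^sub>R a m) b" for b w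
    using fun_cong[OF col[of b]] inner_eq_infsum[of "\<Sum>m<r. ell2_nth (a m) b *\<^sub>R u m" w]
    by (simp add: inner_sum_left ell2_nth_sum ell2_nth_scaleR mult.commute)
  have psv: "positive_singular_values A = {s. s > 0 \<and> (\<exists>w v. norm w = 1 \<and> norm v = 1 \<and>
     (\<Sum>m<r. inner (a m) v *\<^sub>R u m) = s *\<^sub>R w \<and> (\<Sum>m<r. inner (u m) w *\<^sub>R a m) = s *\<^sub>R v)}"
    unfolding positive_singular_values_def Av Au
    by (simp add: ell2_nth_scaleR[symmetric] ell2_nth_inject[symmetric] fun_eq_iff)
  have ortho: "i \<in> {..<r} \<Longrightarrow> j \<in> {..<r} \<Longrightarrow> inner (u i) (u j) = of_bool (i = j)" for i j
    using onsD[OF u] by simp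
  have eigen: "\<exists>x. (\<Sum>m<r. (x m)\<^sup>2) = 1 \<and>
      (\<forall>m<r. inner (\<Sum>m<r. x m *\<^sub>R a m) (a m) = t\<^sup>2 * x m)"
    if "t \<in> positive_singular_values A" for t
  proof -
    from that obtain w v where t: "t > 0" "norm w = 1" "norm v = 1"
      and w: "(\<Sum>m<r. inner (a m) v *\<^sub>R u m) = t *\<^sub>R w"
      and v: "(\<Sum>m<r. inner (u m) w *\<^sub>R a m) = t *\<^sub>R v" unfolding psv by blast
    have "w = (1 / t) *\<^sub>R (t *\<^sub>R w)" using t by simp
    also have "\<dots> = (\<Sum>m<r. (inner (a m) v / t) *\<^sub>R u m)"
      unfolding w[symmetric] by (simp add: scaleR_sum_right)
    finally have w': "w = (\<Sum>m<r. (inner (a m) v / t) *\<^sub>R u m)" .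
    note os = orthonormal_sum[OF finite_lessThan ortho w']
    have x: "inner (u m) w = inner (a m) v / t" if "m < r" for m
      using os(1)[of m] that by (simp add: inner_commute)
    have "(\<Sum>m<r. (inner (u m) w)\<^sup>2) = 1" using os(2) t(2) x by simp
    moreover have "inner (\<Sum>m<r. inner (u m) w *\<^sub>R a m) (a m) = t\<^sup>2 * inner (u m) w" if "m < r" for m
      unfolding v using x[OF that] t(1) by (simp add: inner_commute power2_eq_square)
    ultimately show ?thesis by (intro exI[of _ "\<lambda>m. inner (u m) w"]) simp
  qed
  obtain x where x1: "(\<Sum>m<r. (x m)\<^sup>2) = (1::real)"
    and xmin: "\<And>y. (norm (\<Sum>m<r. x m *\<^sub>R a m))\<^sup>2 * (\<Sum>m<r. (y m)\<^sup>2)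
        \<le> (norm (\<Sum>m<r. y m *\<^sub>R a m))\<^sup>2"
    and xeig: "\<And>m. m < r \<Longrightarrow>
        inner (\<Sum>m<r. x m *\<^sub>R a m) (a m) = (norm (\<Sum>m<r. x m *\<^sub>R a m))\<^sup>2 * x m"
    using minimal_combination[OF r, of a] by blast
  define s0 where "s0 = norm (\<Sum>m<r. x m *\<^sub>R a m)"
  have "(\<Sum>m<r. x m *\<^sub>R a m) \<noteq> 0"
  proof
    assume "(\<Sum>m<r. x m *\<^sub>R a m) = 0"
    then have "x m = 0" if "m < r" for m using indep that by blast
    then have "(\<Sum>m<r. (x m)\<^sup>2) = 0" by simp
    then show False using x1 by simp
  qed
  then have s0: "s0 > 0" by (simp add: s0_def)
  have s0_in: "s0 \<in> positive_singular_values A"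
  proof -
    define w where "w = (\<Sum>m<r. x m *\<^sub>R u m)"
    define v where "v = (1 / s0) *\<^sub>R (\<Sum>m<r. x m *\<^sub>R a m)"
    note os = orthonormal_sum[OF finite_lessThan ortho w_def]
    have wx: "inner (u m) w = x m" if "m < r" for m using os(1)[of m] that by (simp add: inner_commute)
    have "(norm w)\<^sup>2 = 1\<^sup>2" using os(2) x1 by simp
    then have nw: "norm w = 1" by (rule power2_eq_imp_eq) auto
    have nv: "norm v = 1" using s0 by (simp add: v_def s0_def)
    have "inner (a m) v = s0 * x m" if "m < r" for m
      using xeig[OF that] s0 by (simp add: v_def inner_commute power2_eq_square s0_def)
    then have "(\<Sum>m<r. inner (a m) v *\<^sub>R u m) = s0 *\<^sub>R w"
      by (simp add: w_def scaleR_sum_right)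
    moreover have "(\<Sum>m<r. inner (u m) w *\<^sub>R a m) = s0 *\<^sub>R v"
      using s0 by (simp add: wx v_def)
    ultimately show ?thesis unfolding psv using s0 nw nv by blast
  qed
  have s0_le: "s0 \<le> t" if t: "t \<in> positive_singular_values A" for t
  proof -
    obtain y where y: "(\<Sum>m<r. (y m)\<^sup>2) = 1"
      "\<And>m. m < r \<Longrightarrow> inner (\<Sum>m<r. y m *\<^sub>R a m) (a m) = t\<^sup>2 * y m"
      using eigen[OF t] by blast
    have "(norm (\<Sum>m<r. y m *\<^sub>R a m))\<^sup>2 = (\<Sum>m<r. y m * (t\<^sup>2 * y m))"
      unfolding norm_sum_scaleR_sq by (intro sum.cong) (auto simp: y(2))
    also have "\<dots> = t\<^sup>2 * (\<Sum>m<r. (y m)\<^sup>2)"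
      by (simp add: sum_distrib_left power2_eq_square mult_ac)
    finally have "s0\<^sup>2 \<le> t\<^sup>2" using xmin[of y] by (simp add: y(1) s0_def)
    moreover have "t > 0" using t by (simp add: psv)
    ultimately show ?thesis by (metis less_le power2_le_imp_le)
  qed
  have fin: "finite (positive_singular_values A)"
  proof -
    have "- (t\<^sup>2) \<in> {c. \<not> invertible_square r (\<lambda>i j. inner (a i) (a j) + c * of_bool (i = j))}"
      if t: "t \<in> positive_singular_values A" for t
    proof -
      obtain y where y: "(\<Sum>m<r. (y m)\<^sup>2) = 1"
        "\<And>m. m < r \<Longrightarrow> inner (\<Sum>m<r. y m *\<^sub>R a m) (a m) = t\<^sup>2 * y m"
        using eigen[OF t] by blast
      have "(\<Sum>k<r. (inner (a i) (a k) + - (t\<^sup>2) * of_bool (i = k)) * y k) = 0" if i: "i < r" for i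
      proof -
        have "(\<Sum>k<r. (inner (a i) (a k) + - (t\<^sup>2) * of_bool (i = k)) * y k)
            = (\<Sum>k<r. inner (a i) (a k) * y k) + - (t\<^sup>2) * (\<Sum>k<r. of_bool (i = k) * y k)"
          by (simp only: distrib_right sum.distrib sum_distrib_left mult.assoc)
        moreover have "(\<Sum>k<r. inner (a i) (a k) * y k) = inner (\<Sum>m<r. y m *\<^sub>R a m) (a i)"
          by (simp add: inner_sum_left inner_sum_right mult.commute inner_commute[of _ "a i"])
        ultimately have "(\<Sum>k<r. (inner (a i) (a k) + - (t\<^sup>2) * of_bool (i = k)) * y k)
            = t\<^sup>2 * y i - t\<^sup>2 * (\<Sum>k<r. of_bool (i = k) * y k)"
          using i by (simp only: y(2))
        then show ?thesis using i by simp
      qed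
      moreover have "\<not> (\<forall>k<r. y k = 0)"
      proof
        assume "\<forall>k<r. y k = 0"
        then have "(\<Sum>m<r. (y m)\<^sup>2) = 0" by simp
        then show False using y(1) by simp
      qed
      ultimately show ?thesis unfolding invertible_square_iff_inj by auto
    qed
    then have "finite ((\<lambda>t. - (t\<^sup>2)) ` positive_singular_values A)"
      by (intro finite_subset[OF _ finite_singular_shifts[of r "\<lambda>i j. inner (a i) (a j)"]] image_subsetI)
    moreover have "inj_on (\<lambda>t. - (t\<^sup>2)) (positive_singular_values A)"
      by (intro inj_onI) (auto simp: psv power2_eq_iff_nonneg)
    ultimately show ?thesis by (rule finite_imageD)
  qed
  have "s = s0" unfolding s_def using fin s0_in s0_le by (intro Min_eqI)
  then show "s > 0" "s\<^sup>2 * (\<Sum>m<r. (y m)\<^sup>2) \<le> (norm (\<Sum>m<r. y m *\<^sub>R a m))\<^sup>2"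
      "\<exists>x. (\<Sum>m<r. (x m)\<^sup>2) = 1 \<and> (norm (\<Sum>m<r. x m *\<^sub>R a m))\<^sup>2 = s\<^sup>2" for y
    using s0 xmin x1 by (auto simp: s0_def)
qed

section \<open>Perturbation of matrices of fixed rank\<close>

text \<open>Let \<open>S\<close> be the coordinate subspace of the first \<open>r\<close> indices, which is the column space of the matrix
  \<open>A\<close> with rows \<open>a l\<close> and zero rows from \<open>r\<close> on, and let \<open>S'\<close> be the range of \<open>V\<close>, which contains the
  column space of the matrix \<open>B\<close> with rows \<open>\<Sum> V l k d k\<close>. A vector of \<open>S\<close> is \<open>A t\<close> with
  \<open>\<sigma> * norm t \<le> norm (A t)\<close>, hence it has relative distance at most \<open>norm (A - B) / \<sigma>\<close> from \<open>B t\<close>. If this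
  ratio is less than one, then \<open>B t\<close> runs through all of \<open>S'\<close>, because \<open>S\<close> has dimension \<open>r\<close> and \<open>S'\<close>
  at most \<open>r\<close>; and the relative distance between the lines through \<open>A t\<close> and \<open>B t\<close> is symmetric. So vectors of
  \<open>S'\<close> are as close to \<open>S\<close> as vectors of \<open>S\<close> are to \<open>S'\<close>.\<close>
lemma subspace_angle_bound:
  fixes a d :: "nat \<Rightarrow> 'k::real_inner" and V :: "nat \<Rightarrow> nat \<Rightarrow> real"
  assumes rn: "r \<le> n" and s: "\<sigma> > 0"
    and low: "\<And>x. \<sigma>\<^sup>2 * (\<Sum>m<r. (x m)\<^sup>2) \<le> (norm (\<Sum>m<r. x m *\<^sub>R a m))\<^sup>2"
  defines "e \<equiv> (\<Sum>l<n. (norm ((if l < r then a l else 0) - (\<Sum>k<r. V l k *\<^sub>R d k)))\<^sup>2)"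
  shows "(\<Sum>l=r..<n. (\<Sum>k<r. V l k * x k)\<^sup>2) \<le> e / \<sigma>\<^sup>2 * (\<Sum>l<n. (\<Sum>k<r. V l k * x k)\<^sup>2)"
proof -
  define q where "q = e / \<sigma>\<^sup>2"
  define v where "v x l = (\<Sum>k<r. V l k * x k)" for x l
  define N where "N = (\<Sum>l<n. (v x l)\<^sup>2)"
  have split: "(\<Sum>l<n. f l) = (\<Sum>l<r. f l) + (\<Sum>l=r..<n. f l)" for f :: "nat \<Rightarrow> real"
    using sum.atLeastLessThan_concat[of 0 r n f] rn by (simp add: lessThan_atLeast0)
  have e0: "e \<ge> 0" by (simp add: e_def sum_nonneg)
  have N0: "N \<ge> 0" by (simp add: N_def sum_nonneg)
  have tail: "(\<Sum>l=r..<n. (v x l)\<^sup>2) \<le> N"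
    by (simp add: N_def split sum_nonneg)
  have "(\<Sum>l=r..<n. (v x l)\<^sup>2) \<le> q * N"
  proof (cases "q \<ge> 1")
    case True
    then have "1 * N \<le> q * N" using N0 by (intro mult_right_mono)
    then show ?thesis using tail by simp
  next
    case False
    \<comment> \<open>\<open>\<alpha> h\<close> and \<open>v (p h)\<close> are the images of \<open>t h\<close> under the two matrices\<close>
    define t where "t h = (\<Sum>m<r. h m *\<^sub>R a m)" for h
    define \<alpha> where "\<alpha> h m = inner (t h) (a m)" for h m
    define A where "A h = (\<Sum>m<r. (\<alpha> h m)\<^sup>2)" for h
    define p where "p h k = inner (t h) (d k)" for h k
    have A0: "A h \<ge> 0" for h by (simp add: A_def sum_nonneg)
    have tA: "\<sigma>\<^sup>2 * (norm (t h))\<^sup>2 \<le> A h" for h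
    proof (cases "t h = 0")
      case False
      have "((norm (t h))\<^sup>2)\<^sup>2 = (\<Sum>m<r. h m * \<alpha> h m)\<^sup>2"
        unfolding t_def \<alpha>_def by (simp only: norm_sum_scaleR_sq[of h a r])
      also have "\<dots> \<le> (\<Sum>m<r. (h m)\<^sup>2) * A h"
        unfolding A_def by (rule Cauchy_Schwarz_ineq_sum)
      finally have "\<sigma>\<^sup>2 * ((norm (t h))\<^sup>2)\<^sup>2 \<le> \<sigma>\<^sup>2 * ((\<Sum>m<r. (h m)\<^sup>2) * A h)"
        by (intro mult_left_mono) auto
      also have "\<dots> \<le> (norm (t h))\<^sup>2 * A h"
        using mult_right_mono[OF low[of h] A0[of h]] by (simp add: t_def mult.assoc)
      finally have "(norm (t h))\<^sup>2 * (\<sigma>\<^sup>2 * (norm (t h))\<^sup>2) \<le> (norm (t h))\<^sup>2 * A h"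
        by (simp add: power2_eq_square mult_ac)
      then show ?thesis using False by (subst (asm) mult_le_cancel_left_pos) auto
    qed (simp add: A0)
    have dist: "(\<Sum>l<n. ((if l < r then \<alpha> h l else 0) - v (p h) l)\<^sup>2) \<le> q * A h" for h
    proof -
      have "(if l < r then \<alpha> h l else 0) - v (p h) l
          = inner (t h) ((if l < r then a l else 0) - (\<Sum>k<r. V l k *\<^sub>R d k))" for l
        by (simp add: \<alpha>_def v_def p_def inner_diff_right inner_sum_right)
      then have "(\<Sum>l<n. ((if l < r then \<alpha> h l else 0) - v (p h) l)\<^sup>2)
          \<le> (\<Sum>l<n. (norm (t h))\<^sup>2 * (norm ((if l < r then a l else 0) - (\<Sum>k<r. V l k *\<^sub>R d k)))\<^sup>2)"
        by (intro sum_mono) (metis Cauchy_Schwarz_ineq power2_norm_eq_inner)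
      also have "\<dots> = (norm (t h))\<^sup>2 * e" by (simp add: e_def sum_distrib_left)
      also have "\<dots> = q * (\<sigma>\<^sup>2 * (norm (t h))\<^sup>2)" using s by (simp add: q_def)
      also have "\<dots> \<le> q * A h" using tA e0 by (intro mult_left_mono) (auto simp: q_def)
      finally show ?thesis .
    qed
    have h0: "h m = 0" if "A h = 0" "m < r" for h m
    proof -
      have "\<sigma>\<^sup>2 * (norm (t h))\<^sup>2 \<le> 0" using tA[of h] that by simp
      then have "t h = 0" using s by (simp add: mult_le_0_iff)
      then have "\<sigma>\<^sup>2 * (\<Sum>m<r. (h m)\<^sup>2) \<le> 0" using low[of h] by (simp add: t_def)
      then have "(\<Sum>m<r. (h m)\<^sup>2) = 0"
        using s by (simp add: mult_le_0_iff) (meson antisym sum_nonneg zero_le_power2)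
      then show ?thesis using that by (simp add: sum_nonneg_eq_0_iff)
    qed
    have pM: "p h k = (\<Sum>m<r. inner (a m) (d k) * h m)" for h k
      by (simp add: p_def t_def inner_sum_left mult.commute)
    \<comment> \<open>if \<open>p h = 0\<close>, then \<open>\<alpha> h\<close> has distance less than its own length from \<open>0\<close>\<close>
    have "invertible_square r (\<lambda>k m. inner (a m) (d k))"
      unfolding invertible_square_iff_inj
    proof (intro allI impI)
      fix h m assume "\<forall>k<r. (\<Sum>m<r. inner (a m) (d k) * h m) = 0" and m: "m < r"
      then have "v (p h) l = 0" for l by (simp add: v_def pM)
      then have "A h \<le> q * A h" using dist[of h] by (simp add: A_def split)
      moreover have "q * A h < 1 * A h" if "A h > 0"
        using that False by (intro mult_strict_right_mono) auto
      ultimately have "A h = 0" using A0[of h] by (cases "A h > 0") auto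
      then show "h m = 0" using h0 m by blast
    qed
    then obtain h where h: "\<And>k. k < r \<Longrightarrow> p h k = x k"
      unfolding pM by (rule invertible_square_surj[where y = x]) blast
    have vh: "v (p h) l = v x l" for l unfolding v_def using h by simp
    define c where "c = (\<Sum>l<r. \<alpha> h l * v x l)"
    have "(\<Sum>l<n. ((if l < r then \<alpha> h l else 0) - v x l)\<^sup>2) = A h - 2 * c + N"
      by (simp add: split N_def A_def c_def power2_diff sum.distrib sum_subtractf sum_distrib_left mult.assoc)
    then have D: "A h - 2 * c + N \<le> q * A h" using dist[of h] by (simp add: vh)
    show ?thesis
    proof (cases "A h = 0")
      case True
      then have "v x l = 0" for l
        unfolding vh[symmetric] by (simp add: v_def pM h0)
      then show ?thesis by (simp add: N_def)
    next
      case False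
      then have A: "A h > 0" using A0[of h] by simp
      \<comment> \<open>the symmetry of the angle: \<open>D\<close> bounds the inner product \<open>c\<close> from below, by the inequality of
        arithmetic and geometric means, and Cauchy-Schwarz returns to the first \<open>r\<close> coordinates of \<open>v x\<close>\<close>
      define b where "b = (1 - q) * A h"
      have b: "b > 0" using A \<open>\<not> q \<ge> 1\<close> by (simp add: b_def)
      have "b + N \<le> 2 * c" using D by (simp add: b_def algebra_simps)
      then have "(b + N)\<^sup>2 \<le> (2 * c)\<^sup>2" using b N0 by (intro power_mono) auto
      moreover have "4 * (b * N) \<le> (b + N)\<^sup>2" using zero_le_power2[of "b - N"]
        by (simp add: power2_eq_square algebra_simps)
      ultimately have "b * N \<le> c\<^sup>2" by (simp add: power2_eq_square)
      also have "\<dots> \<le> A h * (\<Sum>l<r. (v x l)\<^sup>2)"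
        unfolding c_def A_def by (rule Cauchy_Schwarz_ineq_sum)
      finally have "A h * ((1 - q) * N) \<le> A h * (\<Sum>l<r. (v x l)\<^sup>2)"
        by (simp add: b_def mult_ac)
      then have "(1 - q) * N \<le> (\<Sum>l<r. (v x l)\<^sup>2)" using A by simp
      then show ?thesis by (simp add: N_def split algebra_simps)
    qed
  qed
  then show ?thesis by (simp add: q_def v_def N_def)
qed

text \<open>The classical estimate for \<open>(1 - Q) B (1 - \<Pi>)\<close> with \<open>A\<close> of rank \<open>r\<close> and \<open>B\<close> of rank at most \<open>r\<close>: the columns of
  \<open>B (1 - \<Pi>) = (B - A) (1 - \<Pi>)\<close> lie in the range of \<open>V\<close> and have total squared length at most \<open>e\<close>, and by
  \<open>subspace_angle_bound\<close> the factor \<open>1 - Q\<close> multiplies this total by at most \<open>e / \<sigma>\<^sup>2\<close>. The rows are vectors of an arbitrary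
  inner product space, so that the remaining modes of a tensor can stay together.\<close>
lemma low_rank_perturbation:
  fixes a d d' :: "nat \<Rightarrow> 'k::real_inner" and V \<gamma> :: "nat \<Rightarrow> nat \<Rightarrow> real"
  assumes rn: "r \<le> n" and s: "\<sigma> > 0"
    and low: "\<And>x. \<sigma>\<^sup>2 * (\<Sum>m<r. (x m)\<^sup>2) \<le> (norm (\<Sum>m<r. x m *\<^sub>R a m))\<^sup>2"
    and dec: "\<And>k. k < r \<Longrightarrow> d k = d' k + (\<Sum>m<r. \<gamma> k m *\<^sub>R a m)"
    and orth: "\<And>k m. k < r \<Longrightarrow> m < r \<Longrightarrow> inner (d' k) (a m) = 0"
  defines "e \<equiv> (\<Sum>l<n. (norm ((if l < r then a l else 0) - (\<Sum>k<r. V l k *\<^sub>R d k)))\<^sup>2)"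
  shows "(\<Sum>l=r..<n. (norm (\<Sum>k<r. V l k *\<^sub>R d' k))\<^sup>2) \<le> e\<^sup>2 / \<sigma>\<^sup>2"
proof -
  define z where "z l = (\<Sum>k<r. V l k *\<^sub>R d' k)" for l
  define w where "w l = (if l < r then a l else 0) - (\<Sum>k<r. V l k *\<^sub>R d k)" for l
  have z_orth: "inner (z l) (a m) = 0" if "m < r" for l m
    using that by (simp add: z_def inner_sum_left orth)
  have "(norm (z l))\<^sup>2 \<le> (norm (w l))\<^sup>2" for l
  proof -
    have "(\<Sum>k<r. V l k *\<^sub>R d k) = z l + (\<Sum>k<r. V l k *\<^sub>R (\<Sum>m<r. \<gamma> k m *\<^sub>R a m))"
      by (simp add: z_def dec scaleR_add_right sum.distrib)
    then have "inner (z l) (w l + z l) = 0"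
      by (simp add: w_def inner_diff_right inner_add_right inner_sum_right z_orth)
    then have "(norm (w l))\<^sup>2 = (norm (w l + z l))\<^sup>2 + (norm (z l))\<^sup>2"
      by (simp add: power2_norm_eq_inner inner_add inner_commute)
    then show ?thesis by simp
  qed
  then have ze: "(\<Sum>l<n. (norm (z l))\<^sup>2) \<le> e" unfolding e_def w_def by (intro sum_mono)
  have "ons 0 (\<lambda>_::nat. 0 :: 'k)" by (simp add: ons_def)
  \<comment> \<open>columns are taken with respect to an orthonormal basis of the span of the \<open>d' k\<close>\<close>
  from gram_schmidt_extend[OF this, of r d'] obtain N b where b: "ons N b"
    and d': "\<And>k. k < r \<Longrightarrow> d' k = (\<Sum>p<N. inner (b p) (d' k) *\<^sub>R b p)" by blast
  have zn: "(norm (z l))\<^sup>2 = (\<Sum>p<N. (\<Sum>k<r. V l k * inner (b p) (d' k))\<^sup>2)" for l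
  proof (rule orthonormal_sum(2))
    have "z l = (\<Sum>k<r. V l k *\<^sub>R (\<Sum>p<N. inner (b p) (d' k) *\<^sub>R b p))"
      unfolding z_def by (intro sum.cong refl arg_cong[where f = "\<lambda>v. _ *\<^sub>R v"] d') simp
    then show "z l = (\<Sum>p<N. (\<Sum>k<r. V l k * inner (b p) (d' k)) *\<^sub>R b p)"
      unfolding scaleR_sum_right scaleR_sum_left by (subst sum.swap) simp
  qed (use onsD[OF b] in auto)
  have "(\<Sum>l=r..<n. (norm (z l))\<^sup>2) = (\<Sum>p<N. \<Sum>l=r..<n. (\<Sum>k<r. V l k * inner (b p) (d' k))\<^sup>2)"
    unfolding zn by (rule sum.swap)
  also have "\<dots> \<le> (\<Sum>p<N. e / \<sigma>\<^sup>2 * (\<Sum>l<n. (\<Sum>k<r. V l k * inner (b p) (d' k))\<^sup>2))"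
    unfolding e_def by (intro sum_mono subspace_angle_bound rn s low)
  also have "\<dots> = e / \<sigma>\<^sup>2 * (\<Sum>l<n. (norm (z l))\<^sup>2)"
    unfolding zn sum_distrib_left[symmetric] by (subst sum.swap) simp
  also have "\<dots> \<le> e / \<sigma>\<^sup>2 * e"
    using ze by (intro mult_left_mono) (auto simp: e_def intro!: divide_nonneg_nonneg sum_nonneg)
  finally show ?thesis by (simp add: z_def power2_eq_square)
qed

section \<open>Tensors in factored form\<close>

definition unit_seq :: "nat \<Rightarrow> nat ell2" where
  "unit_seq a = Abs_ell2 (\<lambda>i. of_bool (i = a))"

lemma unit_seq_nth: "ell2_nth (unit_seq a) i = of_bool (i = a)"
proof -
  have "(\<lambda>i. (of_bool (i = a) :: real)\<^sup>2) summable_on UNIV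
      \<longleftrightarrow> (\<lambda>i. (of_bool (i = a) :: real)\<^sup>2) summable_on {a}"
    by (rule summable_on_cong_neutral) auto
  then have "(\<lambda>i. (of_bool (i = a) :: real)\<^sup>2) summable_on UNIV" by simp
  then show ?thesis by (simp add: unit_seq_def ell2_nth_Abs)
qed

lemma inner_unit_seq: "inner x (unit_seq a) = ell2_nth x a"
proof -
  have "inner x (unit_seq a) = (\<Sum>\<^sub>\<infinity>i. ell2_nth x i * of_bool (i = a))"
    by (simp add: inner_ell2_def unit_seq_nth)
  also have "\<dots> = (\<Sum>\<^sub>\<infinity>i\<in>{a}. ell2_nth x i)"
    by (rule infsum_cong_neutral) auto
  finally show ?thesis by simp
qed

lemma inner_elementary_tensor:
  "inner (elementary_tensor u) (elementary_tensor v) = (\<Prod>\<mu>\<in>UNIV. inner (u \<mu>) (v \<mu>))"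
proof -
  have "inner (elementary_tensor u) (elementary_tensor v)
      = infsum (\<lambda>i. \<Prod>\<mu>\<in>UNIV. ell2_nth (u \<mu>) (i \<mu>) * ell2_nth (v \<mu>) (i \<mu>)) (PiE UNIV (\<lambda>_. UNIV))"
    by (simp add: inner_ell2_def elementary_tensor_nth prod.distrib)
  also have "\<dots> = (\<Prod>\<mu>\<in>UNIV. inner (u \<mu>) (v \<mu>))"
    unfolding inner_ell2_def
    by (rule infsum_prod_PiE_abs)
      (simp_all only: finite_class.finite_UNIV summable_on_iff_abs_summable_on_real[symmetric] ell2_mult_summable)
  finally show ?thesis .
qed

definition Idx :: "('d::finite \<Rightarrow> nat) \<Rightarrow> ('d \<Rightarrow> nat) set" where
  "Idx r = {i. \<forall>\<mu>. i \<mu> < r \<mu>}"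

text \<open>The labels of the columns of the \<open>\<mu>\<close>-th matricization.\<close>
definition Idx0 :: "('d::finite \<Rightarrow> nat) \<Rightarrow> 'd \<Rightarrow> ('d \<Rightarrow> nat) set" where
  "Idx0 r \<mu> = {i \<in> Idx r. i \<mu> = 0}"

lemma Idx_PiE: "Idx r = PiE UNIV (\<lambda>\<mu>. {..<r \<mu>})"
  by (auto simp: Idx_def)

lemma finite_Idx [simp]: "finite (Idx r)" "finite (Idx0 r \<mu>)"
  by (simp_all add: Idx_PiE Idx0_def finite_PiE)

lemma sum_Idx_fibers:
  assumes "0 < r \<mu>"
  shows "sum f (Idx r) = (\<Sum>j\<in>Idx0 r \<mu>. \<Sum>m<r \<mu>. f (j(\<mu> := m)))"
proof -
  have "(\<Sum>j\<in>Idx0 r \<mu>. \<Sum>m<r \<mu>. f (j(\<mu> := m)))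
      = (\<Sum>(j, m)\<in>Idx0 r \<mu> \<times> {..<r \<mu>}. f (j(\<mu> := m)))"
    by (rule sum.cartesian_product)
  also have "\<dots> = sum f (Idx r)"
    by (rule sum.reindex_bij_witness[of _ "\<lambda>i. (i(\<mu> := 0), i \<mu>)" "\<lambda>(j, m). j(\<mu> := m)"])
      (use assms in \<open>auto simp: Idx0_def Idx_def fun_eq_iff\<close>)
  finally show ?thesis by simp
qed

lemma Idx0_updI: "j \<in> Idx0 r \<mu> \<Longrightarrow> m < r \<mu> \<Longrightarrow> j(\<mu> := m) \<in> Idx r"
  by (auto simp: Idx0_def Idx_def)

lemma prod_split_mode: "(\<Prod>\<nu>\<in>UNIV. f \<nu>) = f \<mu> * (\<Prod>\<nu>\<in>UNIV - {\<mu>}. f (\<nu>::'d::finite))"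
  by (rule prod.remove) auto

lemma prod_of_bool_eq: "finite A \<Longrightarrow> (\<Prod>\<nu>\<in>A. of_bool (P \<nu>)) = (of_bool (\<forall>\<nu>\<in>A. P \<nu>) :: real)"
  by (induction A rule: finite_induct) auto

lemma ell2_nth_eq_inner:
  "ell2_nth X i = inner X (elementary_tensor (\<lambda>\<nu>. unit_seq (i \<nu>)))"
proof -
  have "inner X (elementary_tensor (\<lambda>\<nu>. unit_seq (i \<nu>))) = (\<Sum>\<^sub>\<infinity>k. ell2_nth X k * of_bool (k = i))"
    by (simp add: inner_ell2_def elementary_tensor_nth unit_seq_nth prod_of_bool_eq fun_eq_iff)
  also have "\<dots> = (\<Sum>\<^sub>\<infinity>k\<in>{i}. ell2_nth X k)" by (rule infsum_cong_neutral) auto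
  finally show ?thesis by simp
qed

lemma elementary_tensor_orthonormal:
  assumes "\<And>\<mu>. ons (n \<mu>) (b \<mu>)" "i \<in> Idx n" "j \<in> Idx n"
  shows "inner (elementary_tensor (\<lambda>\<mu>. b \<mu> (i \<mu>))) (elementary_tensor (\<lambda>\<mu>. b \<mu> (j \<mu>))) = of_bool (i = j)"
proof -
  have "(\<Prod>\<mu>\<in>UNIV. inner (b \<mu> (i \<mu>)) (b \<mu> (j \<mu>))) = (\<Prod>\<mu>\<in>UNIV. of_bool (i \<mu> = j \<mu>))"
    using assms by (intro prod.cong) (auto simp: ons_def Idx_def)
  then show ?thesis by (simp add: inner_elementary_tensor prod_of_bool_eq fun_eq_iff)
qed

text \<open>The vectors in the pairing are orthonormal in \<open>a\<close>, so Bessel's inequality makes the fiber square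
  summable. It is the contraction of \<open>Z\<close> with \<open>w\<close> in all modes but \<open>\<mu>\<close>.\<close>
lemma fiber_exists:
  fixes Z :: "('d::finite \<Rightarrow> nat) ell2"
  assumes w: "\<And>\<nu>. inner (w \<nu>) (w \<nu>) = 1"
  obtains y where "\<And>a. ell2_nth y a = inner Z (elementary_tensor (w(\<mu> := unit_seq a)))"
proof -
  define f where "f a = inner Z (elementary_tensor (w(\<mu> := unit_seq a)))" for a
  have unit: "inner (unit_seq a) (unit_seq b) = of_bool (a = b)" for a b
    by (simp add: inner_unit_seq unit_seq_nth)
  have ortho: "inner (elementary_tensor (w(\<mu> := unit_seq a))) (elementary_tensor (w(\<mu> := unit_seq b)))
      = of_bool (a = b)" for a b
    by (simp add: inner_elementary_tensor prod_split_mode[of _ \<mu>] unit w)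
  have "(\<lambda>a. (f a)\<^sup>2) summable_on UNIV"
  proof (rule nonneg_bdd_above_summable_on)
    show "bdd_above (sum (\<lambda>a. (f a)\<^sup>2) ` {F. F \<subseteq> UNIV \<and> finite F})"
      unfolding f_def using ortho by (intro bdd_aboveI2[where M = "(norm Z)\<^sup>2"] bessel) auto
  qed simp
  then show thesis using that[of "Abs_ell2 f"] by (simp add: ell2_nth_Abs f_def)
qed

lemma Idx0_eq_iff:
  "i \<in> Idx0 r \<mu> \<Longrightarrow> j \<in> Idx0 r \<mu> \<Longrightarrow> (\<forall>\<nu>\<in>UNIV - {\<mu>}. i \<nu> = j \<nu>) \<longleftrightarrow> i = j"
  by (auto simp: fun_eq_iff Idx0_def)

lemma elementary_tensor_in_span:
  assumes "\<And>\<mu>. u \<mu> = (\<Sum>l<n \<mu>. t \<mu> l *\<^sub>R b \<mu> l)"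
  shows "elementary_tensor u \<in> span ((\<lambda>i. elementary_tensor (\<lambda>\<mu>. b \<mu> (i \<mu>))) ` Idx n)"
proof -
  have "elementary_tensor u = (\<Sum>i\<in>Idx n. (\<Prod>\<mu>\<in>UNIV. t \<mu> (i \<mu>)) *\<^sub>R elementary_tensor (\<lambda>\<mu>. b \<mu> (i \<mu>)))"
  proof (rule ell2_eqI)
    fix a
    have "ell2_nth (elementary_tensor u) a = (\<Prod>\<mu>\<in>UNIV. \<Sum>l<n \<mu>. t \<mu> l * ell2_nth (b \<mu> l) (a \<mu>))"
      by (simp add: elementary_tensor_nth assms ell2_nth_sum ell2_nth_scaleR)
    also have "\<dots> = (\<Sum>i\<in>Idx n. \<Prod>\<mu>\<in>UNIV. t \<mu> (i \<mu>) * ell2_nth (b \<mu> (i \<mu>)) (a \<mu>))"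
      unfolding Idx_PiE by (rule prod_sum_PiE) auto
    finally show "ell2_nth (elementary_tensor u) a = ell2_nth (\<Sum>i\<in>Idx n. (\<Prod>\<mu>\<in>UNIV. t \<mu> (i \<mu>)) *\<^sub>R
        elementary_tensor (\<lambda>\<mu>. b \<mu> (i \<mu>))) a"
      by (simp add: ell2_nth_sum ell2_nth_scaleR elementary_tensor_nth prod.distrib)
  qed
  also have "\<dots> \<in> span ((\<lambda>i. elementary_tensor (\<lambda>\<mu>. b \<mu> (i \<mu>))) ` Idx n)"
    by (intro span_sum span_scale span_base imageI)
  finally show ?thesis .
qed

locale tensor_labels =
  fixes r :: "'d::finite \<Rightarrow> nat" and p :: "'n::finite \<Rightarrow> 'd \<Rightarrow> nat"
  assumes r_pos: "0 < r \<mu>" and labelling: "tensor_labelling r p"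
begin

lemma bij_p: "bij_betw p UNIV (Idx r)"
  using labelling by (simp add: tensor_labelling_def Idx_def)

lemma inj_p: "inj p"
  using bij_p by (simp add: bij_betw_def)

lemma p_in [simp]: "p k \<in> Idx r"
  using bij_p by (auto simp: bij_betw_def)

lemma p_less [simp]: "p k \<mu> < r \<mu>"
  using p_in[of k] by (simp add: Idx_def)

lemma entry_p [simp]: "entry p C (p k) = C $ k"
  by (simp add: entry_def inj_p)

lemma sum_p: "(\<Sum>k\<in>UNIV. f (p k)) = sum f (Idx r)"
  by (rule sum.reindex_bij_betw[OF bij_p])

lemma p_inv: "i \<in> Idx r \<Longrightarrow> p (inv_into UNIV p i) = i"
  by (rule f_inv_into_f) (use bij_p in \<open>simp add: bij_betw_def\<close>)

lemma entry_tabulate: "i \<in> Idx r \<Longrightarrow> entry p (\<chi> k. f (p k)) i = f i"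
  by (simp add: entry_def p_inv)

lemma core_eqI: "(\<And>i. i \<in> Idx r \<Longrightarrow> entry p C i = entry p D i) \<Longrightarrow> C = D"
  unfolding Finite_Cartesian_Product.vec_eq_iff by (metis entry_p p_in)

lemma norm_core: "(norm C)\<^sup>2 = (\<Sum>i\<in>Idx r. (entry p C i)\<^sup>2)"
proof -
  have "(norm C)\<^sup>2 = (\<Sum>k\<in>UNIV. (C $ k)\<^sup>2)"
    by (simp add: norm_vec_def L2_set_def sum_nonneg)
  then show ?thesis using sum_p[of "\<lambda>i. (entry p C i)\<^sup>2"] by simp
qed

lemma inner_core: "inner C D = (\<Sum>i\<in>Idx r. entry p C i * entry p D i)"
  using sum_p[of "\<lambda>i. entry p C i * entry p D i"] by (simp add: inner_vec_def)

lemma entry_linear: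
  "entry p (C + D) i = entry p C i + entry p D i" "entry p (C - D) i = entry p C i - entry p D i"
  "entry p (c *\<^sub>R C) i = c * entry p C i" "entry p 0 i = 0"
  by (simp_all add: entry_def)

lemma tucker_Idx:
  "tucker p C U = (\<Sum>i\<in>Idx r. entry p C i *\<^sub>R elementary_tensor (\<lambda>\<mu>. U \<mu> (i \<mu>)))"
  using sum_p[of "\<lambda>i. entry p C i *\<^sub>R elementary_tensor (\<lambda>\<mu>. U \<mu> (i \<mu>))"] by (simp add: tucker_def)

lemma tucker_diff: "tucker p (C - D) U = tucker p C U - tucker p D U"
  by (simp add: tucker_def scaleR_diff_left sum_subtractf)

lemma entry_core_mult:
  "i \<in> Idx r \<Longrightarrow>
    entry p (core_mult p C T) i = (\<Sum>k\<in>Idx r. entry p C k * (\<Prod>\<mu>\<in>UNIV. T \<mu> (i \<mu>) (k \<mu>)))"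
  using sum_p[of "\<lambda>k. entry p C k * (\<Prod>\<mu>\<in>UNIV. T \<mu> (i \<mu>) (k \<mu>))"]
  unfolding core_mult_def by (subst entry_tabulate) simp_all

lemma inner_tucker_elementary:
  "inner (tucker p C U) (elementary_tensor w)
    = (\<Sum>i\<in>Idx r. entry p C i * (\<Prod>\<mu>\<in>UNIV. inner (U \<mu> (i \<mu>)) (w \<mu>)))"
  by (simp add: tucker_Idx inner_sum_left inner_elementary_tensor)

lemma tucker_expand:
  assumes "\<And>\<mu> k. k < r \<mu> \<Longrightarrow> U \<mu> k = (\<Sum>l<n \<mu>. T \<mu> l k *\<^sub>R B \<mu> l)"
  shows "tucker p C U = (\<Sum>i\<in>Idx n. (\<Sum>k\<in>Idx r. entry p C k * (\<Prod>\<mu>\<in>UNIV. T \<mu> (i \<mu>) (k \<mu>)))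
            *\<^sub>R elementary_tensor (\<lambda>\<mu>. B \<mu> (i \<mu>)))"
proof (rule ell2_eqI)
  fix a
  have "(\<Prod>\<mu>\<in>UNIV. ell2_nth (U \<mu> (k \<mu>)) (a \<mu>))
      = (\<Sum>i\<in>Idx n. (\<Prod>\<mu>\<in>UNIV. T \<mu> (i \<mu>) (k \<mu>)) * (\<Prod>\<mu>\<in>UNIV. ell2_nth (B \<mu> (i \<mu>)) (a \<mu>)))"
    if "k \<in> Idx r" for k
  proof -
    have "(\<Prod>\<mu>\<in>UNIV. ell2_nth (U \<mu> (k \<mu>)) (a \<mu>))
        = (\<Prod>\<mu>\<in>UNIV. \<Sum>l<n \<mu>. T \<mu> l (k \<mu>) * ell2_nth (B \<mu> l) (a \<mu>))"
      using that by (intro prod.cong) (auto simp: assms Idx_def ell2_nth_sum ell2_nth_scaleR)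
    also have "\<dots> = (\<Sum>i\<in>Idx n. \<Prod>\<mu>\<in>UNIV. T \<mu> (i \<mu>) (k \<mu>) * ell2_nth (B \<mu> (i \<mu>)) (a \<mu>))"
      unfolding Idx_PiE by (rule prod_sum_PiE) auto
    finally show ?thesis by (simp add: prod.distrib)
  qed
  then show "ell2_nth (tucker p C U) a =
      ell2_nth (\<Sum>i\<in>Idx n. (\<Sum>k\<in>Idx r. entry p C k * (\<Prod>\<mu>\<in>UNIV. T \<mu> (i \<mu>) (k \<mu>)))
            *\<^sub>R elementary_tensor (\<lambda>\<mu>. B \<mu> (i \<mu>))) a"
    unfolding tucker_Idx ell2_nth_sum ell2_nth_scaleR elementary_tensor_nth sum_distrib_right
    by (subst sum.swap) (simp add: sum_distrib_left mult.assoc)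
qed

lemma tucker_core_mult:
  assumes "\<And>\<mu> k. k < r \<mu> \<Longrightarrow> U \<mu> k = (\<Sum>l<r \<mu>. T \<mu> l k *\<^sub>R B \<mu> l)"
  shows "tucker p C U = tucker p (core_mult p C T) B"
proof -
  have "tucker p C U = (\<Sum>i\<in>Idx r. (\<Sum>k\<in>Idx r. entry p C k * (\<Prod>\<mu>\<in>UNIV. T \<mu> (i \<mu>) (k \<mu>)))
            *\<^sub>R elementary_tensor (\<lambda>\<mu>. B \<mu> (i \<mu>)))"
    using assms by (rule tucker_expand)
  also have "\<dots> = tucker p (core_mult p C T) B"
    unfolding tucker_Idx[of "core_mult p C T"] by (intro sum.cong refl) (simp add: entry_core_mult)
  finally show ?thesis .
qed

lemma inner_tucker_fiber:
  assumes j: "j \<in> Idx0 r \<mu>"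
    and w: "\<And>\<nu> k. \<nu> \<noteq> \<mu> \<Longrightarrow> k < r \<nu> \<Longrightarrow> inner (U \<nu> k) (w \<nu>) = of_bool (k = j \<nu>)"
  shows "inner (tucker p C U) (elementary_tensor w)
    = (\<Sum>m<r \<mu>. entry p C (j(\<mu> := m)) * inner (U \<mu> m) (w \<mu>))"
proof -
  have "(\<Prod>\<nu>\<in>UNIV - {\<mu>}. inner (U \<nu> ((i(\<mu> := m)) \<nu>)) (w \<nu>)) = of_bool (i = j)"
    if "i \<in> Idx0 r \<mu>" for i m
  proof -
    have "(\<Prod>\<nu>\<in>UNIV - {\<mu>}. inner (U \<nu> ((i(\<mu> := m)) \<nu>)) (w \<nu>))
        = (\<Prod>\<nu>\<in>UNIV - {\<mu>}. of_bool (i \<nu> = j \<nu>))"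
      using that by (intro prod.cong) (auto simp: Idx0_def Idx_def w)
    also have "\<dots> = of_bool (\<forall>\<nu>\<in>UNIV - {\<mu>}. i \<nu> = j \<nu>)" by (rule prod_of_bool_eq) simp
    also have "(\<forall>\<nu>\<in>UNIV - {\<mu>}. i \<nu> = j \<nu>) \<longleftrightarrow> i = j"
      using that j by (auto simp: fun_eq_iff Idx0_def)
    finally show ?thesis .
  qed
  then have "inner (tucker p C U) (elementary_tensor w)
    = (\<Sum>i\<in>Idx0 r \<mu>. \<Sum>m<r \<mu>. entry p C (i(\<mu> := m)) * (inner (U \<mu> m) (w \<mu>) * of_bool (i = j)))"
    unfolding inner_tucker_elementary sum_Idx_fibers[of r \<mu>, OF r_pos]
    by (intro sum.cong refl) (simp add: prod_split_mode[of _ \<mu>])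
  also have "\<dots> = (\<Sum>m<r \<mu>. \<Sum>i\<in>Idx0 r \<mu>. of_bool (i = j) * (entry p C (i(\<mu> := m)) * inner (U \<mu> m) (w \<mu>)))"
    by (subst sum.swap) (simp add: mult_ac)
  finally show ?thesis using j by simp
qed

text \<open>Pairing with elementary tensors of a dual system reads off core entries; \<open>inner_tucker_fiber\<close> leaves
  one mode free and reads off a fiber.\<close>
lemma inner_tucker_dual:
  assumes j: "j \<in> Idx r"
    and w: "\<And>\<nu> k. k < r \<nu> \<Longrightarrow> inner (U \<nu> k) (w \<nu>) = of_bool (k = j \<nu>)"
  shows "inner (tucker p C U) (elementary_tensor w) = entry p C j"
proof -
  have "(\<Prod>\<nu>\<in>UNIV. inner (U \<nu> (i \<nu>)) (w \<nu>)) = of_bool (i = j)" if "i \<in> Idx r" for i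
  proof -
    have "(\<Prod>\<nu>\<in>UNIV. inner (U \<nu> (i \<nu>)) (w \<nu>)) = (\<Prod>\<nu>\<in>UNIV. of_bool (i \<nu> = j \<nu>))"
      using that by (intro prod.cong) (auto simp: Idx_def w)
    then show ?thesis by (simp add: prod_of_bool_eq fun_eq_iff)
  qed
  then have "inner (tucker p C U) (elementary_tensor w) = (\<Sum>i\<in>Idx r. entry p C i * of_bool (i = j))"
    unfolding inner_tucker_elementary by (intro sum.cong) auto
  then show ?thesis using j by simp
qed

text \<open>The \<open>m\<close>-th row of the \<open>\<mu>\<close>-th matricization, expressed in the basis \<open>U \<mu>\<close> of the columns. As in the
  labelling of matricizations, mode \<open>\<mu>\<close> is kept but filled with the unit vector at \<open>0\<close>, so that rows
  are again tensors.\<close>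
definition slice :: "'d \<Rightarrow> real ^ 'n \<Rightarrow> ('d \<Rightarrow> nat \<Rightarrow> nat ell2) \<Rightarrow> nat \<Rightarrow> ('d \<Rightarrow> nat) ell2" where
  "slice \<mu> C U m = (\<Sum>j\<in>Idx0 r \<mu>. entry p C (j(\<mu> := m)) *\<^sub>R
     elementary_tensor ((\<lambda>\<nu>. U \<nu> (j \<nu>))(\<mu> := unit_seq 0)))"

lemma inner_tucker_slice:
  "inner (tucker p C U) (elementary_tensor w)
    = (\<Sum>m<r \<mu>. inner (U \<mu> m) (w \<mu>) * inner (slice \<mu> C U m) (elementary_tensor (w(\<mu> := unit_seq 0))))"
proof -
  have unit: "inner (unit_seq 0) (unit_seq 0) = 1" by (simp add: inner_unit_seq unit_seq_nth)
  have "inner (slice \<mu> C U m) (elementary_tensor (w(\<mu> := unit_seq 0)))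
      = (\<Sum>j\<in>Idx0 r \<mu>. entry p C (j(\<mu> := m)) * (\<Prod>\<nu>\<in>UNIV - {\<mu>}. inner (U \<nu> (j \<nu>)) (w \<nu>)))" for m
    by (simp add: slice_def inner_sum_left inner_elementary_tensor prod_split_mode[of _ \<mu>] unit)
  then have "(\<Sum>m<r \<mu>. inner (U \<mu> m) (w \<mu>) * inner (slice \<mu> C U m) (elementary_tensor (w(\<mu> := unit_seq 0))))
      = (\<Sum>j\<in>Idx0 r \<mu>. \<Sum>m<r \<mu>. inner (U \<mu> m) (w \<mu>) *
          (entry p C (j(\<mu> := m)) * (\<Prod>\<nu>\<in>UNIV - {\<mu>}. inner (U \<nu> (j \<nu>)) (w \<nu>))))"
    by (simp add: sum_distrib_left) (rule sum.swap)
  also have "\<dots> = inner (tucker p C U) (elementary_tensor w)"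
    unfolding inner_tucker_elementary sum_Idx_fibers[of r \<mu>, OF r_pos]
    by (intro sum.cong refl) (simp add: prod_split_mode[of _ \<mu>] mult_ac)
  finally show ?thesis by simp
qed

lemma matricization_tucker:
  "matricization \<mu> (tucker p C U) a b = (\<Sum>m<r \<mu>. ell2_nth (U \<mu> m) a * ell2_nth (slice \<mu> C U m) b)"
proof (cases "b \<mu> = 0")
  case False
  then have "ell2_nth (slice \<mu> C U m) b = 0" for m
    by (simp add: slice_def ell2_nth_sum ell2_nth_scaleR elementary_tensor_nth
        prod_split_mode[of _ \<mu>] unit_seq_nth)
  then show ?thesis using False by (simp add: matricization_def)
next
  case True
  have upd: "(\<lambda>\<nu>. unit_seq ((b(\<mu> := a)) \<nu>))(\<mu> := unit_seq 0) = (\<lambda>\<nu>. unit_seq (b \<nu>))"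
    using True by auto
  show ?thesis
    using True inner_tucker_slice[of C U "\<lambda>\<nu>. unit_seq ((b(\<mu> := a)) \<nu>)" \<mu>]
    unfolding upd by (simp add: matricization_def ell2_nth_eq_inner inner_unit_seq)
qed

text \<open>Full multilinear rank as independence of the rows of every matricization.\<close>
definition nondegenerate :: "real ^ 'n \<Rightarrow> bool" where
  "nondegenerate C \<longleftrightarrow> (\<forall>\<mu> x. (\<forall>j\<in>Idx0 r \<mu>. (\<Sum>m<r \<mu>. x m * entry p C (j(\<mu> := m))) = 0)
      \<longrightarrow> (\<forall>m<r \<mu>. x m = 0))"

lemma nondegenerateD:
  "nondegenerate C \<Longrightarrow> (\<And>j. j \<in> Idx0 r \<mu> \<Longrightarrow> (\<Sum>m<r \<mu>. x m * entry p C (j(\<mu> := m))) = 0)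
    \<Longrightarrow> m < r \<mu> \<Longrightarrow> x m = 0"
  unfolding nondegenerate_def by blast

lemma full_rank_imp_nondegenerate:
  assumes "C \<in> full_rank_tensors r p"
  shows "nondegenerate C"
  unfolding nondegenerate_def
proof (intro allI impI)
  fix \<mu> x m
  assume x: "\<forall>j\<in>Idx0 r \<mu>. (\<Sum>m<r \<mu>. x m * entry p C (j(\<mu> := m))) = 0" and m: "m < r \<mu>"
  have "dim (core_matricization_row p \<mu> C ` {..<r \<mu>}) = r \<mu>"
    using assms by (simp add: full_rank_tensors_def fun_eq_iff multilinear_rank_def)
  moreover have "(\<Sum>m<r \<mu>. x m *\<^sub>R core_matricization_row p \<mu> C m) = 0"
    unfolding Finite_Cartesian_Product.vec_eq_iff
  proof
    fix k
    have "p k \<in> Idx0 r \<mu>" if "p k \<mu> = 0" using that by (simp add: Idx0_def)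
    then show "(\<Sum>m<r \<mu>. x m *\<^sub>R core_matricization_row p \<mu> C m) $ k = 0 $ k"
      using x by (cases "p k \<mu> = 0") (simp_all add: sum_component core_matricization_row_def)
  qed
  ultimately show "x m = 0" using m by (rule full_dim_imp_independent)
qed

lemma nondegenerate_core_mult_imp_invertible:
  assumes "nondegenerate (core_mult p D A)"
  shows "invertible_square (r \<mu>) (A \<mu>)"
  unfolding invertible_square_iff_left_inj
proof (intro allI impI)
  fix x m
  assume x: "\<forall>k<r \<mu>. (\<Sum>i<r \<mu>. x i * A \<mu> i k) = 0" and m: "m < r \<mu>"
  show "x m = 0"
  proof (rule nondegenerateD[OF assms _ m])
    fix j assume j: "j \<in> Idx0 r \<mu>"
    have "(\<Sum>m<r \<mu>. x m * entry p (core_mult p D A) (j(\<mu> := m)))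
       = (\<Sum>m<r \<mu>. \<Sum>k\<in>Idx r. (x m * A \<mu> m (k \<mu>)) *
            (entry p D k * (\<Prod>\<nu>\<in>UNIV - {\<mu>}. A \<nu> (j \<nu>) (k \<nu>))))"
      using j by (simp add: entry_core_mult Idx0_updI sum_distrib_left prod_split_mode[of _ \<mu>] mult_ac)
    also have "\<dots> = (\<Sum>k\<in>Idx r. (\<Sum>m<r \<mu>. x m * A \<mu> m (k \<mu>)) *
            (entry p D k * (\<Prod>\<nu>\<in>UNIV - {\<mu>}. A \<nu> (j \<nu>) (k \<nu>))))"
      by (subst sum.swap) (simp add: sum_distrib_right)
    also have "\<dots> = 0" using x by (intro sum.neutral) (auto simp: Idx_def)
    finally show "(\<Sum>m<r \<mu>. x m * entry p (core_mult p D A) (j(\<mu> := m))) = 0" .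
  qed
qed

lemma regular_factors_dual:
  assumes "regular_factors r V"
  obtains W where "\<And>\<mu> k l. k < r \<mu> \<Longrightarrow> l < r \<mu> \<Longrightarrow> inner (V \<mu> k) (W \<mu> l) = of_bool (k = l)"
proof -
  have "\<forall>\<mu>. \<exists>H. \<forall>i<r \<mu>. \<forall>j<r \<mu>. (\<Sum>k<r \<mu>. inner (V \<mu> i) (V \<mu> k) * H k j) = of_bool (i = j)"
    using assms unfolding regular_factors_def invertible_square_def by blast
  then obtain H where H: "\<And>\<mu> i j. i < r \<mu> \<Longrightarrow> j < r \<mu> \<Longrightarrow>
      (\<Sum>k<r \<mu>. inner (V \<mu> i) (V \<mu> k) * H \<mu> k j) = of_bool (i = j)" by metis
  show thesis
    by (rule that[of "\<lambda>\<mu> l. \<Sum>k<r \<mu>. H \<mu> k l *\<^sub>R V \<mu> k"])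
      (simp add: inner_sum_right H mult.commute[of "H _ _ _"])
qed

lemma regular_factors_independent:
  assumes "regular_factors r V" "(\<Sum>k<r \<mu>. x k *\<^sub>R V \<mu> k) = 0" "k < r \<mu>"
  shows "x k = 0"
proof -
  obtain W where W: "\<And>\<mu> k l. k < r \<mu> \<Longrightarrow> l < r \<mu> \<Longrightarrow> inner (V \<mu> k) (W \<mu> l) = of_bool (k = l)"
    using regular_factors_dual[OF assms(1)] by metis
  have "0 = inner (\<Sum>k<r \<mu>. x k *\<^sub>R V \<mu> k) (W \<mu> k)" using assms(2) by simp
  also have "\<dots> = (\<Sum>l<r \<mu>. x l * of_bool (l = k))"
    unfolding inner_sum_left using assms(3) by (intro sum.cong) (auto simp: W)
  finally show ?thesis using assms(3) by simp
qed

text \<open>Contracting the other modes with the dual system of \<open>V\<close> leaves a linear combination of the rows of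
  the \<open>\<mu>\<close>-th matricization of \<open>D\<close>, with coefficients \<open>inner (V \<mu> m) h\<close>.\<close>
lemma factors_orthogonal:
  assumes D: "nondegenerate D" and V: "regular_factors r V"
    and h: "\<And>w. w \<mu> = h \<Longrightarrow> inner (tucker p D V) (elementary_tensor w) = 0"
    and k: "k < r \<mu>"
  shows "inner (V \<mu> k) h = 0"
proof -
  obtain W where W: "\<And>\<mu> k l. k < r \<mu> \<Longrightarrow> l < r \<mu> \<Longrightarrow> inner (V \<mu> k) (W \<mu> l) = of_bool (k = l)"
    using regular_factors_dual[OF V] by metis
  show ?thesis
  proof (rule nondegenerateD[OF D _ k])
    fix j assume j: "j \<in> Idx0 r \<mu>"
    have "inner (tucker p D V) (elementary_tensor ((\<lambda>\<nu>. W \<nu> (j \<nu>))(\<mu> := h)))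
       = (\<Sum>m<r \<mu>. entry p D (j(\<mu> := m)) * inner (V \<mu> m) h)"
      using inner_tucker_fiber[OF j, of V "(\<lambda>\<nu>. W \<nu> (j \<nu>))(\<mu> := h)" D] j
      by (simp add: W Idx0_def Idx_def)
    then show "(\<Sum>m<r \<mu>. inner (V \<mu> m) h * entry p D (j(\<mu> := m))) = 0"
      by (simp add: h mult.commute)
  qed
qed

abbreviation orthonormal_factors :: "('d \<Rightarrow> nat \<Rightarrow> nat ell2) \<Rightarrow> bool" where
  "orthonormal_factors U \<equiv> \<forall>\<mu>. ons (r \<mu>) (U \<mu>)"

text \<open>Every vector orthogonal to the columns of \<open>U \<mu>\<close> annihilates the tensor in mode \<open>\<mu>\<close>, and is
  therefore orthogonal to those of \<open>V \<mu>\<close> by \<open>factors_orthogonal\<close>. Hence \<open>V\<close> is \<open>U\<close> times square matrices,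
  which are invertible since the columns of \<open>V\<close> are independent. This makes the tangent space
  independent of the representation, and it shows that boundary cores yield boundary tensors.\<close>
lemma factors_change_of_basis:
  assumes U: "orthonormal_factors U" and D: "nondegenerate D" and V: "regular_factors r V"
    and eq: "tucker p C U = tucker p D V"
  defines "B \<equiv> \<lambda>\<mu> l k. inner (U \<mu> l) (V \<mu> k)"
  shows "\<And>\<mu> k. k < r \<mu> \<Longrightarrow> V \<mu> k = (\<Sum>l<r \<mu>. B \<mu> l k *\<^sub>R U \<mu> l)"
    and "\<And>\<mu>. invertible_square (r \<mu>) (B \<mu>)"
    and "C = core_mult p D B"
proof -
  show exp: "V \<mu> k = (\<Sum>l<r \<mu>. B \<mu> l k *\<^sub>R U \<mu> l)" if k: "k < r \<mu>" for \<mu> k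
  proof -
    define h where "h = V \<mu> k - (\<Sum>l<r \<mu>. B \<mu> l k *\<^sub>R U \<mu> l)"
    have Uh: "inner (U \<mu> i) h = 0" if "i < r \<mu>" for i
    proof -
      have "inner (U \<mu> i) (\<Sum>l<r \<mu>. B \<mu> l k *\<^sub>R U \<mu> l) = (\<Sum>l<r \<mu>. B \<mu> l k * of_bool (i = l))"
        unfolding inner_sum_right using that U by (intro sum.cong) (auto simp: ons_def)
      then show ?thesis using that by (simp add: h_def inner_diff_right B_def)
    qed
    have Vh: "inner (V \<mu> k) h = 0"
    proof (rule factors_orthogonal[OF D V _ k])
      fix w :: "'d \<Rightarrow> nat ell2" assume w: "w \<mu> = h"
      have zero: "(\<Prod>\<nu>\<in>UNIV. inner (U \<nu> (i \<nu>)) (w \<nu>)) = 0" if "i \<in> Idx r" for i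
        using that by (simp add: prod_split_mode[of _ \<mu>] w Uh Idx_def)
      show "inner (tucker p D V) (elementary_tensor w) = 0"
        unfolding eq[symmetric] inner_tucker_elementary
        by (intro sum.neutral ballI) (simp only: zero mult_zero_right)
    qed
    have "inner h h = 0"
      by (subst (1) h_def) (simp add: inner_diff_left inner_sum_left Vh Uh)
    then show ?thesis by (simp add: h_def)
  qed
  show "invertible_square (r \<mu>) (B \<mu>)" for \<mu>
    unfolding invertible_square_iff_inj
  proof (intro allI impI)
    fix x k assume x: "\<forall>i<r \<mu>. (\<Sum>k<r \<mu>. B \<mu> i k * x k) = 0" and k: "k < r \<mu>"
    have "(\<Sum>k<r \<mu>. x k *\<^sub>R V \<mu> k) = (\<Sum>k<r \<mu>. x k *\<^sub>R (\<Sum>l<r \<mu>. B \<mu> l k *\<^sub>R U \<mu> l))"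
      by (intro sum.cong refl arg_cong[where f = "\<lambda>v. _ *\<^sub>R v"] exp) simp
    also have "\<dots> = (\<Sum>l<r \<mu>. (\<Sum>k<r \<mu>. B \<mu> l k * x k) *\<^sub>R U \<mu> l)"
      unfolding scaleR_sum_right scaleR_sum_left by (subst sum.swap) (simp add: mult.commute)
    also have "\<dots> = 0" using x by simp
    finally show "x k = 0" using regular_factors_independent[OF V] k by blast
  qed
  have eq2: "tucker p C U = tucker p (core_mult p D B) U"
    unfolding eq by (rule tucker_core_mult) (rule exp)
  show "C = core_mult p D B"
  proof (rule core_eqI)
    fix i assume i: "i \<in> Idx r"
    have "inner (U \<nu> k) (U \<nu> (i \<nu>)) = of_bool (k = i \<nu>)" if "k < r \<nu>" for \<nu> k
      using that U i by (simp add: ons_def Idx_def)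
    then show "entry p C i = entry p (core_mult p D B) i"
      using inner_tucker_dual[OF i, of U "\<lambda>\<nu>. U \<nu> (i \<nu>)"] eq2 by metis
  qed
qed

end

section \<open>Embedded submanifolds and their tangent spaces\<close>

lemma Ck_on_cong_imp:
  fixes f g :: "'a::euclidean_space \<Rightarrow> 'b::euclidean_space"
  assumes "open S" "\<And>x. x \<in> S \<Longrightarrow> f x = g x" "Ck_on n S f"
  shows "Ck_on n S g"
  using assms(2,3)
proof (induction n arbitrary: f g)
  case 0
  then show ?case by (simp cong: continuous_on_cong)
next
  case (Suc n)
  have D: "(f has_derivative D) (at x) \<longleftrightarrow> (g has_derivative D) (at x)" if x: "x \<in> S" for x D
    using has_derivative_transform_within_open[OF _ assms(1) x, of f D UNIV g]
      has_derivative_transform_within_open[OF _ assms(1) x, of g D UNIV f] Suc.prems(1) by auto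
  then have "frechet_derivative f (at x) = frechet_derivative g (at x)" if "x \<in> S" for x
    using that by (simp add: frechet_derivative_def)
  then have "Ck_on n S (\<lambda>x. frechet_derivative g (at x) v)" for v
    using Suc.IH[of "\<lambda>x. frechet_derivative f (at x) v" "\<lambda>x. frechet_derivative g (at x) v"] Suc.prems(2)
    by simp
  moreover have "g differentiable (at x)" if "x \<in> S" for x
  proof -
    from Suc.prems(2) that obtain E where "(f has_derivative E) (at x)"
      unfolding Ck_on.simps differentiable_def by blast
    then show ?thesis unfolding differentiable_def using D[OF that] by blast
  qed
  ultimately show ?case by simp
qed

lemma Ck_on_linear_image:
  fixes f :: "'a::euclidean_space \<Rightarrow> 'b::euclidean_space" and L :: "'b \<Rightarrow> 'c::euclidean_space"
  assumes L: "bounded_linear L" and S: "open S" and f: "Ck_on n S f"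
  shows "Ck_on n S (\<lambda>x. L (f x))"
  using f
proof (induction n arbitrary: f)
  case 0
  then show ?case by (simp add: bounded_linear.continuous_on[OF L])
next
  case (Suc n)
  have D: "((\<lambda>x. L (f x)) has_derivative (\<lambda>v. L (frechet_derivative f (at x) v))) (at x)"
    if "x \<in> S" for x
    using Suc.prems that by (intro bounded_linear.has_derivative[OF L])
      (auto simp: frechet_derivative_works)
  have "Ck_on n S (\<lambda>x. frechet_derivative (\<lambda>x. L (f x)) (at x) v)" for v
  proof (rule Ck_on_cong_imp[OF S])
    show "Ck_on n S (\<lambda>x. L (frechet_derivative f (at x) v))" using Suc by simp
    show "L (frechet_derivative f (at x) v) = frechet_derivative (\<lambda>x. L (f x)) (at x) v"
      if "x \<in> S" for x
      using frechet_derivative_at[OF D[OF that]] by metis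
  qed
  then show ?case using D by (auto simp: differentiable_def)
qed

lemma Ck_on_affine:
  fixes f :: "'a::euclidean_space \<Rightarrow> 'b::euclidean_space"
  assumes I: "open I" and IV: "\<And>t. t \<in> I \<Longrightarrow> a + t *\<^sub>R w \<in> V" and f: "Ck_on n V f"
  shows "Ck_on n I (\<lambda>t::real. f (a + t *\<^sub>R w))"
  using f
proof (induction n arbitrary: f)
  case 0
  then show ?case
    by (auto intro!: continuous_on_compose2[of V f] continuous_intros IV)
next
  case (Suc n)
  have D: "((\<lambda>t. f (a + t *\<^sub>R w)) has_derivative
      (\<lambda>s. s *\<^sub>R frechet_derivative f (at (a + t *\<^sub>R w)) w)) (at t)" if t: "t \<in> I" for t
  proof -
    have "(f has_derivative frechet_derivative f (at (a + t *\<^sub>R w))) (at (a + t *\<^sub>R w))"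
      using Suc.prems IV[OF t] by (simp add: frechet_derivative_works)
    moreover have "((\<lambda>t. a + t *\<^sub>R w) has_derivative (\<lambda>s. s *\<^sub>R w)) (at t)"
      by (auto intro!: derivative_eq_intros)
    ultimately have "((\<lambda>t. f (a + t *\<^sub>R w)) has_derivative
        (\<lambda>s. frechet_derivative f (at (a + t *\<^sub>R w)) (s *\<^sub>R w))) (at t)"
      using diff_chain_at[of "\<lambda>t. a + t *\<^sub>R w" "\<lambda>s. s *\<^sub>R w" t f] by (simp add: o_def)
    moreover have "linear (frechet_derivative f (at (a + t *\<^sub>R w)))"
      using Suc.prems IV[OF t] by (intro linear_frechet_derivative) simp
    ultimately show ?thesis by (simp add: linear_scale)
  qed
  have "Ck_on n I (\<lambda>t. frechet_derivative (\<lambda>t. f (a + t *\<^sub>R w)) (at t) s)" for s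
  proof (rule Ck_on_cong_imp[OF I])
    have "Ck_on n I (\<lambda>t. frechet_derivative f (at (a + t *\<^sub>R w)) w)"
      using Suc.prems by (intro Suc.IH) simp
    then show "Ck_on n I (\<lambda>t. s *\<^sub>R frechet_derivative f (at (a + t *\<^sub>R w)) w)"
      by (rule Ck_on_linear_image[OF bounded_linear_scaleR_right I])
    show "s *\<^sub>R frechet_derivative f (at (a + t *\<^sub>R w)) w
        = frechet_derivative (\<lambda>t. f (a + t *\<^sub>R w)) (at t) s" if "t \<in> I" for t
      using fun_cong[OF frechet_derivative_at[OF D[OF that]]] by metis
  qed
  then show ?case using D by (auto simp: differentiable_def)
qed

lemma smooth_on_differentiable: "smooth_on S f \<Longrightarrow> x \<in> S \<Longrightarrow> f differentiable (at x)"
  unfolding smooth_on_def by (drule spec[of _ "Suc 0"]) simp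

lemma has_derivative_frechet:
  "smooth_on S f \<Longrightarrow> x \<in> S \<Longrightarrow> (f has_derivative frechet_derivative f (at x)) (at x)"
  by (rule frechet_derivative_works[THEN iffD1, OF smooth_on_differentiable])

lemma tangent_space_linear_image:
  fixes L :: "'a::euclidean_space \<Rightarrow> 'b::euclidean_space"
  assumes L: "bounded_linear L" and M: "L ` M \<subseteq> M'" and v: "v \<in> tangent_space M x"
  shows "L v \<in> tangent_space M' (L x)"
proof -
  from v obtain e \<gamma> where e: "e > 0" and \<gamma>: "smooth_on {-e<..<e} \<gamma>" "\<gamma> ` {-e<..<e} \<subseteq> M"
    "\<gamma> 0 = x" "(\<gamma> has_vector_derivative v) (at 0)"
    unfolding tangent_space_def by blast
  show ?thesis unfolding tangent_space_def mem_Collect_eq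
  proof (intro exI[of _ e] exI[of _ "\<lambda>t. L (\<gamma> t)"] conjI)
    show "smooth_on {-e<..<e} (\<lambda>t. L (\<gamma> t))"
      using \<gamma>(1) by (simp add: smooth_on_def Ck_on_linear_image[OF L])
    show "(\<lambda>t. L (\<gamma> t)) ` {- e<..<e} \<subseteq> M'" using \<gamma>(2) M by auto
    show "((\<lambda>t. L (\<gamma> t)) has_vector_derivative L v) (at 0)"
      by (rule bounded_linear.has_vector_derivative[OF L \<gamma>(4)])
  qed (use e \<gamma>(3) in auto)
qed

text \<open>Every linear functional that vanishes on \<open>W\<close> is zero along the curve near \<open>0\<close>, hence vanishes on its
  velocity.\<close>
lemma closed_subspace_derivative:
  fixes h :: "real \<Rightarrow> 'a::euclidean_space"
  assumes W: "subspace W" and h: "(h has_vector_derivative v) (at 0)"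
    and ev: "eventually (\<lambda>t. h t \<in> W) (nhds 0)"
  shows "v \<in> W"
proof -
  obtain y z where y: "y \<in> W" and z: "\<And>w. w \<in> W \<Longrightarrow> inner z w = 0" and v: "v = y + z"
    using orthogonal_subspace_decomp_exists[of W v] W span_eq_iff[of W]
    unfolding real_inner_class.orthogonal_def by metis
  obtain S where S: "open S" "0 \<in> S" "\<And>t. t \<in> S \<Longrightarrow> h t \<in> W"
    using ev unfolding eventually_nhds by blast
  have "((\<lambda>t. inner (h t) z) has_vector_derivative inner v z) (at 0)"
    by (rule bounded_linear.has_vector_derivative[OF bounded_linear_inner_left h])
  moreover have "((\<lambda>t. inner (h t) z) has_vector_derivative 0) (at 0)"
    by (rule has_vector_derivative_transform_within_open[OF has_vector_derivative_const S(1,2)])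
      (simp add: inner_commute z S(3))
  ultimately have "inner v z = 0" by (rule vector_derivative_unique_at)
  then have "z = 0" using z[OF y] by (simp add: v inner_add_left inner_commute[of y])
  then show ?thesis using v y by simp
qed

lemma submanifold_chart:
  fixes M :: "'a::euclidean_space set"
  assumes "smooth_submanifold M" "x \<in> M"
  obtains U V and \<phi> \<psi> :: "'a \<Rightarrow> 'a" and W where
    "open U" "x \<in> U" "open V" "homeomorphism U V \<phi> \<psi>"
    "smooth_on U \<phi>" "smooth_on V \<psi>" "subspace W" "\<phi> ` (M \<inter> U) = W \<inter> V"
proof -
  obtain m where "\<forall>x\<in>M. \<exists>U V (\<phi> :: 'a \<Rightarrow> 'a) \<psi> W. open U \<and> x \<in> U \<and> open V \<and>
     homeomorphism U V \<phi> \<psi> \<and> smooth_on U \<phi> \<and> smooth_on V \<psi> \<and>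
     subspace W \<and> dim W = m \<and> \<phi> ` (M \<inter> U) = W \<inter> V"
    using assms(1) unfolding smooth_submanifold_def by (elim exE)
  from bspec[OF this assms(2)] show thesis
    by (elim exE conjE) (rule that)
qed

text \<open>Curves in \<open>M\<close> are mapped by the chart into \<open>W\<close>, and straight lines in \<open>W\<close> are mapped back to smooth
  curves in \<open>M\<close>. This is why the velocities form a linear subspace, which the orthogonal projection needs.\<close>
lemma tangent_space_chart:
  fixes M :: "'a::euclidean_space set" and \<phi> \<psi> :: "'a \<Rightarrow> 'a"
  assumes x: "x \<in> M" "x \<in> U" and U: "open U" and V: "open V" and hom: "homeomorphism U V \<phi> \<psi>"
    and smooth: "smooth_on U \<phi>" "smooth_on V \<psi>" and W: "subspace W"
    and flat: "\<phi> ` (M \<inter> U) = W \<inter> V"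
  shows "tangent_space M x = frechet_derivative \<psi> (at (\<phi> x)) ` W"
proof -
  let ?D\<phi> = "frechet_derivative \<phi> (at x)" and ?D\<psi> = "frechet_derivative \<psi> (at (\<phi> x))"
  have inv: "\<psi> (\<phi> y) = y" if "y \<in> U" for y using hom that by (simp add: homeomorphism_def)
  have \<phi>x: "\<phi> x \<in> V" "\<phi> x \<in> W" using flat x by auto
  have D\<phi>: "(\<phi> has_derivative ?D\<phi>) (at x)" using has_derivative_frechet[OF smooth(1) x(2)] .
  have D\<psi>: "(\<psi> has_derivative ?D\<psi>) (at (\<phi> x))" using has_derivative_frechet[OF smooth(2) \<phi>x(1)] .
  have "((\<lambda>y. y) has_derivative (\<lambda>v. ?D\<psi> (?D\<phi> v))) (at x)"
  proof (rule has_derivative_transform_within_open[OF _ U x(2)])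
    show "((\<lambda>y. \<psi> (\<phi> y)) has_derivative (\<lambda>v. ?D\<psi> (?D\<phi> v))) (at x)"
      using diff_chain_at[OF D\<phi> D\<psi>] by (simp add: o_def)
  qed (simp add: inv)
  then have D_inv: "?D\<psi> (?D\<phi> v) = v" for v
    using has_derivative_unique[OF has_derivative_ident[of "at x"]] by metis
  show ?thesis
  proof (intro equalityI subsetI)
    fix v assume "v \<in> tangent_space M x"
    then obtain e \<gamma> where e: "e > 0" and \<gamma>: "smooth_on {-e<..<e} \<gamma>" "\<gamma> ` {-e<..<e} \<subseteq> M"
      "\<gamma> 0 = x" "(\<gamma> has_vector_derivative v) (at 0)"
      unfolding tangent_space_def by blast
    have "((\<lambda>t. \<phi> (\<gamma> t)) has_vector_derivative ?D\<phi> v) (at 0)"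
      using vector_derivative_diff_chain_within[of \<gamma> v 0 UNIV \<phi> ?D\<phi>] \<gamma>(3,4) D\<phi>
      by (simp add: o_def has_derivative_at_withinI)
    moreover have "eventually (\<lambda>t. \<phi> (\<gamma> t) \<in> W) (nhds 0)"
    proof -
      have "continuous (at 0) \<gamma>" using \<gamma>(4) by (rule has_vector_derivative_continuous)
      then have "eventually (\<lambda>t. \<gamma> t \<in> U) (nhds 0)"
        unfolding continuous_at_open eventually_nhds using \<gamma>(3) x(2) U by metis
      moreover have "eventually (\<lambda>t. t \<in> {-e<..<e}) (nhds 0)"
        using e by (intro eventually_nhds_in_open) auto
      ultimately show ?thesis
      proof eventually_elim
        case (elim t)
        then have "\<gamma> t \<in> M \<inter> U" using \<gamma>(2) by blast
        then show ?case using flat by blast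
      qed
    qed
    ultimately have "?D\<phi> v \<in> W" using W closed_subspace_derivative by blast
    then show "v \<in> ?D\<psi> ` W" using D_inv[of v] by (metis imageI)
  next
    fix v assume "v \<in> ?D\<psi> ` W"
    then obtain w where w: "w \<in> W" "v = ?D\<psi> w" by blast
    obtain d where d: "d > 0" "ball (\<phi> x) d \<subseteq> V" using V \<phi>x(1) openE by blast
    define e where "e = d / (norm w + 1)"
    have n: "norm w + 1 > 0" by (simp add: add_nonneg_pos)
    then have e: "e > 0" using d by (simp add: e_def)
    have inV: "\<phi> x + t *\<^sub>R w \<in> V" if "t \<in> {-e<..<e}" for t
    proof -
      have "\<bar>t\<bar> * norm w \<le> \<bar>t\<bar> * (norm w + 1)" by (intro mult_left_mono) auto
      also have "\<dots> < d" using that n by (auto simp: e_def abs_less_iff field_simps)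
      finally show ?thesis using d(2) by (auto simp: dist_norm subset_iff)
    qed
    have inM: "\<psi> (\<phi> x + t *\<^sub>R w) \<in> M" if "t \<in> {-e<..<e}" for t
    proof -
      have "\<phi> x + t *\<^sub>R w \<in> W \<inter> V"
        using inV[OF that] \<phi>x w W by (simp add: subspace_add subspace_scale)
      then obtain y where "y \<in> M \<inter> U" "\<phi> x + t *\<^sub>R w = \<phi> y" using flat by blast
      then show ?thesis using inv by simp
    qed
    show "v \<in> tangent_space M x" unfolding tangent_space_def mem_Collect_eq
    proof (intro exI[of _ e] exI[of _ "\<lambda>t. \<psi> (\<phi> x + t *\<^sub>R w)"] conjI)
      show "smooth_on {-e<..<e} (\<lambda>t. \<psi> (\<phi> x + t *\<^sub>R w))"
        using smooth(2) inV by (auto simp: smooth_on_def intro!: Ck_on_affine[where V = V])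
      have "((\<lambda>t. \<phi> x + t *\<^sub>R w) has_vector_derivative w) (at 0)"
        by (auto intro!: derivative_eq_intros)
      then show "((\<lambda>t. \<psi> (\<phi> x + t *\<^sub>R w)) has_vector_derivative v) (at 0)"
        using vector_derivative_diff_chain_within[of "\<lambda>t. \<phi> x + t *\<^sub>R w" w 0 UNIV \<psi> ?D\<psi>] D\<psi> w
        by (simp add: o_def has_derivative_at_withinI)
    qed (use e inM inv x in auto)
  qed
qed

lemma subspace_tangent_space:
  fixes M :: "'a::euclidean_space set"
  assumes "smooth_submanifold M" "x \<in> M"
  shows "subspace (tangent_space M x)"
proof -
  obtain U V and \<phi> \<psi> :: "'a \<Rightarrow> 'a" and W where *: "open U" "x \<in> U" "open V"
    "homeomorphism U V \<phi> \<psi>" "smooth_on U \<phi>" "smooth_on V \<psi>" "subspace W"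
    "\<phi> ` (M \<inter> U) = W \<inter> V"
    using submanifold_chart[OF assms] by blast
  then have "\<phi> x \<in> V" using assms by auto
  then have "linear (frechet_derivative \<psi> (at (\<phi> x)))"
    using * by (intro linear_frechet_derivative smooth_on_differentiable)
  then show ?thesis
    unfolding tangent_space_chart[OF assms(2) *(2,1,3-8)] using *(7) by (rule linear_subspace_image)
qed

text \<open>In a chart the submanifold is a linear subspace, and this is closed.\<close>
lemma submanifold_locally_closed:
  fixes M :: "'a::euclidean_space set"
  assumes "smooth_submanifold M" "x \<in> M"
  obtains d where "d > 0" "ball x d \<inter> closure M \<subseteq> M"
proof -
  obtain U V and \<phi> \<psi> :: "'a \<Rightarrow> 'a" and W where *: "open U" "x \<in> U" "open V"
    "homeomorphism U V \<phi> \<psi>" "smooth_on U \<phi>" "smooth_on V \<psi>" "subspace W"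
    "\<phi> ` (M \<inter> U) = W \<inter> V"
    using submanifold_chart[OF assms] by blast
  have inv: "\<psi> (\<phi> y) = y" if "y \<in> U" for y using *(4) that by (simp add: homeomorphism_def)
  have cont: "continuous_on U \<phi>" and im: "\<phi> ` U = V" using *(4) by (auto simp: homeomorphism_def)
  obtain d where d: "d > 0" "ball x d \<subseteq> U" using * openE by blast
  have "z \<in> M" if z: "z \<in> ball x d" "z \<in> closure M" for z
  proof -
    have zU: "z \<in> U" using z d by blast
    have "z \<in> closure (U \<inter> M)" using open_Int_closure_subset[OF *(1), of M] zU z(2) by blast
    then obtain s where s: "\<And>n. s n \<in> U \<inter> M" "s \<longlonglongrightarrow> z" unfolding closure_sequential by blast
    have "(\<lambda>n. \<phi> (s n)) \<longlonglongrightarrow> \<phi> z"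
      using continuous_on_tendsto_compose[OF cont s(2) zU] s(1) by simp
    moreover have "\<phi> (s n) \<in> W" for n using s(1)[of n] *(8) by blast
    ultimately have "\<phi> z \<in> W" using closed_sequentially[OF closed_subspace[OF *(7)], of "\<lambda>n. \<phi> (s n)"] by simp
    then have "\<phi> z \<in> \<phi> ` (M \<inter> U)" using *(8) im zU by blast
    then obtain y where "y \<in> M" "y \<in> U" "\<phi> z = \<phi> y" by blast
    then show ?thesis using inv zU by metis
  qed
  then show thesis using that d by blast
qed

section \<open>Orthogonal projections and weak closures\<close>

lemma orth_proj_eqI:
  assumes "y \<in> S" "\<And>s. s \<in> S \<Longrightarrow> inner (x - y) s = 0"
  shows "orth_proj S x = y"
  unfolding orth_proj_def
proof (rule the_equality)
  fix z assume z: "z \<in> S \<and> (\<forall>s\<in>S. inner (x - z) s = 0)"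
  have "inner (z - y) (z - y) = inner (x - y) (z - y) - inner (x - z) (z - y)"
    by (simp add: inner_diff_left inner_diff_right)
  also have "\<dots> = 0" using z assms by (simp add: inner_diff_right)
  finally show "z = y" by simp
qed (use assms in auto)

lemma orth_proj_subspace:
  fixes S :: "'a::euclidean_space set"
  assumes "subspace S"
  shows "orth_proj S x \<in> S" "s \<in> S \<Longrightarrow> inner (x - orth_proj S x) s = 0"
proof -
  obtain y z where yz: "y \<in> S" "\<And>w. w \<in> S \<Longrightarrow> inner z w = 0" "x = y + z"
    using orthogonal_subspace_decomp_exists[of S x] assms span_eq_iff[of S]
    unfolding real_inner_class.orthogonal_def by metis
  then have "orth_proj S x = y" by (intro orth_proj_eqI) auto
  then show "orth_proj S x \<in> S" "s \<in> S \<Longrightarrow> inner (x - orth_proj S x) s = 0"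
    using yz by auto
qed

lemma openin_weak_functional:
  fixes f :: "'a::real_normed_vector \<Rightarrow>\<^sub>L real"
  shows "open U \<Longrightarrow> openin weak_topology (blinfun_apply f -` U)"
  unfolding weak_topology_def
  by (rule topology_generated_by_Basis) (rule CollectI, rule exI[of _ f], rule exI[of _ U], simp)

lemma topspace_weak [simp]: "topspace weak_topology = (UNIV :: 'a::real_normed_vector set)"
proof -
  have "openin weak_topology (blinfun_apply (0 :: 'a \<Rightarrow>\<^sub>L real) -` UNIV)"
    by (rule openin_weak_functional) simp
  then show ?thesis using openin_subset by fastforce
qed

lemma openin_weak_imp_open:
  assumes "openin weak_topology (S :: 'a::real_normed_vector set)"
  shows "open S"
proof -
  have "generate_topology_on {blinfun_apply f -` U |(f :: 'a \<Rightarrow>\<^sub>L real) U. open U} S"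
    using assms unfolding weak_topology_def openin_topology_generated_by_iff .
  then show ?thesis
  proof (induction rule: generate_topology_on.induct)
    case (Basis s)
    then obtain f :: "'a \<Rightarrow>\<^sub>L real" and U where s: "s = blinfun_apply f -` U" "open U"
      by (elim CollectE exE conjE)
    show ?case unfolding s(1)
      by (intro open_vimage s(2) linear_continuous_on blinfun.bounded_linear_right)
  qed auto
qed

lemma closure_subset_weak_closure: "closure S \<subseteq> weak_closure S"
proof
  fix x assume x: "x \<in> closure S"
  show "x \<in> weak_closure S" unfolding weak_closure_def in_closure_of
  proof (intro conjI allI impI)
    fix T assume "x \<in> T \<and> openin weak_topology T"
    then have "open T" "x \<in> T" using openin_weak_imp_open by auto
    then show "\<exists>y. y \<in> S \<and> y \<in> T" using x open_Int_closure_eq_empty[of T S] by blast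
  qed simp
qed

text \<open>The filter plays the role of a net in \<open>S\<close> that converges weakly to \<open>Z\<close>; sequences would not
  suffice, since \<open>S\<close> may be unbounded.\<close>
lemma weak_closure_filter:
  fixes Z :: "'a::real_inner"
  assumes "Z \<in> weak_closure S"
  obtains F where "F \<noteq> bot" "eventually (\<lambda>w. w \<in> S) F"
    "\<And>g. ((\<lambda>w. inner w g) \<longlongrightarrow> inner Z g) F"
proof -
  define F where "F = inf (nhdsin weak_topology Z) (principal S)"
  have ev: "eventually P F \<longleftrightarrow> (\<exists>T. openin weak_topology T \<and> Z \<in> T \<and> (\<forall>w\<in>T. w \<in> S \<longrightarrow> P w))" for P
    by (simp add: F_def eventually_inf_principal eventually_nhdsin)
  show thesis
  proof (rule that)
    show "F \<noteq> bot"
    proof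
      assume "F = bot"
      then have "eventually (\<lambda>_. False) F" by simp
      then obtain T where "openin weak_topology T" "Z \<in> T" "\<forall>w\<in>T. w \<notin> S" unfolding ev by blast
      then show False using assms unfolding weak_closure_def in_closure_of by blast
    qed
    show "eventually (\<lambda>w. w \<in> S) F" unfolding F_def by (simp add: eventually_inf_principal)
    show "((\<lambda>w. inner w g) \<longlongrightarrow> inner Z g) F" for g
    proof (rule topological_tendstoI)
      fix U assume "open U" "inner Z g \<in> U"
      then show "eventually (\<lambda>w. inner w g \<in> U) F"
        unfolding ev using openin_weak_functional[of U "blinfun_inner_left g"]
        by (intro exI[of _ "blinfun_apply (blinfun_inner_left g) -` U"]) auto
    qed
  qed
qed

section \<open>The core manifold and the tensor manifold\<close>

locale core_manifold_setting = tensor_labels r p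
  for r :: "'d::finite \<Rightarrow> nat" and p :: "'n::finite \<Rightarrow> 'd \<Rightarrow> nat" +
  fixes Mc :: "(real ^ 'n) set"
  assumes core_manifold: "core_manifold r p Mc"
begin

abbreviation "M \<equiv> tensor_manifold r p Mc"

lemma smooth_Mc: "smooth_submanifold Mc"
  using core_manifold by (simp add: core_manifold_def)

lemma Mc_nondegenerate: "C \<in> Mc \<Longrightarrow> nondegenerate C"
  using core_manifold full_rank_imp_nondegenerate by (auto simp: core_manifold_def)

lemma Mc_core_mult: "C \<in> Mc \<Longrightarrow> (\<And>\<mu>. invertible_square (r \<mu>) (T \<mu>)) \<Longrightarrow> core_mult p C T \<in> Mc"
  using core_manifold by (simp add: core_manifold_def)

lemma MI: "C \<in> Mc \<Longrightarrow> regular_factors r U \<Longrightarrow> tucker p C U \<in> M"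
  by (auto simp: tensor_manifold_def)

lemma ME:
  assumes "X \<in> M"
  obtains C U where "C \<in> Mc" "regular_factors r U" "X = tucker p C U"
  using assms by (auto simp: tensor_manifold_def)

lemma tangent_core_mult:
  assumes "C' \<in> tangent_space Mc C" "\<And>\<mu>. invertible_square (r \<mu>) (T \<mu>)"
  shows "core_mult p C' T \<in> tangent_space Mc (core_mult p C T)"
proof (rule tangent_space_linear_image[OF _ _ assms(1)])
  have "linear (\<lambda>C. core_mult p C T)"
    by (rule linearI) (simp_all add: core_mult_def Finite_Cartesian_Product.vec_eq_iff sum.distrib
        distrib_right sum_distrib_left mult.assoc)
  then show "bounded_linear (\<lambda>C. core_mult p C T)" by (simp add: linear_conv_bounded_linear)
  show "(\<lambda>C. core_mult p C T) ` Mc \<subseteq> Mc" using assms(2) Mc_core_mult by blast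
qed

text \<open>Singular \<open>T\<close> are approximated by the invertible matrices \<open>T + t I\<close> with small \<open>t \<noteq> 0\<close>.\<close>
lemma core_mult_in_closure:
  assumes C: "C \<in> Mc"
  shows "core_mult p C T \<in> closure Mc"
proof -
  define T' where "T' t \<mu> i j = T \<mu> i j + t * of_bool (i = j)" for t \<mu> i j
  define S where "S = (\<Union>\<mu>. {t. \<not> invertible_square (r \<mu>) (T' t \<mu>)})"
  have "finite S" unfolding S_def T'_def 
    by (intro finite_UN_I finite_class.finite_UNIV finite_singular_shifts)
  then have "open (- (S - {0}))" by (intro open_Compl finite_imp_closed) auto
  then have "eventually (\<lambda>t. t \<notin> S) (at 0)"
    unfolding eventually_at_topological by (intro exI[of _ "- (S - {0})"]) auto
  then have ev: "eventually (\<lambda>t. core_mult p C (T' t) \<in> closure Mc) (at 0)"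
  proof eventually_elim
    case (elim t)
    then show ?case by (auto simp: S_def intro!: subsetD[OF closure_subset] Mc_core_mult[OF C])
  qed
  have "((\<lambda>t. core_mult p C (T' t)) \<longlongrightarrow> core_mult p C (T' 0)) (at 0)"
    unfolding core_mult_def T'_def
    by (intro tendsto_vec_lambda tendsto_sum tendsto_mult tendsto_prod tendsto_add tendsto_const tendsto_ident_at)
  moreover have "T' 0 = T" by (simp add: T'_def fun_eq_iff)
  ultimately show ?thesis using Lim_in_closed_set[OF closed_closure ev] by simp
qed

lemma regular_if_invertible_pairing:
  assumes "\<And>\<mu>. invertible_square (r \<mu>) (\<lambda>l k. inner (U \<mu> l) (V \<mu> k))"
  shows "regular_factors r V"
  unfolding regular_factors_def invertible_square_iff_inj
proof (intro allI impI)
  fix \<mu> x k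
  assume x: "\<forall>i<r \<mu>. (\<Sum>k<r \<mu>. inner (V \<mu> i) (V \<mu> k) * x k) = 0" and k: "k < r \<mu>"
  have "inner (V \<mu> i) (\<Sum>k<r \<mu>. x k *\<^sub>R V \<mu> k) = 0" if "i < r \<mu>" for i
    using x that by (simp add: inner_sum_right mult.commute)
  then have "inner (\<Sum>k<r \<mu>. x k *\<^sub>R V \<mu> k) (\<Sum>k<r \<mu>. x k *\<^sub>R V \<mu> k) = 0"
    by (subst inner_sum_left) simp
  then have 0: "(\<Sum>k<r \<mu>. x k *\<^sub>R V \<mu> k) = 0" by simp
  have "(\<Sum>k<r \<mu>. inner (U \<mu> l) (V \<mu> k) * x k) = inner (U \<mu> l) (\<Sum>k<r \<mu>. x k *\<^sub>R V \<mu> k)" for l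
    by (simp add: inner_sum_right mult.commute)
  then have "(\<Sum>k<r \<mu>. inner (U \<mu> l) (V \<mu> k) * x k) = 0" for l by (simp add: 0)
  then show "x k = 0" using assms[of \<mu>] k unfolding invertible_square_iff_inj by blast
qed

lemma orthonormal_imp_regular:
  assumes "orthonormal_factors U"
  shows "regular_factors r U"
proof (rule regular_if_invertible_pairing)
  fix \<mu>
  show "invertible_square (r \<mu>) (\<lambda>l k. inner (U \<mu> l) (U \<mu> k))"
    using invertible_square_id[of "r \<mu>"] assms
      invertible_square_cong[of "r \<mu>" "\<lambda>l k. inner (U \<mu> l) (U \<mu> k)" "\<lambda>l k. of_bool (l = k)"]
    by (simp add: ons_def)
qed

text \<open>The change from \<open>V\<close> to orthonormal factors is by invertible matrices, which are absorbed by the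
  core.\<close>
lemma orthonormal_representation:
  assumes "X \<in> M"
  obtains C U where "C \<in> Mc" "orthonormal_factors U" "X = tucker p C U"
proof -
  obtain D V where D: "D \<in> Mc" and V: "regular_factors r V" and X: "X = tucker p D V"
    using assms by (rule ME)
  have "\<forall>\<mu>. \<exists>b. ons (r \<mu>) b \<and> (\<forall>k<r \<mu>. V \<mu> k = (\<Sum>l<r \<mu>. inner (b l) (V \<mu> k) *\<^sub>R b l)) \<and>
    invertible_square (r \<mu>) (\<lambda>l k. inner (b l) (V \<mu> k))"
    using regular_factors_independent[OF V] by (intro allI orthonormalize_independent) blast
  from choice[OF this] obtain U where U: "\<And>\<mu>. ons (r \<mu>) (U \<mu>)"
    "\<And>\<mu> k. k < r \<mu> \<Longrightarrow> V \<mu> k = (\<Sum>l<r \<mu>. inner (U \<mu> l) (V \<mu> k) *\<^sub>R U \<mu> l)"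
    "\<And>\<mu>. invertible_square (r \<mu>) (\<lambda>l k. inner (U \<mu> l) (V \<mu> k))" by blast
  show thesis
  proof (rule that)
    show "core_mult p D (\<lambda>\<mu> l k. inner (U \<mu> l) (V \<mu> k)) \<in> Mc" using D U(3) by (rule Mc_core_mult)
    show "X = tucker p (core_mult p D (\<lambda>\<mu> l k. inner (U \<mu> l) (V \<mu> k))) U"
      unfolding X by (rule tucker_core_mult) (rule U(2))
  qed (use U in auto)
qed

lemma inner_tucker_orthonormal:
  assumes "orthonormal_factors U" "i \<in> Idx r"
  shows "inner (tucker p C U) (elementary_tensor (\<lambda>\<mu>. U \<mu> (i \<mu>))) = entry p C i"
  using assms by (intro inner_tucker_dual) (auto simp: ons_def Idx_def)

lemma norm_tucker:
  assumes "orthonormal_factors U"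
  shows "norm (tucker p C U) = norm C"
proof -
  have "(norm (tucker p C U))\<^sup>2 = (\<Sum>i\<in>Idx r. (entry p C i)\<^sup>2)"
    using assms by (intro orthonormal_sum(2)[OF _ _ tucker_Idx] elementary_tensor_orthonormal) auto
  then have "(norm (tucker p C U))\<^sup>2 = (norm C)\<^sup>2" by (simp add: norm_core)
  then show ?thesis by (rule power2_eq_imp_eq) auto
qed

text \<open>For orthonormal factors the rows of the matricization of the tensor have the same Gram matrix as
  those of the core.\<close>
lemma norm_slice_combination:
  assumes U: "orthonormal_factors U"
  shows "(norm (\<Sum>m<r \<mu>. x m *\<^sub>R slice \<mu> C U m))\<^sup>2
    = (\<Sum>j\<in>Idx0 r \<mu>. (\<Sum>m<r \<mu>. x m * entry p C (j(\<mu> := m)))\<^sup>2)"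
proof (rule orthonormal_sum(2))
  show "(\<Sum>m<r \<mu>. x m *\<^sub>R slice \<mu> C U m) = (\<Sum>j\<in>Idx0 r \<mu>. (\<Sum>m<r \<mu>. x m * entry p C (j(\<mu> := m)))
      *\<^sub>R elementary_tensor ((\<lambda>\<nu>. U \<nu> (j \<nu>))(\<mu> := unit_seq 0)))"
    unfolding slice_def scaleR_sum_right scaleR_sum_left by (subst sum.swap) simp
  fix i j assume ij: "i \<in> Idx0 r \<mu>" "j \<in> Idx0 r \<mu>"
  have "(\<Prod>\<nu>\<in>UNIV - {\<mu>}. inner (U \<nu> (i \<nu>)) (U \<nu> (j \<nu>))) = (\<Prod>\<nu>\<in>UNIV - {\<mu>}. of_bool (i \<nu> = j \<nu>))"
    using U ij by (intro prod.cong) (auto simp: ons_def Idx0_def Idx_def)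
  also have "\<dots> = of_bool (i = j)"
  proof -
    have "(\<forall>\<nu>\<in>UNIV - {\<mu>}. i \<nu> = j \<nu>) \<longleftrightarrow> i = j" using ij by (auto simp: Idx0_def fun_eq_iff)
    then show ?thesis by (simp add: prod_of_bool_eq)
  qed
  finally show "inner (elementary_tensor ((\<lambda>\<nu>. U \<nu> (i \<nu>))(\<mu> := unit_seq 0)))
      (elementary_tensor ((\<lambda>\<nu>. U \<nu> (j \<nu>))(\<mu> := unit_seq 0))) = of_bool (i = j)"
    by (simp add: inner_elementary_tensor prod_split_mode[of _ \<mu>] inner_unit_seq unit_seq_nth)
qed simp

lemma smallest_singular_value_tucker:
  fixes \<mu> :: 'd
  assumes U: "orthonormal_factors U" and C: "nondegenerate C"
  defines "s \<equiv> smallest_singular_value \<mu> (tucker p C U)"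
  shows "s > 0"
    and "\<And>x. s\<^sup>2 * (\<Sum>m<r \<mu>. (x m)\<^sup>2) \<le> (norm (\<Sum>m<r \<mu>. x m *\<^sub>R slice \<mu> C U m))\<^sup>2"
    and "\<exists>x. (\<Sum>m<r \<mu>. (x m)\<^sup>2) = 1 \<and> (norm (\<Sum>m<r \<mu>. x m *\<^sub>R slice \<mu> C U m))\<^sup>2 = s\<^sup>2"
proof -
  have indep: "x m = 0" if "(\<Sum>m<r \<mu>. x m *\<^sub>R slice \<mu> C U m) = 0" and m: "m < r \<mu>" for x m
  proof (rule nondegenerateD[OF C _ m])
    fix j assume "j \<in> Idx0 r \<mu>"
    moreover have "(\<Sum>j\<in>Idx0 r \<mu>. (\<Sum>m<r \<mu>. x m * entry p C (j(\<mu> := m)))\<^sup>2) = 0"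
      using that(1) norm_slice_combination[OF U, where \<mu> = \<mu> and x = x and C = C] by simp
    ultimately show "(\<Sum>m<r \<mu>. x m * entry p C (j(\<mu> := m))) = 0"
      by (simp add: sum_nonneg_eq_0_iff)
  qed
  have onsU: "ons (r \<mu>) (U \<mu>)" using U by blast
  note sv = singular_values_of_expansion[where A = "matricization \<mu> (tucker p C U)" and u = "U \<mu>"
      and a = "slice \<mu> C U" and r = "r \<mu>", folded smallest_singular_value_def s_def]
  show "s > 0"
    by (rule sv(1), rule onsU, rule r_pos, rule matricization_tucker, erule indep)
  show "s\<^sup>2 * (\<Sum>m<r \<mu>. (x m)\<^sup>2) \<le> (norm (\<Sum>m<r \<mu>. x m *\<^sub>R slice \<mu> C U m))\<^sup>2" for x
    by (rule sv(2), rule onsU, rule r_pos, rule matricization_tucker, erule indep)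
  show "\<exists>x. (\<Sum>m<r \<mu>. (x m)\<^sup>2) = 1 \<and> (norm (\<Sum>m<r \<mu>. x m *\<^sub>R slice \<mu> C U m))\<^sup>2 = s\<^sup>2"
    by (rule sv(3), rule onsU, rule r_pos, rule matricization_tucker, erule indep)
qed

lemma entry_core_mult_mode:
  assumes T: "\<And>\<nu> i k. \<nu> \<noteq> \<mu> \<Longrightarrow> T \<nu> i k = of_bool (i = k)" and j: "j \<in> Idx0 r \<mu>" and m: "m < r \<mu>"
  shows "entry p (core_mult p C T) (j(\<mu> := m)) = (\<Sum>k<r \<mu>. T \<mu> m k * entry p C (j(\<mu> := k)))"
proof -
  have "(\<Prod>\<nu>\<in>UNIV. T \<nu> ((j(\<mu> := m)) \<nu>) ((i(\<mu> := k)) \<nu>)) = of_bool (i = j) * T \<mu> m k"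
    if "i \<in> Idx0 r \<mu>" for i k
  proof -
    have "(\<Prod>\<nu>\<in>UNIV - {\<mu>}. T \<nu> ((j(\<mu> := m)) \<nu>) ((i(\<mu> := k)) \<nu>)) = (\<Prod>\<nu>\<in>UNIV - {\<mu>}. of_bool (j \<nu> = i \<nu>))"
      by (intro prod.cong) (auto simp: T)
    also have "\<dots> = of_bool (i = j)"
      using Idx0_eq_iff[OF j that] by (simp add: prod_of_bool_eq eq_commute)
    finally show ?thesis by (simp add: prod_split_mode[of _ \<mu>])
  qed
  then have "entry p (core_mult p C T) (j(\<mu> := m))
      = (\<Sum>i\<in>Idx0 r \<mu>. \<Sum>k<r \<mu>. of_bool (i = j) * (T \<mu> m k * entry p C (i(\<mu> := k))))"
    using j m by (simp add: entry_core_mult Idx0_updI sum_Idx_fibers[of r \<mu>] r_pos mult_ac)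
  also have "\<dots> = (\<Sum>i\<in>Idx0 r \<mu>. of_bool (i = j) * (\<Sum>k<r \<mu>. T \<mu> m k * entry p C (i(\<mu> := k))))"
    by (simp add: sum_distrib_left)
  finally show ?thesis using j by simp
qed

text \<open>If \<open>x\<close> is a unit left singular vector for the smallest singular value, then multiplying mode \<open>\<mu>\<close> of \<open>C\<close> by
  the singular projection \<open>I - x x\<^sup>T\<close> removes one rank-one term of the matricization, whose norm is that singular value. The
  result is in the closure by \<open>core_mult_in_closure\<close>, but it has lost rank.\<close>
lemma boundary_core_near:
  assumes C: "C \<in> Mc" and U: "orthonormal_factors U"
  obtains C0 where "C0 \<in> closure Mc - Mc"
    "dist C C0 = smallest_singular_value \<mu> (tucker p C U)"
proof -
  define s where "s = smallest_singular_value \<mu> (tucker p C U)"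
  note sv = smallest_singular_value_tucker[OF U Mc_nondegenerate[OF C], of \<mu>, folded s_def]
  obtain x where x1: "(\<Sum>m<r \<mu>. (x m)\<^sup>2) = 1"
    and xs: "(norm (\<Sum>m<r \<mu>. x m *\<^sub>R slice \<mu> C U m))\<^sup>2 = s\<^sup>2" using sv(3) by blast
  define T where "T \<nu> i k = of_bool (i = k) - (if \<nu> = \<mu> then x i * x k else 0)" for \<nu> i k
  define C0 where "C0 = core_mult p C T"
  have "\<not> invertible_square (r \<mu>) (T \<mu>)"
  proof
    assume inv: "invertible_square (r \<mu>) (T \<mu>)"
    have "(\<Sum>i<r \<mu>. x i * T \<mu> i k) = 0" if "k < r \<mu>" for k
    proof -
      have "(\<Sum>i<r \<mu>. x i * T \<mu> i k) = (\<Sum>i<r \<mu>. x i * of_bool (i = k)) - (\<Sum>i<r \<mu>. (x i)\<^sup>2) * x k"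
        by (simp add: T_def right_diff_distrib sum_subtractf sum_distrib_right power2_eq_square mult.assoc)
      then show ?thesis using that by (simp add: x1)
    qed
    then have "x i = 0" if "i < r \<mu>" for i
      using inv that unfolding invertible_square_iff_left_inj by blast
    then have "(\<Sum>m<r \<mu>. (x m)\<^sup>2) = 0" by simp
    then show False using x1 by simp
  qed
  then have "C0 \<notin> Mc"
    using Mc_nondegenerate nondegenerate_core_mult_imp_invertible unfolding C0_def by blast
  moreover have "C0 \<in> closure Mc" unfolding C0_def by (rule core_mult_in_closure[OF C])
  moreover have "dist C C0 = s"
  proof -
    define y where "y j = (\<Sum>m<r \<mu>. x m * entry p C (j(\<mu> := m)))" for j
    have "entry p (C - C0) (j(\<mu> := m)) = x m * y j" if "j \<in> Idx0 r \<mu>" "m < r \<mu>" for j m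
    proof -
      have "entry p C0 (j(\<mu> := m)) = (\<Sum>k<r \<mu>. T \<mu> m k * entry p C (j(\<mu> := k)))"
        unfolding C0_def using that by (intro entry_core_mult_mode) (auto simp: T_def)
      also have "\<dots> = entry p C (j(\<mu> := m)) - x m * y j"
        using that(2) by (simp add: T_def y_def left_diff_distrib sum_subtractf sum_distrib_left mult.assoc)
      finally show ?thesis by (simp add: entry_linear)
    qed
    then have "(norm (C - C0))\<^sup>2 = (\<Sum>j\<in>Idx0 r \<mu>. \<Sum>m<r \<mu>. (x m * y j)\<^sup>2)"
      unfolding norm_core sum_Idx_fibers[of r \<mu>, OF r_pos] by simp
    also have "\<dots> = (\<Sum>j\<in>Idx0 r \<mu>. (y j)\<^sup>2)"
      by (simp add: power_mult_distrib x1 flip: sum_distrib_right)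
    also have "\<dots> = s\<^sup>2" using xs norm_slice_combination[OF U, where \<mu> = \<mu> and x = x and C = C] by (simp add: y_def)
    finally have "(dist C C0)\<^sup>2 = s\<^sup>2" by (simp add: dist_norm)
    then show ?thesis by (rule power2_eq_imp_eq) (use sv(1) in auto)
  qed
  ultimately show thesis using that by (simp add: s_def)
qed

text \<open>Were the tensor in the manifold, then \<open>factors_change_of_basis\<close> would move its core back into \<open>Mc\<close>.\<close>
lemma tucker_boundary:
  assumes U: "orthonormal_factors U" and C0: "C0 \<in> closure Mc - Mc"
  shows "tucker p C0 U \<in> weak_closure M - M"
proof
  have "tucker p C0 U \<in> closure M" unfolding closure_approachable
  proof (intro allI impI)
    fix e :: real assume "0 < e"
    then obtain C where C: "C \<in> Mc" "dist C C0 < e" using C0 closure_approachable by blast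
    have "dist (tucker p C U) (tucker p C0 U) = dist C C0"
      by (simp add: dist_norm norm_tucker[OF U] flip: tucker_diff)
    then show "\<exists>y\<in>M. dist y (tucker p C0 U) < e"
      using MI[OF C(1) orthonormal_imp_regular[OF U]] C(2)
      by (intro bexI[of _ "tucker p C U"]) simp_all
  qed
  then show "tucker p C0 U \<in> weak_closure M" using closure_subset_weak_closure by blast
  show "tucker p C0 U \<notin> M"
  proof
    assume "tucker p C0 U \<in> M"
    then obtain D V where D: "D \<in> Mc" and V: "regular_factors r V" and X: "tucker p C0 U = tucker p D V"
      by (rule ME)
    note cb = factors_change_of_basis[OF U Mc_nondegenerate[OF D] V X]
    have "C0 \<in> Mc" using cb(3) Mc_core_mult[OF D cb(2)] by simp
    then show False using C0 by blast
  qed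
qed

text \<open>Multiplication by \<open>(U \<mu>)\<^sup>T\<close> in every mode.\<close>
definition compress :: "('d \<Rightarrow> nat \<Rightarrow> nat ell2) \<Rightarrow> ('d \<Rightarrow> nat) ell2 \<Rightarrow> real ^ 'n" where
  "compress U w = (\<chi> k. inner w (elementary_tensor (\<lambda>\<mu>. U \<mu> (p k \<mu>))))"

lemma entry_compress:
  "i \<in> Idx r \<Longrightarrow> entry p (compress U w) i = inner w (elementary_tensor (\<lambda>\<mu>. U \<mu> (i \<mu>)))"
  using entry_tabulate[of i "\<lambda>i. inner w (elementary_tensor (\<lambda>\<mu>. U \<mu> (i \<mu>)))"] by (simp add: compress_def)

lemma compress_tucker:
  "compress U (tucker p D V) = core_mult p D (\<lambda>\<mu> l k. inner (U \<mu> l) (V \<mu> k))"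
  by (rule core_eqI) (simp add: entry_compress entry_core_mult inner_tucker_elementary inner_commute)

lemma norm_compress_le:
  assumes "orthonormal_factors U"
  shows "norm (compress U w) \<le> norm w"
proof -
  have "(norm (compress U w))\<^sup>2 = (\<Sum>i\<in>Idx r. (inner w (elementary_tensor (\<lambda>\<mu>. U \<mu> (i \<mu>))))\<^sup>2)"
    by (simp add: norm_core entry_compress)
  also have "\<dots> \<le> (norm w)\<^sup>2"
    using assms by (intro bessel elementary_tensor_orthonormal) auto
  finally show ?thesis by (rule power2_le_imp_le) simp
qed

lemma compress_diff: "compress U (v - w) = compress U v - compress U w"
  by (simp add: compress_def Finite_Cartesian_Product.vec_eq_iff inner_diff_left)

lemma compress_orthonormal: "orthonormal_factors U \<Longrightarrow> compress U (tucker p C U) = C"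
  by (rule core_eqI) (simp add: entry_compress inner_tucker_orthonormal)

text \<open>The smallest singular value is the distance by which a core may move before a row combination can
  vanish.\<close>
lemma nondegenerate_near:
  assumes U: "orthonormal_factors U" and C: "nondegenerate C"
    and near: "\<And>\<mu>. dist C D < smallest_singular_value \<mu> (tucker p C U)"
  shows "nondegenerate D"
  unfolding nondegenerate_def
proof (intro allI impI)
  fix \<mu> x m
  assume x: "\<forall>j\<in>Idx0 r \<mu>. (\<Sum>m<r \<mu>. x m * entry p D (j(\<mu> := m))) = 0" and m: "m < r \<mu>"
  define s where "s = smallest_singular_value \<mu> (tucker p C U)"
  note sv = smallest_singular_value_tucker[OF U C, of \<mu>, folded s_def]
  have "s\<^sup>2 * (\<Sum>m<r \<mu>. (x m)\<^sup>2) \<le> (\<Sum>j\<in>Idx0 r \<mu>. (\<Sum>m<r \<mu>. x m * entry p C (j(\<mu> := m)))\<^sup>2)"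
    using sv(2)[of x] by (simp add: norm_slice_combination[OF U])
  also have "\<dots> = (\<Sum>j\<in>Idx0 r \<mu>. (\<Sum>m<r \<mu>. x m * entry p (C - D) (j(\<mu> := m)))\<^sup>2)"
    using x by (simp add: entry_linear right_diff_distrib sum_subtractf)
  also have "\<dots> \<le> (\<Sum>j\<in>Idx0 r \<mu>. (\<Sum>m<r \<mu>. (x m)\<^sup>2) * (\<Sum>m<r \<mu>. (entry p (C - D) (j(\<mu> := m)))\<^sup>2))"
    by (intro sum_mono Cauchy_Schwarz_ineq_sum)
  also have "\<dots> = (\<Sum>m<r \<mu>. (x m)\<^sup>2) * (norm (C - D))\<^sup>2"
    unfolding norm_core sum_Idx_fibers[of r \<mu>, OF r_pos] by (simp add: sum_distrib_left)
  finally have le: "s\<^sup>2 * (\<Sum>m<r \<mu>. (x m)\<^sup>2) \<le> (dist C D)\<^sup>2 * (\<Sum>m<r \<mu>. (x m)\<^sup>2)"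
    by (simp add: dist_norm mult.commute)
  have "(dist C D)\<^sup>2 < s\<^sup>2" using near[of \<mu>] by (intro power_strict_mono) (auto simp: s_def)
  then have "(\<Sum>m<r \<mu>. (x m)\<^sup>2) = 0"
    using le sum_nonneg[of "{..<r \<mu>}" "\<lambda>m. (x m)\<^sup>2"]
    by (cases "(\<Sum>m<r \<mu>. (x m)\<^sup>2) > 0") auto
  then show "x m = 0" using m by (simp add: sum_nonneg_eq_0_iff)
qed

text \<open>Nondegeneracy of the compression forces \<open>B = U\<^sup>T V\<close> to be invertible. Then \<open>F = V B\<^sup>-\<^sup>1\<close> satisfies
  \<open>U\<^sup>T F = I\<close>, a normalization that determines \<open>F\<close> and thus makes it continuous in the tensor.\<close>
lemma normalized_representation:
  assumes w: "w \<in> M" and nd: "nondegenerate (compress U w)"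
  shows "compress U w \<in> Mc"
    and "\<exists>F. w = tucker p (compress U w) F \<and>
      (\<forall>\<mu> m l. m < r \<mu> \<longrightarrow> l < r \<mu> \<longrightarrow> inner (F \<mu> m) (U \<mu> l) = of_bool (m = l))"
proof -
  obtain D V where D: "D \<in> Mc" and V: "regular_factors r V" and w: "w = tucker p D V"
    using w by (rule ME)
  define B where "B \<mu> l k = inner (U \<mu> l) (V \<mu> k)" for \<mu> l k
  have cw: "compress U w = core_mult p D B" by (simp add: w compress_tucker B_def[abs_def])
  have inv: "invertible_square (r \<mu>) (B \<mu>)" for \<mu>
    using nondegenerate_core_mult_imp_invertible nd cw by simp
  then show "compress U w \<in> Mc" using cw Mc_core_mult[OF D inv] by simp
  have "\<forall>\<mu>. \<exists>H. \<forall>i<r \<mu>. \<forall>j<r \<mu>. (\<Sum>k<r \<mu>. B \<mu> i k * H k j) = of_bool (i = j) \<and>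
      (\<Sum>k<r \<mu>. H i k * B \<mu> k j) = of_bool (i = j)"
    using inv unfolding invertible_square_def by blast
  from choice[OF this] obtain H where H: "\<And>\<mu> i j. i < r \<mu> \<Longrightarrow> j < r \<mu> \<Longrightarrow> (\<Sum>k<r \<mu>. B \<mu> i k * H \<mu> k j) = of_bool (i = j)"
    "\<And>\<mu> i j. i < r \<mu> \<Longrightarrow> j < r \<mu> \<Longrightarrow> (\<Sum>k<r \<mu>. H \<mu> i k * B \<mu> k j) = of_bool (i = j)" by blast
  define F where "F \<mu> m = (\<Sum>k<r \<mu>. H \<mu> k m *\<^sub>R V \<mu> k)" for \<mu> m
  have VF: "V \<mu> k = (\<Sum>l<r \<mu>. B \<mu> l k *\<^sub>R F \<mu> l)" if k: "k < r \<mu>" for \<mu> k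
  proof -
    have "(\<Sum>l<r \<mu>. B \<mu> l k *\<^sub>R F \<mu> l) = (\<Sum>i<r \<mu>. (\<Sum>l<r \<mu>. H \<mu> i l * B \<mu> l k) *\<^sub>R V \<mu> i)"
      unfolding F_def scaleR_sum_right scaleR_sum_left by (subst sum.swap) (simp add: mult.commute)
    also have "\<dots> = (\<Sum>i<r \<mu>. of_bool (i = k) *\<^sub>R V \<mu> i)" using k by (intro sum.cong) (auto simp: H)
    also have "\<dots> = V \<mu> k" using k by (simp add: sum_of_bool_scaleR)
    finally show ?thesis by simp
  qed
  have "w = tucker p (compress U w) F" unfolding cw unfolding w by (rule tucker_core_mult) (rule VF)
  moreover have "inner (F \<mu> m) (U \<mu> l) = of_bool (m = l)" if "m < r \<mu>" "l < r \<mu>" for \<mu> m l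
  proof -
    have "inner (F \<mu> m) (U \<mu> l) = (\<Sum>k<r \<mu>. B \<mu> l k * H \<mu> k m)"
      by (simp add: F_def inner_sum_left inner_sum_right B_def inner_commute mult.commute)
    then show ?thesis using that by (simp add: H eq_commute)
  qed
  ultimately show "\<exists>F. w = tucker p (compress U w) F \<and>
      (\<forall>\<mu> m l. m < r \<mu> \<longrightarrow> l < r \<mu> \<longrightarrow> inner (F \<mu> m) (U \<mu> l) = of_bool (m = l))" by blast
qed

text \<open>For \<open>w = compress U w \<times> E\<close> with \<open>U\<^sup>T E = I\<close>, contracting \<open>w\<close> with \<open>U\<close> in all modes but \<open>\<mu>\<close> gives the
  product of \<open>E \<mu>\<close> with the \<open>\<mu>\<close>-th matricization of the compressed core. So \<open>E \<mu>\<close> solves a linear system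
  whose matrix is the Gram matrix of the rows of that matricization. Its coefficients and its right-hand side
  are weakly continuous in \<open>w\<close>, and it stays regular at \<open>Z\<close>. Hence the entries of the factors converge, and so
  does the identity \<open>w = compress U w \<times> E\<close> in every entry.\<close>
lemma weak_limit_tucker:
  assumes U: "orthonormal_factors U" and F: "F \<noteq> bot"
    and lim: "\<And>g. ((\<lambda>w. inner w g) \<longlongrightarrow> inner Z g) F"
    and ev: "eventually (\<lambda>w. w \<in> M \<and> nondegenerate (compress U w)) F"
    and nd: "nondegenerate (compress U Z)"
  obtains E where "Z = tucker p (compress U Z) E"
proof -
  define t where "t w = entry p (compress U w)" for w
  have t_lim: "((\<lambda>w. t w i) \<longlongrightarrow> t Z i) F" if "i \<in> Idx r" for i
    unfolding t_def using lim that by (simp add: entry_compress)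
  \<comment> \<open>matrix and right-hand side of the normal equations for the factor in mode \<open>\<mu>\<close>\<close>
  define G where "G w \<mu> m k = (\<Sum>j\<in>Idx0 r \<mu>. t w (j(\<mu> := m)) * t w (j(\<mu> := k)))" for w \<mu> m k
  have G_lim: "((\<lambda>w. G w \<mu> m k) \<longlongrightarrow> G Z \<mu> m k) F" if "m < r \<mu>" "k < r \<mu>" for \<mu> m k
    unfolding G_def using that by (intro tendsto_sum tendsto_mult t_lim Idx0_updI)
  define fib where "fib w \<mu> j a = inner w (elementary_tensor ((\<lambda>\<nu>. U \<nu> (j \<nu>))(\<mu> := unit_seq a)))"
    for w \<mu> j a
  define \<rho> where "\<rho> w \<mu> m a = (\<Sum>j\<in>Idx0 r \<mu>. t w (j(\<mu> := m)) * fib w \<mu> j a)" for w \<mu> m a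
  have \<rho>_lim: "((\<lambda>w. \<rho> w \<mu> m a) \<longlongrightarrow> \<rho> Z \<mu> m a) F" if "m < r \<mu>" for \<mu> m a
    unfolding \<rho>_def fib_def using that by (intro tendsto_sum tendsto_mult t_lim lim Idx0_updI)
  have G_inv: "invertible_square (r \<mu>) (G Z \<mu>)" for \<mu>
    unfolding invertible_square_iff_inj
  proof (intro allI impI)
    fix x k assume x: "\<forall>m<r \<mu>. (\<Sum>k<r \<mu>. G Z \<mu> m k * x k) = 0" and k: "k < r \<mu>"
    define y where "y j = (\<Sum>k<r \<mu>. x k * t Z (j(\<mu> := k)))" for j
    have "(\<Sum>k<r \<mu>. G Z \<mu> m k * x k) = (\<Sum>j\<in>Idx0 r \<mu>. t Z (j(\<mu> := m)) * y j)" for m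
      unfolding G_def y_def sum_distrib_right sum_distrib_left
      by (subst sum.swap) (simp add: mult_ac)
    then have "0 = (\<Sum>m<r \<mu>. x m * (\<Sum>j\<in>Idx0 r \<mu>. t Z (j(\<mu> := m)) * y j))" using x by simp
    also have "\<dots> = (\<Sum>j\<in>Idx0 r \<mu>. (y j)\<^sup>2)"
      unfolding sum_distrib_left
      by (subst sum.swap) (simp add: y_def power2_eq_square sum_distrib_right sum_distrib_left mult_ac)
    finally have "y j = 0" if "j \<in> Idx0 r \<mu>" for j
      using that by (simp add: sum_nonneg_eq_0_iff eq_commute[of 0])
    then show "x k = 0"
      using nondegenerateD[OF nd, of \<mu> x k] k by (simp add: y_def t_def)
  qed
  \<comment> \<open>a choice of normalized factors for every \<open>w\<close> in the manifold with nondegenerate compression\<close>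
  define Fc where "Fc w = (SOME F. w = tucker p (compress U w) F \<and>
      (\<forall>\<mu> m l. m < r \<mu> \<longrightarrow> l < r \<mu> \<longrightarrow> inner (F \<mu> m) (U \<mu> l) = of_bool (m = l)))" for w
  have Fc: "w = tucker p (compress U w) (Fc w)"
      "m < r \<mu> \<Longrightarrow> l < r \<mu> \<Longrightarrow> inner (Fc w \<mu> m) (U \<mu> l) = of_bool (m = l)"
    if "w \<in> M" "nondegenerate (compress U w)" for w \<mu> m l
    using someI_ex[OF normalized_representation(2)[OF that]] unfolding Fc_def[symmetric] by blast+
  have G_sol: "(\<Sum>k<r \<mu>. G w \<mu> m k * ell2_nth (Fc w \<mu> k) a) = \<rho> w \<mu> m a"
    if w: "w \<in> M" "nondegenerate (compress U w)" for w \<mu> m a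
  proof -
    have "fib w \<mu> j a = (\<Sum>k<r \<mu>. t w (j(\<mu> := k)) * ell2_nth (Fc w \<mu> k) a)" if j: "j \<in> Idx0 r \<mu>" for j
    proof -
      have "inner (tucker p (compress U w) (Fc w)) (elementary_tensor ((\<lambda>\<nu>. U \<nu> (j \<nu>))(\<mu> := unit_seq a)))
          = (\<Sum>k<r \<mu>. entry p (compress U w) (j(\<mu> := k)) * inner (Fc w \<mu> k) (unit_seq a))"
        using j inner_tucker_fiber[OF j, of "Fc w" "(\<lambda>\<nu>. U \<nu> (j \<nu>))(\<mu> := unit_seq a)"]
        by (simp add: Fc(2)[OF w] Idx0_def Idx_def)
      then show ?thesis by (simp add: fib_def t_def inner_unit_seq flip: Fc(1)[OF w])
    qed
    then have "\<rho> w \<mu> m a = (\<Sum>j\<in>Idx0 r \<mu>. \<Sum>k<r \<mu>.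
        t w (j(\<mu> := m)) * t w (j(\<mu> := k)) * ell2_nth (Fc w \<mu> k) a)"
      by (simp add: \<rho>_def sum_distrib_left mult.assoc)
    also have "\<dots> = (\<Sum>k<r \<mu>. G w \<mu> m k * ell2_nth (Fc w \<mu> k) a)"
      by (subst sum.swap) (simp add: G_def sum_distrib_right)
    finally show ?thesis by simp
  qed
  have "\<exists>y. \<forall>a. ell2_nth y a = fib Z \<mu> j a" if "j \<in> Idx0 r \<mu>" for \<mu> j
  proof -
    have "inner (U \<nu> (j \<nu>)) (U \<nu> (j \<nu>)) = 1" for \<nu>
      using U that by (simp add: ons_def Idx0_def Idx_def)
    then show ?thesis unfolding fib_def
      using fiber_exists[of "\<lambda>\<nu>. U \<nu> (j \<nu>)" Z \<mu>] by blast
  qed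
  note fib_ex = this
  define y where "y \<mu> j = (SOME y. \<forall>a. ell2_nth y a = fib Z \<mu> j a)" for \<mu> j
  have y: "ell2_nth (y \<mu> j) a = fib Z \<mu> j a" if "j \<in> Idx0 r \<mu>" for \<mu> j a
    unfolding y_def using someI_ex[OF fib_ex[OF that]] by blast
  have "\<forall>\<mu>. \<exists>H. \<forall>i<r \<mu>. \<forall>j<r \<mu>. (\<Sum>k<r \<mu>. G Z \<mu> i k * H k j) = of_bool (i = j)"
    using G_inv unfolding invertible_square_def by blast
  from choice[OF this] obtain H where H: "\<And>\<mu> i j. i < r \<mu> \<Longrightarrow> j < r \<mu> \<Longrightarrow>
      (\<Sum>k<r \<mu>. G Z \<mu> i k * H \<mu> k j) = of_bool (i = j)" by blast
  define E where "E \<mu> k = (\<Sum>i<r \<mu>. H \<mu> k i *\<^sub>R (\<Sum>j\<in>Idx0 r \<mu>. t Z (j(\<mu> := i)) *\<^sub>R y \<mu> j))" for \<mu> k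
  have E_nth: "ell2_nth (E \<mu> k) a = (\<Sum>i<r \<mu>. H \<mu> k i * \<rho> Z \<mu> i a)" for \<mu> k a
    by (simp add: E_def ell2_nth_sum ell2_nth_scaleR \<rho>_def y)
  have E_sol: "(\<Sum>k<r \<mu>. G Z \<mu> m k * ell2_nth (E \<mu> k) a) = \<rho> Z \<mu> m a" if m: "m < r \<mu>" for \<mu> m a
  proof -
    have "(\<Sum>k<r \<mu>. G Z \<mu> m k * ell2_nth (E \<mu> k) a)
        = (\<Sum>i<r \<mu>. (\<Sum>k<r \<mu>. G Z \<mu> m k * H \<mu> k i) * \<rho> Z \<mu> i a)"
      unfolding E_nth sum_distrib_left sum_distrib_right by (subst sum.swap) (simp add: mult.assoc)
    also have "\<dots> = (\<Sum>i<r \<mu>. of_bool (m = i) * \<rho> Z \<mu> i a)"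
      using m by (intro sum.cong) (auto simp: H)
    finally show ?thesis using m by simp
  qed
  have E_lim: "((\<lambda>w. ell2_nth (Fc w \<mu> k) a) \<longlongrightarrow> ell2_nth (E \<mu> k) a) F" if k: "k < r \<mu>" for \<mu> k a
  proof (rule tendsto_linear_solution[where A = "\<lambda>w. G w \<mu>" and y = "\<lambda>w m. \<rho> w \<mu> m a" and n = "r \<mu>"
        and x = "\<lambda>w k. ell2_nth (Fc w \<mu> k) a" and ?x0.0 = "\<lambda>k. ell2_nth (E \<mu> k) a"
        and ?y0.0 = "\<lambda>m. \<rho> Z \<mu> m a" and ?A0.0 = "G Z \<mu>"])
    show "eventually (\<lambda>w. \<forall>m<r \<mu>. (\<Sum>k<r \<mu>. G w \<mu> m k * ell2_nth (Fc w \<mu> k) a) = \<rho> w \<mu> m a) F"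
      using ev by eventually_elim (simp add: G_sol)
  qed (use G_lim G_inv \<rho>_lim E_sol k in auto)
  have "Z = tucker p (compress U Z) E"
  proof (rule ell2_eqI)
    fix i
    have tn: "ell2_nth (tucker p (compress U w) V) i
        = (\<Sum>k\<in>Idx r. t w k * (\<Prod>\<mu>\<in>UNIV. ell2_nth (V \<mu> (k \<mu>)) (i \<mu>)))" for w V
      by (simp add: tucker_Idx t_def ell2_nth_sum ell2_nth_scaleR elementary_tensor_nth)
    have "((\<lambda>w. ell2_nth (tucker p (compress U w) (Fc w)) i)
        \<longlongrightarrow> ell2_nth (tucker p (compress U Z) E) i) F"
      unfolding tn by (intro tendsto_sum tendsto_mult tendsto_prod t_lim E_lim) (auto simp: Idx_def)
    moreover have "eventually (\<lambda>w. ell2_nth (tucker p (compress U w) (Fc w)) i = ell2_nth w i) F"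
      using ev by eventually_elim (simp flip: Fc(1))
    ultimately have "((\<lambda>w. ell2_nth w i) \<longlongrightarrow> ell2_nth (tucker p (compress U Z) E) i) F"
      by (rule Lim_transform_eventually)
    moreover have "((\<lambda>w. ell2_nth w i) \<longlongrightarrow> ell2_nth Z i) F"
      unfolding ell2_nth_eq_inner by (rule lim)
    ultimately show "ell2_nth Z i = ell2_nth (tucker p (compress U Z) E) i"
      using F tendsto_unique by blast
  qed
  then show thesis by (rule that)
qed

text \<open>The radius is taken so small that cores within it are nondegenerate and, if they belong to
  \<open>closure Mc\<close>, lie in \<open>Mc\<close>. Compression does not increase distances, so it carries a point \<open>Z\<close> close to
  \<open>C \<times> U\<close> to such a core, and \<open>weak_limit_tucker\<close> recovers \<open>Z\<close> from it.\<close>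
lemma weak_closure_near:
  assumes C: "C \<in> Mc" and U: "orthonormal_factors U"
  obtains d where "d > 0"
    "\<And>Z. Z \<in> weak_closure M \<Longrightarrow> dist (tucker p C U) Z < d \<Longrightarrow> Z \<in> M"
proof -
  obtain e where e: "e > 0" "ball C e \<inter> closure Mc \<subseteq> Mc"
    using submanifold_locally_closed[OF smooth_Mc C] by blast
  define s where "s \<mu> = smallest_singular_value \<mu> (tucker p C U)" for \<mu>
  define d where "d = Min (insert e (range s))"
  have d: "d > 0" unfolding d_def s_def
    using e smallest_singular_value_tucker(1)[OF U Mc_nondegenerate[OF C]] by (subst Min_gr_iff) auto
  have de: "d \<le> e" and ds: "d \<le> s \<mu>" for \<mu> unfolding d_def by (rule Min_le, simp, simp)+
  have nd: "nondegenerate D" if "dist C D < d" for D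
    using nondegenerate_near[OF U Mc_nondegenerate[OF C]] ds that unfolding s_def
    by (meson less_le_trans)
  have "Z \<in> M" if Z: "Z \<in> weak_closure M" "dist (tucker p C U) Z < d" for Z
  proof -
    obtain F where F: "F \<noteq> bot" "eventually (\<lambda>w. w \<in> M) F" and
      lim: "\<And>g. ((\<lambda>w. inner w g) \<longlongrightarrow> inner Z g) F"
      using weak_closure_filter[OF Z(1)] by blast
    have "dist C (compress U Z) \<le> dist (tucker p C U) Z"
      using norm_compress_le[OF U, of "tucker p C U - Z"]
      by (simp add: compress_diff compress_orthonormal[OF U] dist_norm)
    then have TZ: "dist C (compress U Z) < d" using Z(2) by simp
    have T_lim: "((\<lambda>w. compress U w) \<longlongrightarrow> compress U Z) F"
      unfolding compress_def by (intro tendsto_vec_lambda lim)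
    have "eventually (\<lambda>w. compress U w \<in> ball C d) F"
      using topological_tendstoD[OF T_lim open_ball, of C d] TZ by simp
    with F(2) have ev: "eventually (\<lambda>w. w \<in> M \<and> nondegenerate (compress U w)) F"
      by eventually_elim (simp add: nd)
    then have "eventually (\<lambda>w. compress U w \<in> closure Mc) F"
      by eventually_elim (use normalized_representation(1) closure_subset in blast)
    then have "compress U Z \<in> closure Mc"
      using Lim_in_closed_set[OF closed_closure _ F(1) T_lim] by blast
    then have Mc: "compress U Z \<in> Mc" using e(2) TZ de by auto
    obtain E where E: "Z = tucker p (compress U Z) E"
      using weak_limit_tucker[OF U F(1) lim ev nd[OF TZ]] by blast
    have "core_mult p (compress U Z) (\<lambda>\<mu> l k. inner (U \<mu> l) (E \<mu> k)) = compress U Z"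
      using compress_tucker[of U "compress U Z" E] E by simp
    then have nd': "nondegenerate (core_mult p (compress U Z) (\<lambda>\<mu> l k. inner (U \<mu> l) (E \<mu> k)))"
      using nd[OF TZ] by simp
    have "regular_factors r E"
      by (rule regular_if_invertible_pairing) (rule nondegenerate_core_mult_imp_invertible[OF nd'])
    then have "tucker p (compress U Z) E \<in> M" by (rule MI[OF Mc])
    then show "Z \<in> M" using E by simp
  qed
  then show thesis using that d by blast
qed

text \<open>The three distances that occur in the estimate. Boundary points exist by \<open>boundary_core_near\<close>, which
  matters because \<open>infdist\<close> to the empty set is \<open>0\<close>.\<close>
lemma distance_to_boundary:
  assumes C: "C \<in> Mc" and U: "orthonormal_factors U"
  defines "\<sigma> \<equiv> infdist (tucker p C U) (weak_closure M - M)"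
  shows "\<sigma> > 0" and "\<sigma> \<le> infdist C (closure Mc - Mc)"
    and "\<And>\<mu>. infdist C (closure Mc - Mc) \<le> smallest_singular_value \<mu> (tucker p C U)"
proof -
  obtain C0 where C0: "C0 \<in> closure Mc - Mc" using boundary_core_near[OF C U] by blast
  have ne: "weak_closure M - M \<noteq> {}" using tucker_boundary[OF U C0] by blast
  obtain d where d: "d > 0" "\<And>Z. Z \<in> weak_closure M \<Longrightarrow> dist (tucker p C U) Z < d \<Longrightarrow> Z \<in> M"
    using weak_closure_near[OF C U] by blast
  have "d \<le> dist (tucker p C U) Z" if "Z \<in> weak_closure M - M" for Z
    using d(2)[of Z] that by force
  then have "d \<le> \<sigma>" unfolding \<sigma>_def infdist_notempty[OF ne] using ne by (intro cINF_greatest)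
  then show "\<sigma> > 0" using d by simp
  have "\<sigma> \<le> dist C C1" if "C1 \<in> closure Mc - Mc" for C1
  proof -
    have "\<sigma> \<le> dist (tucker p C U) (tucker p C1 U)"
      unfolding \<sigma>_def by (rule infdist_le[OF tucker_boundary[OF U that]])
    also have "\<dots> = dist C C1" by (simp add: dist_norm norm_tucker[OF U] flip: tucker_diff)
    finally show ?thesis .
  qed
  then show "\<sigma> \<le> infdist C (closure Mc - Mc)"
    using C0 by (subst infdist_notempty) (auto intro!: cINF_greatest)
  fix \<mu>
  obtain C1 where "C1 \<in> closure Mc - Mc" "dist C C1 = smallest_singular_value \<mu> (tucker p C U)"
    using boundary_core_near[OF C U] by blast
  then show "infdist C (closure Mc - Mc) \<le> smallest_singular_value \<mu> (tucker p C U)"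
    using infdist_le by metis
qed

end

section \<open>Tangent vectors and the projection onto the tangent space\<close>

context core_manifold_setting
begin

lemma slice_indep:
  assumes "orthonormal_factors U" "nondegenerate C"
    "(\<Sum>m<r \<mu>. x m *\<^sub>R slice \<mu> C U m) = 0" "m < r \<mu>"
  shows "x m = 0"
proof -
  define s where "s = smallest_singular_value \<mu> (tucker p C U)"
  note sv = smallest_singular_value_tucker[OF assms(1,2), of \<mu>, folded s_def]
  have "s\<^sup>2 * (\<Sum>m<r \<mu>. (x m)\<^sup>2) \<le> 0" using sv(2)[of x] assms(3) by simp
  then have "(\<Sum>m<r \<mu>. (x m)\<^sup>2) \<le> 0" using sv(1) by (simp add: mult_le_0_iff)
  then have "(\<Sum>m<r \<mu>. (x m)\<^sup>2) = 0" by (meson antisym sum_nonneg zero_le_power2)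
  then show ?thesis using assms(4) by (simp add: sum_nonneg_eq_0_iff)
qed

lemma slice_upd: "slice \<mu> C (U(\<mu> := w)) m = slice \<mu> C U m"
proof -
  have "(\<lambda>\<nu>. (U(\<mu> := w)) \<nu> (j \<nu>))(\<mu> := unit_seq 0) = (\<lambda>\<nu>. U \<nu> (j \<nu>))(\<mu> := unit_seq 0)" for j :: "'d \<Rightarrow> nat"
    by (auto simp: fun_eq_iff)
  then show ?thesis by (simp add: slice_def)
qed

text \<open>Another representation \<open>D \<times> V\<close> of the same tensor differs by invertible matrices \<open>B\<close>. Multiplication
  by \<open>B\<close> maps tangent vectors of \<open>Mc\<close> at \<open>D\<close> to tangent vectors at \<open>C\<close>, and variations \<open>V'\<close> of the factors
  correspond to \<open>W = V' B\<^sup>-\<^sup>1\<close>.\<close>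
lemma tangent_vector_representation:
  assumes C: "C \<in> Mc" and U: "orthonormal_factors U"
    and s: "s \<in> tensor_tangent_space r p Mc (tucker p C U)"
  obtains C' W where "C' \<in> tangent_space Mc C"
    "\<And>\<mu> k l. k < r \<mu> \<Longrightarrow> l < r \<mu> \<Longrightarrow> inner (U \<mu> k) (W \<mu> l) = 0"
    "s = tucker p C' U + (\<Sum>\<mu>\<in>UNIV. tucker p C (U(\<mu> := W \<mu>)))"
proof -
  obtain D V D' V' where D: "D \<in> Mc" and V: "regular_factors r V"
    and eq: "tucker p C U = tucker p D V" and D': "D' \<in> tangent_space Mc D"
    and V': "\<And>\<mu> k l. k < r \<mu> \<Longrightarrow> l < r \<mu> \<Longrightarrow> inner (V \<mu> k) (V' \<mu> l) = 0"
    and s: "s = tucker p D' V + (\<Sum>\<mu>\<in>UNIV. tucker p D (V(\<mu> := V' \<mu>)))"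
    using s unfolding tensor_tangent_space_def by blast
  define B where "B = (\<lambda>\<mu> l k. inner (U \<mu> l) (V \<mu> k))"
  note cb = factors_change_of_basis[OF U Mc_nondegenerate[OF D] V eq]
  have VB: "V \<mu> k = (\<Sum>l<r \<mu>. B \<mu> l k *\<^sub>R U \<mu> l)" if "k < r \<mu>" for \<mu> k
    unfolding B_def by (rule cb(1)[OF that])
  have inv: "invertible_square (r \<mu>) (B \<mu>)" for \<mu> unfolding B_def by (rule cb(2))
  have CB: "C = core_mult p D B" unfolding B_def by (rule cb(3))
  have "\<forall>\<mu>. \<exists>H. \<forall>i<r \<mu>. \<forall>j<r \<mu>. (\<Sum>k<r \<mu>. B \<mu> i k * H k j) = of_bool (i = j) \<and>
      (\<Sum>k<r \<mu>. H i k * B \<mu> k j) = of_bool (i = j)"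
    using inv unfolding invertible_square_def by blast
  from choice[OF this] obtain H where
    H: "\<And>\<mu> i j. i < r \<mu> \<Longrightarrow> j < r \<mu> \<Longrightarrow> (\<Sum>k<r \<mu>. B \<mu> i k * H \<mu> k j) = of_bool (i = j)"
    "\<And>\<mu> i j. i < r \<mu> \<Longrightarrow> j < r \<mu> \<Longrightarrow> (\<Sum>k<r \<mu>. H \<mu> i k * B \<mu> k j) = of_bool (i = j)" by blast
  define W where "W \<mu> l = (\<Sum>k<r \<mu>. H \<mu> k l *\<^sub>R V' \<mu> k)" for \<mu> l
  have V'W: "V' \<mu> k = (\<Sum>l<r \<mu>. B \<mu> l k *\<^sub>R W \<mu> l)" if "k < r \<mu>" for \<mu> k
    unfolding W_def using combination_inverse[of "r \<mu>" "H \<mu>" "B \<mu>" k "V' \<mu>"] H(2) that by simp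
  have UV: "U \<mu> l = (\<Sum>k<r \<mu>. H \<mu> k l *\<^sub>R V \<mu> k)" if "l < r \<mu>" for \<mu> l
    using combination_inverse[of "r \<mu>" "B \<mu>" "H \<mu>" l "U \<mu>"] H(1) that by (simp add: VB)
  have UV': "inner (U \<mu> k) (V' \<mu> l) = 0" if "k < r \<mu>" "l < r \<mu>" for \<mu> k l
    using that by (simp add: UV inner_sum_left V')
  show thesis
  proof (rule that)
    show "core_mult p D' B \<in> tangent_space Mc C"
      unfolding CB by (rule tangent_core_mult[OF D' inv])
    show "inner (U \<mu> k) (W \<mu> l) = 0" if "k < r \<mu>" "l < r \<mu>" for \<mu> k l
      using that by (simp add: W_def inner_sum_right UV')
    have "tucker p D' V = tucker p (core_mult p D' B) U" by (rule tucker_core_mult) (rule VB)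
    moreover have "tucker p D (V(\<mu> := V' \<mu>)) = tucker p C (U(\<mu> := W \<mu>))" for \<mu>
      unfolding CB by (rule tucker_core_mult) (auto simp: VB V'W)
    ultimately show "s = tucker p (core_mult p D' B) U + (\<Sum>\<mu>\<in>UNIV. tucker p C (U(\<mu> := W \<mu>)))"
      using s by simp
  qed
qed

end

section \<open>The residual in a basis adapted to two points\<close>

text \<open>The orthonormal bases \<open>b\<close> start with the columns of \<open>U\<close> and span those of \<open>V\<close>, so that \<open>X - Y\<close> becomes
  a finite array of coefficients. The numbers \<open>\<gamma>\<close> describe the orthogonal projection of the rows of \<open>Y\<close> to
  the row space of \<open>X\<close> in every matricization.\<close>
locale adapted_basis = core_manifold_setting r p Mc
  for r :: "'d::finite \<Rightarrow> nat" and p :: "'n::finite \<Rightarrow> 'd \<Rightarrow> nat" and Mc :: "(real ^ 'n) set" +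
  fixes C D :: "real ^ 'n" and U V b :: "'d \<Rightarrow> nat \<Rightarrow> nat ell2" and n :: "'d \<Rightarrow> nat"
    and \<gamma> :: "'d \<Rightarrow> nat \<Rightarrow> nat \<Rightarrow> real"
  assumes C: "C \<in> Mc" and D: "D \<in> Mc" and U: "orthonormal_factors U"
    and rn: "r \<mu> \<le> n \<mu>" and b: "ons (n \<mu>) (b \<mu>)"
    and bU: "k < r \<mu> \<Longrightarrow> b \<mu> k = U \<mu> k"
    and V: "k < r \<mu> \<Longrightarrow> V \<mu> k = (\<Sum>l<n \<mu>. inner (b \<mu> l) (V \<mu> k) *\<^sub>R b \<mu> l)"
    and \<gamma>: "k < r \<mu> \<Longrightarrow> m < r \<mu> \<Longrightarrow>
      inner (slice \<mu> D V k - (\<Sum>j<r \<mu>. \<gamma> \<mu> k j *\<^sub>R slice \<mu> C U j)) (slice \<mu> C U m) = 0"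
begin

definition "X = tucker p C U"
definition "Y = tucker p D V"
definition "basis_tensor i = elementary_tensor (\<lambda>\<mu>. b \<mu> (i \<mu>))"
definition "slice_basis \<mu> j = elementary_tensor ((\<lambda>\<nu>. b \<nu> (j \<nu>))(\<mu> := unit_seq 0))"
definition "coord \<mu> l k = inner (b \<mu> l) (V \<mu> k)"
definition "slice_residual \<mu> k = slice \<mu> D V k - (\<Sum>m<r \<mu>. \<gamma> \<mu> k m *\<^sub>R slice \<mu> C U m)"
text \<open>A row of the matricization of \<open>Y\<close>, minus its projection to the row space of \<open>X\<close>.\<close>
definition "row_residual \<mu> l = (\<Sum>k<r \<mu>. coord \<mu> l k *\<^sub>R slice_residual \<mu> k)"
text \<open>With this and the next definition, \<open>tangent_part\<close> is the projection of \<open>X - Y\<close>: its core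
  part projects the compression of \<open>X - Y\<close>. In the rows outside \<open>U \<mu>\<close> the matricization of \<open>X\<close>
  vanishes, so \<open>factor_variation\<close> carries minus the projection of the rows of \<open>Y\<close>, that is of
  \<open>\<Sum> coord \<mu> l k * slice \<mu> D V k\<close>, to the row space of \<open>X\<close>.\<close>
definition "core_variation = orth_proj (tangent_space Mc C) (C - compress U Y)"
definition "factor_variation \<mu> m = - (\<Sum>l=r \<mu>..<n \<mu>. (\<Sum>k<r \<mu>. coord \<mu> l k * \<gamma> \<mu> k m) *\<^sub>R b \<mu> l)"
definition "tangent_part = tucker p core_variation U + (\<Sum>\<mu>\<in>UNIV. tucker p C (U(\<mu> := factor_variation \<mu>)))"
definition "normal_part = (X - Y) - tangent_part"

lemma r_less_n: "k < r \<mu> \<Longrightarrow> k < n \<mu>"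
  using rn[of \<mu>] by simp

lemma n_pos: "0 < n \<mu>"
  using rn[of \<mu>] r_pos[of \<mu>] by linarith

lemma Idx_r_n: "i \<in> Idx r \<Longrightarrow> i \<in> Idx n"
  using r_less_n by (auto simp: Idx_def)

lemma basis_tensor_U: "i \<in> Idx r \<Longrightarrow> basis_tensor i = elementary_tensor (\<lambda>\<mu>. U \<mu> (i \<mu>))"
  unfolding basis_tensor_def by (rule arg_cong[where f = elementary_tensor]) (auto simp: bU Idx_def)

lemma basis_tensor_orthonormal: "i \<in> Idx n \<Longrightarrow> j \<in> Idx n \<Longrightarrow> inner (basis_tensor i) (basis_tensor j) = of_bool (i = j)"
  unfolding basis_tensor_def by (rule elementary_tensor_orthonormal) (rule b)

lemma slice_basis_eq: "slice_basis \<mu> j = elementary_tensor (\<lambda>\<nu>. (b(\<mu> := \<lambda>_. unit_seq 0)) \<nu> (j \<nu>))"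
  unfolding slice_basis_def by (rule arg_cong[where f = elementary_tensor]) auto

lemma slice_basis_upd: "elementary_tensor ((\<lambda>\<nu>. b \<nu> ((j(\<mu> := l)) \<nu>))(\<mu> := unit_seq 0)) = slice_basis \<mu> j"
  unfolding slice_basis_def by (rule arg_cong[where f = elementary_tensor]) auto

lemma Idx0_eq_Idx: "Idx0 n \<mu> = Idx (n(\<mu> := 1))"
  using n_pos by (auto simp: Idx0_def Idx_def)

lemma slice_basis_orthonormal:
  assumes "i \<in> Idx0 n \<mu>" "j \<in> Idx0 n \<mu>"
  shows "inner (slice_basis \<mu> i) (slice_basis \<mu> j) = of_bool (i = j)"
  unfolding slice_basis_eq
proof (rule elementary_tensor_orthonormal)
  show "ons ((n(\<mu> := 1)) \<nu>) ((b(\<mu> := \<lambda>_. unit_seq 0)) \<nu>)" for \<nu>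
    using b[of \<nu>] by (auto simp: ons_def inner_unit_seq unit_seq_nth)
qed (use assms in \<open>simp_all only: Idx0_eq_Idx\<close>)

lemma b_orth: "k < r \<mu> \<Longrightarrow> r \<mu> \<le> l \<Longrightarrow> l < n \<mu> \<Longrightarrow> inner (U \<mu> k) (b \<mu> l) = 0"
  using onsD[OF b, of k \<mu> l] bU[of k \<mu>] r_less_n[of k \<mu>] by simp

lemma U_expand: "k < r \<mu> \<Longrightarrow> U \<mu> k = (\<Sum>l<n \<mu>. of_bool (l = k) *\<^sub>R b \<mu> l)"
  using r_less_n[of k \<mu>] bU[of k \<mu>] by (subst sum.remove[of _ k]) auto

lemma factor_variation_expand:
  "factor_variation \<mu> m = (\<Sum>l<n \<mu>. (if r \<mu> \<le> l then - (\<Sum>k<r \<mu>. coord \<mu> l k * \<gamma> \<mu> k m) else 0) *\<^sub>R b \<mu> l)"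
proof -
  have "(\<Sum>l<n \<mu>. (if r \<mu> \<le> l then - (\<Sum>k<r \<mu>. coord \<mu> l k * \<gamma> \<mu> k m) else 0) *\<^sub>R b \<mu> l)
      = (\<Sum>l=r \<mu>..<n \<mu>. - ((\<Sum>k<r \<mu>. coord \<mu> l k * \<gamma> \<mu> k m) *\<^sub>R b \<mu> l))"
    by (rule sum.mono_neutral_cong_right) auto
  then show ?thesis by (simp add: factor_variation_def sum_negf)
qed

lemma inner_factor_variation:
  assumes "r \<mu> \<le> l" "l < n \<mu>"
  shows "inner (factor_variation \<mu> m) (b \<mu> l) = - (\<Sum>k<r \<mu>. coord \<mu> l k * \<gamma> \<mu> k m)"
proof -
  have "inner (factor_variation \<mu> m) (b \<mu> l) = (if r \<mu> \<le> l then - (\<Sum>k<r \<mu>. coord \<mu> l k * \<gamma> \<mu> k m) else 0)"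
    using assms(2) onsD[OF b] by (intro orthonormal_sum(1)[OF _ _ factor_variation_expand]) auto
  then show ?thesis using assms by simp
qed

lemma U_factor_variation: "k < r \<mu> \<Longrightarrow> inner (U \<mu> k) (factor_variation \<mu> m) = 0"
  by (simp add: factor_variation_def inner_sum_right b_orth)

lemma tucker_in_span:
  assumes "\<And>\<mu> k. k < r \<mu> \<Longrightarrow> F \<mu> k = (\<Sum>l<n \<mu>. t \<mu> l k *\<^sub>R b \<mu> l)"
  shows "tucker p K F \<in> span (basis_tensor ` Idx n)"
  unfolding tucker_Idx
proof (intro span_sum span_scale)
  fix i assume "i \<in> Idx r"
  then have "F \<mu> (i \<mu>) = (\<Sum>l<n \<mu>. t \<mu> l (i \<mu>) *\<^sub>R b \<mu> l)" for \<mu>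
    by (intro assms) (simp add: Idx_def)
  then show "elementary_tensor (\<lambda>\<mu>. F \<mu> (i \<mu>)) \<in> span (basis_tensor ` Idx n)"
    unfolding basis_tensor_def[abs_def] by (rule elementary_tensor_in_span)
qed

lemma slice_in_span:
  assumes "\<And>\<mu> k. k < r \<mu> \<Longrightarrow> F \<mu> k = (\<Sum>l<n \<mu>. t \<mu> l k *\<^sub>R b \<mu> l)"
  shows "slice \<mu> K F m \<in> span (slice_basis \<mu> ` Idx0 n \<mu>)"
  unfolding slice_def
proof (intro span_sum span_scale)
  fix j assume j: "j \<in> Idx0 r \<mu>"
  have "((\<lambda>\<nu>. F \<nu> (j \<nu>))(\<mu> := unit_seq 0)) \<nu> = (\<Sum>l<(n(\<mu> := 1)) \<nu>.
      (if \<nu> = \<mu> then 1 else t \<nu> l (j \<nu>)) *\<^sub>R (b(\<mu> := \<lambda>_. unit_seq 0)) \<nu> l)" for \<nu>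
    using j assms[of "j \<nu>" \<nu>] by (auto simp: Idx0_def Idx_def)
  then have "elementary_tensor ((\<lambda>\<nu>. F \<nu> (j \<nu>))(\<mu> := unit_seq 0)) \<in>
      span ((\<lambda>i. elementary_tensor (\<lambda>\<nu>. (b(\<mu> := \<lambda>_. unit_seq 0)) \<nu> (i \<nu>))) ` Idx (n(\<mu> := 1)))"
    by (rule elementary_tensor_in_span)
  then show "elementary_tensor ((\<lambda>\<nu>. F \<nu> (j \<nu>))(\<mu> := unit_seq 0)) \<in> span (slice_basis \<mu> ` Idx0 n \<mu>)"
    by (simp only: slice_basis_eq[abs_def] Idx0_eq_Idx)
qed

lemma normal_part_in_span: "normal_part \<in> span (basis_tensor ` Idx n)"
  unfolding normal_part_def tangent_part_def X_def Y_def
proof -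
  have 1: "tucker p K U \<in> span (basis_tensor ` Idx n)" for K
    by (rule tucker_in_span) (rule U_expand)
  have 2: "tucker p D V \<in> span (basis_tensor ` Idx n)"
    by (rule tucker_in_span) (rule V)
  have 3: "tucker p C (U(\<mu> := factor_variation \<mu>)) \<in> span (basis_tensor ` Idx n)" for \<mu>
  proof (rule tucker_in_span)
    fix \<nu> k assume k: "k < r \<nu>"
    show "(U(\<mu> := factor_variation \<mu>)) \<nu> k = (\<Sum>l<n \<nu>. (if \<nu> = \<mu> then (if r \<mu> \<le> l
        then - (\<Sum>i<r \<mu>. coord \<mu> l i * \<gamma> \<mu> i k) else 0) else of_bool (l = k)) *\<^sub>R b \<nu> l)"
      using U_expand[OF k] factor_variation_expand[of \<mu> k] by (cases "\<nu> = \<mu>") simp_all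
  qed
  show "tucker p C U - tucker p D V - (tucker p core_variation U + (\<Sum>\<mu>\<in>UNIV. tucker p C (U(\<mu> := factor_variation \<mu>))))
      \<in> span (basis_tensor ` Idx n)"
    by (intro span_diff span_add span_sum 1 2 3)
qed

lemma inner_tucker_basis_tensor:
  "inner (tucker p K F) (basis_tensor (j(\<mu> := l)))
    = (\<Sum>m<r \<mu>. inner (F \<mu> m) (b \<mu> l) * inner (slice \<mu> K F m) (slice_basis \<mu> j))"
  unfolding basis_tensor_def using inner_tucker_slice[of K F "\<lambda>\<nu>. b \<nu> ((j(\<mu> := l)) \<nu>)" \<mu>]
  by (simp only: slice_basis_upd fun_upd_same)

text \<open>Variations of the factors are orthogonal to \<open>U\<close> and do not contribute.\<close>
lemma normal_part_core:
  assumes i: "i \<in> Idx r"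
  shows "inner normal_part (basis_tensor i) = entry p ((C - compress U Y) - core_variation) i"
proof -
  have "inner (tucker p C (U(\<mu> := factor_variation \<mu>))) (basis_tensor i) = 0" for \<mu>
  proof -
    have "inner (factor_variation \<mu> (k \<mu>)) (U \<mu> (i \<mu>)) = 0" for k
      using U_factor_variation[of "i \<mu>" \<mu>] i by (simp add: inner_commute Idx_def)
    then have "(\<Prod>\<nu>\<in>UNIV. inner ((U(\<mu> := factor_variation \<mu>)) \<nu> (k \<nu>)) (U \<nu> (i \<nu>))) = 0" for k :: "'d \<Rightarrow> nat"
      unfolding prod_split_mode[of _ \<mu>] by simp
    then show ?thesis
      unfolding basis_tensor_U[OF i] inner_tucker_elementary by (simp only: mult_zero_right sum.neutral_const)
  qed
  then show ?thesis
    using i by (simp add: normal_part_def tangent_part_def X_def inner_diff_left inner_add_left inner_sum_left basis_tensor_U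
        inner_tucker_orthonormal[OF U] entry_linear entry_compress)
qed

text \<open>A basis vector outside \<open>U \<mu>\<close> annihilates \<open>X\<close>, the core part, and the variations of the other factors; what
  is left is a row of \<open>Y\<close> and the variation of the factor in mode \<open>\<mu>\<close>. Multi-indices that leave \<open>U\<close> in
  several modes are covered as well, from each of these modes.\<close>
lemma normal_part_outer:
  assumes l: "r \<mu> \<le> l" "l < n \<mu>"
  shows "inner normal_part (basis_tensor (j(\<mu> := l))) = - inner (row_residual \<mu> l) (slice_basis \<mu> j)"
proof -
  have U0: "inner (tucker p K F) (basis_tensor (j(\<mu> := l))) = 0" if "F \<mu> = U \<mu>" for K F
    unfolding inner_tucker_basis_tensor using l by (simp add: that b_orth)
  have "inner (tucker p C (U(\<nu> := factor_variation \<nu>))) (basis_tensor (j(\<mu> := l))) = 0" if "\<nu> \<noteq> \<mu>" for \<nu>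
    by (rule U0) (use that in auto)
  then have "(\<Sum>\<nu>\<in>UNIV. inner (tucker p C (U(\<nu> := factor_variation \<nu>))) (basis_tensor (j(\<mu> := l))))
      = inner (tucker p C (U(\<mu> := factor_variation \<mu>))) (basis_tensor (j(\<mu> := l)))"
    by (subst sum.remove[of _ \<mu>]) auto
  also have "\<dots> = - (\<Sum>m<r \<mu>. (\<Sum>k<r \<mu>. coord \<mu> l k * \<gamma> \<mu> k m) * inner (slice \<mu> C U m) (slice_basis \<mu> j))"
    unfolding inner_tucker_basis_tensor slice_upd by (simp add: inner_factor_variation[OF l] sum_negf)
  also have "(\<Sum>m<r \<mu>. (\<Sum>k<r \<mu>. coord \<mu> l k * \<gamma> \<mu> k m) * inner (slice \<mu> C U m) (slice_basis \<mu> j))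
      = (\<Sum>k<r \<mu>. coord \<mu> l k * (\<Sum>m<r \<mu>. \<gamma> \<mu> k m * inner (slice \<mu> C U m) (slice_basis \<mu> j)))"
    unfolding sum_distrib_left sum_distrib_right by (subst sum.swap) (simp add: mult.assoc)
  finally have factor_variation: "(\<Sum>\<nu>\<in>UNIV. inner (tucker p C (U(\<nu> := factor_variation \<nu>))) (basis_tensor (j(\<mu> := l))))
      = - (\<Sum>k<r \<mu>. coord \<mu> l k * (\<Sum>m<r \<mu>. \<gamma> \<mu> k m * inner (slice \<mu> C U m) (slice_basis \<mu> j)))" .
  have Y: "inner Y (basis_tensor (j(\<mu> := l))) = (\<Sum>k<r \<mu>. coord \<mu> l k * inner (slice \<mu> D V k) (slice_basis \<mu> j))"
    unfolding Y_def inner_tucker_basis_tensor by (simp add: coord_def inner_commute)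
  have "inner normal_part (basis_tensor (j(\<mu> := l))) = - inner Y (basis_tensor (j(\<mu> := l)))
      - (\<Sum>\<nu>\<in>UNIV. inner (tucker p C (U(\<nu> := factor_variation \<nu>))) (basis_tensor (j(\<mu> := l))))"
    by (simp add: normal_part_def tangent_part_def X_def inner_diff_left inner_add_left inner_sum_left U0)
  also have "\<dots> = - inner (row_residual \<mu> l) (slice_basis \<mu> j)"
    unfolding factor_variation Y
    by (simp add: row_residual_def slice_residual_def inner_sum_left inner_diff_left right_diff_distrib sum_subtractf)
  finally show ?thesis .
qed

lemma row_residual_orthogonal: "m < r \<mu> \<Longrightarrow> inner (row_residual \<mu> l) (slice \<mu> C U m) = 0"
  by (simp add: row_residual_def slice_residual_def inner_sum_left \<gamma>)

lemma core_variation_tangent: "core_variation \<in> tangent_space Mc C"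
  and core_variation_residual: "K \<in> tangent_space Mc C \<Longrightarrow> inner ((C - compress U Y) - core_variation) K = 0"
  unfolding core_variation_def by (rule orth_proj_subspace[OF subspace_tangent_space[OF smooth_Mc C]])+

text \<open>Against core variations this is the orthogonality of the core residual. Against a variation of the
  factor in mode \<open>\<mu>\<close>, only basis vectors outside \<open>U \<mu>\<close> count, and there the residual rows are orthogonal
  to the rows of \<open>X\<close>.\<close>
lemma normal_part_orthogonal:
  assumes s: "s \<in> tensor_tangent_space r p Mc X"
  shows "inner normal_part s = 0"
proof -
  obtain K G where K: "K \<in> tangent_space Mc C"
    and G: "\<And>\<mu> k l. k < r \<mu> \<Longrightarrow> l < r \<mu> \<Longrightarrow> inner (U \<mu> k) (G \<mu> l) = 0"
    and s: "s = tucker p K U + (\<Sum>\<mu>\<in>UNIV. tucker p C (U(\<mu> := G \<mu>)))"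
    using tangent_vector_representation[OF C U s[unfolded X_def]] by blast
  have "inner normal_part (tucker p K U) = (\<Sum>i\<in>Idx r. entry p K i * inner normal_part (basis_tensor i))"
    unfolding tucker_Idx inner_sum_right by (intro sum.cong) (auto simp: basis_tensor_U)
  also have "\<dots> = inner ((C - compress U Y) - core_variation) K"
    by (simp add: normal_part_core inner_core mult.commute)
  also have "\<dots> = 0" using core_variation_residual[OF K] .
  finally have 1: "inner normal_part (tucker p K U) = 0" .
  have 2: "inner normal_part (tucker p C (U(\<mu> := G \<mu>))) = 0" for \<mu>
  proof -
    have U_span: "slice \<mu> C U m \<in> span (slice_basis \<mu> ` Idx0 n \<mu>)" for m
      by (rule slice_in_span) (rule U_expand)
    have inner0: "(\<Sum>j\<in>Idx0 n \<mu>. inner normal_part (basis_tensor (j(\<mu> := l))) *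
        inner (tucker p C (U(\<mu> := G \<mu>))) (basis_tensor (j(\<mu> := l)))) = 0" if l: "l < n \<mu>" for l
    proof (cases "l < r \<mu>")
      case True
      then have "inner (G \<mu> m) (b \<mu> l) = 0" if "m < r \<mu>" for m
        using G[OF True that] by (simp add: bU inner_commute)
      then show ?thesis unfolding inner_tucker_basis_tensor by simp
    next
      case False
      then have "(\<Sum>j\<in>Idx0 n \<mu>. inner normal_part (basis_tensor (j(\<mu> := l))) * inner (tucker p C (U(\<mu> := G \<mu>))) (basis_tensor (j(\<mu> := l))))
        = - (\<Sum>m<r \<mu>. inner (G \<mu> m) (b \<mu> l) *
            (\<Sum>j\<in>Idx0 n \<mu>. inner (row_residual \<mu> l) (slice_basis \<mu> j) * inner (slice \<mu> C U m) (slice_basis \<mu> j)))"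
        unfolding inner_tucker_basis_tensor slice_upd using l
        by (simp add: normal_part_outer sum_distrib_left sum_negf) (subst sum.swap, simp add: mult_ac)
      also have "\<dots> = - (\<Sum>m<r \<mu>. inner (G \<mu> m) (b \<mu> l) * inner (row_residual \<mu> l) (slice \<mu> C U m))"
        by (simp add: parseval(1)[OF _ slice_basis_orthonormal U_span])
      finally show ?thesis by (simp add: row_residual_orthogonal)
    qed
    have "inner normal_part (tucker p C (U(\<mu> := G \<mu>)))
        = inner (tucker p C (U(\<mu> := G \<mu>))) normal_part" by (rule inner_commute)
    also have "\<dots> = (\<Sum>i\<in>Idx n. inner (tucker p C (U(\<mu> := G \<mu>))) (basis_tensor i) * inner normal_part (basis_tensor i))"
      by (rule parseval(1)[OF finite_Idx(1) basis_tensor_orthonormal normal_part_in_span])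
    also have "\<dots> = (\<Sum>l<n \<mu>. \<Sum>j\<in>Idx0 n \<mu>. inner normal_part (basis_tensor (j(\<mu> := l))) *
        inner (tucker p C (U(\<mu> := G \<mu>))) (basis_tensor (j(\<mu> := l))))"
      unfolding sum_Idx_fibers[of n \<mu>, OF n_pos] by (subst sum.swap) (simp add: mult.commute)
    also have "\<dots> = 0" using inner0 by simp
    finally show ?thesis .
  qed
  show ?thesis unfolding s by (simp add: inner_add_right inner_sum_right 1 2)
qed

lemma orth_proj_difference: "orth_proj (tensor_tangent_space r p Mc X) (X - Y) = tangent_part"
proof (rule orth_proj_eqI)
  show "tangent_part \<in> tensor_tangent_space r p Mc X"
    unfolding tensor_tangent_space_def tangent_part_def X_def mem_Collect_eq
    using C orthonormal_imp_regular[OF U] core_variation_tangent U_factor_variation by blast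
  show "inner (X - Y - tangent_part) s = 0" if "s \<in> tensor_tangent_space r p Mc X" for s
    using normal_part_orthogonal[OF that] by (simp add: normal_part_def)
qed

text \<open>These are the rows of the difference of the two matricizations; a matricization preserves the norm.\<close>
lemma slice_difference_le:
  "(\<Sum>l<n \<mu>. (norm ((if l < r \<mu> then slice \<mu> C U l else 0) - (\<Sum>k<r \<mu>. coord \<mu> l k *\<^sub>R slice \<mu> D V k)))\<^sup>2)
    \<le> (norm (X - Y))\<^sup>2"
proof -
  define y where "y l = (if l < r \<mu> then slice \<mu> C U l else 0) - (\<Sum>k<r \<mu>. coord \<mu> l k *\<^sub>R slice \<mu> D V k)" for l
  have y_span: "y l \<in> span (slice_basis \<mu> ` Idx0 n \<mu>)" for l
  proof -
    have "slice \<mu> C U l \<in> span (slice_basis \<mu> ` Idx0 n \<mu>)" by (rule slice_in_span) (rule U_expand)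
    moreover have "slice \<mu> D V k \<in> span (slice_basis \<mu> ` Idx0 n \<mu>)" for k by (rule slice_in_span) (rule V)
    ultimately show ?thesis unfolding y_def by (intro span_diff span_sum span_scale) (auto simp: span_zero)
  qed
  have y_coef: "inner (y l) (slice_basis \<mu> j) = inner (X - Y) (basis_tensor (j(\<mu> := l)))" if l: "l < n \<mu>" for l j
  proof -
    have "inner X (basis_tensor (j(\<mu> := l))) = (\<Sum>m<r \<mu>. of_bool (m = l) * inner (slice \<mu> C U m) (slice_basis \<mu> j))"
      unfolding X_def inner_tucker_basis_tensor
    proof (intro sum.cong refl)
      fix m assume "m \<in> {..<r \<mu>}"
      then have "inner (U \<mu> m) (b \<mu> l) = of_bool (m = l)"
        using onsD[OF b, of m \<mu> l] l r_less_n bU by simp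
      then show "inner (U \<mu> m) (b \<mu> l) * inner (slice \<mu> C U m) (slice_basis \<mu> j)
          = of_bool (m = l) * inner (slice \<mu> C U m) (slice_basis \<mu> j)" by simp
    qed
    also have "\<dots> = inner (if l < r \<mu> then slice \<mu> C U l else 0) (slice_basis \<mu> j)"
      by (cases "l < r \<mu>") auto
    finally have "inner X (basis_tensor (j(\<mu> := l))) = inner (if l < r \<mu> then slice \<mu> C U l else 0) (slice_basis \<mu> j)" .
    moreover have "inner Y (basis_tensor (j(\<mu> := l))) = inner (\<Sum>k<r \<mu>. coord \<mu> l k *\<^sub>R slice \<mu> D V k) (slice_basis \<mu> j)"
      unfolding Y_def inner_tucker_basis_tensor by (simp add: coord_def inner_commute inner_sum_left inner_sum_right)
    ultimately show ?thesis by (simp add: y_def inner_diff_left)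
  qed
  have "(\<Sum>l<n \<mu>. (norm (y l))\<^sup>2) = (\<Sum>l<n \<mu>. \<Sum>j\<in>Idx0 n \<mu>. (inner (y l) (slice_basis \<mu> j))\<^sup>2)"
    by (intro sum.cong refl parseval(2)[OF _ slice_basis_orthonormal y_span]) auto
  also have "\<dots> = (\<Sum>i\<in>Idx n. (inner (X - Y) (basis_tensor i))\<^sup>2)"
    unfolding sum_Idx_fibers[of n \<mu>, OF n_pos] by (subst sum.swap) (simp add: y_coef)
  also have "\<dots> \<le> (norm (X - Y))\<^sup>2" by (intro bessel basis_tensor_orthonormal) auto
  finally show ?thesis by (simp add: y_def)
qed

lemma outer_bound:
  fixes \<mu> :: 'd
  shows "(\<Sum>i\<in>{i \<in> Idx n. r \<mu> \<le> i \<mu>}. (inner normal_part (basis_tensor i))\<^sup>2)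
    \<le> ((norm (X - Y))\<^sup>2)\<^sup>2 / (smallest_singular_value \<mu> X)\<^sup>2"
proof -
  define s where "s = smallest_singular_value \<mu> X"
  note sv = smallest_singular_value_tucker[OF U Mc_nondegenerate[OF C], of \<mu>, folded X_def, folded s_def]
  define e where "e = (\<Sum>l<n \<mu>. (norm ((if l < r \<mu> then slice \<mu> C U l else 0)
      - (\<Sum>k<r \<mu>. coord \<mu> l k *\<^sub>R slice \<mu> D V k)))\<^sup>2)"
  have "(\<Sum>i\<in>{i \<in> Idx n. r \<mu> \<le> i \<mu>}. (inner normal_part (basis_tensor i))\<^sup>2)
      = (\<Sum>i\<in>Idx n. if r \<mu> \<le> i \<mu> then (inner normal_part (basis_tensor i))\<^sup>2 else 0)"
    by (rule sum.inter_filter) simp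
  also have "\<dots> = (\<Sum>l<n \<mu>. \<Sum>j\<in>Idx0 n \<mu>. if r \<mu> \<le> l then (inner normal_part (basis_tensor (j(\<mu> := l))))\<^sup>2 else 0)"
    unfolding sum_Idx_fibers[of n \<mu>, OF n_pos] by (subst sum.swap) simp
  also have "\<dots> = (\<Sum>l=r \<mu>..<n \<mu>. \<Sum>j\<in>Idx0 n \<mu>. (inner normal_part (basis_tensor (j(\<mu> := l))))\<^sup>2)"
    by (rule sum.mono_neutral_cong_right) auto
  also have "\<dots> = (\<Sum>l=r \<mu>..<n \<mu>. \<Sum>j\<in>Idx0 n \<mu>. (inner (row_residual \<mu> l) (slice_basis \<mu> j))\<^sup>2)"
    by (intro sum.cong refl) (simp add: normal_part_outer)
  also have "\<dots> \<le> (\<Sum>l=r \<mu>..<n \<mu>. (norm (row_residual \<mu> l))\<^sup>2)"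
    by (intro sum_mono bessel slice_basis_orthonormal) auto
  also have "\<dots> \<le> e\<^sup>2 / s\<^sup>2"
    unfolding row_residual_def e_def
  proof (rule low_rank_perturbation[OF rn sv(1) sv(2)])
    show "slice \<mu> D V k = slice_residual \<mu> k + (\<Sum>m<r \<mu>. \<gamma> \<mu> k m *\<^sub>R slice \<mu> C U m)" for k
      by (simp add: slice_residual_def)
    show "inner (slice_residual \<mu> k) (slice \<mu> C U m) = 0" if "k < r \<mu>" "m < r \<mu>" for k m
      using that by (simp add: slice_residual_def \<gamma>)
  qed
  also have "\<dots> \<le> ((norm (X - Y))\<^sup>2)\<^sup>2 / s\<^sup>2"
    using slice_difference_le[of \<mu>] by (intro divide_right_mono power_mono) (auto simp: e_def sum_nonneg)
  finally show ?thesis by (simp add: s_def)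
qed

text \<open>A multi-index outside \<open>Idx r\<close> leaves \<open>U\<close> in at least one mode. Counting it once for every such mode only
  increases the sum.\<close>
lemma normal_part_bound:
  "(norm normal_part)\<^sup>2 \<le> (norm ((C - compress U Y) - core_variation))\<^sup>2
    + (\<Sum>\<mu>\<in>UNIV. ((norm (X - Y))\<^sup>2)\<^sup>2 / (smallest_singular_value \<mu> X)\<^sup>2)"
proof -
  define g where "g i = (inner normal_part (basis_tensor i))\<^sup>2" for i
  have "(norm normal_part)\<^sup>2 = (\<Sum>i\<in>Idx n. g i)"
    unfolding g_def by (rule parseval(2)[OF _ basis_tensor_orthonormal normal_part_in_span]) auto
  also have "\<dots> \<le> (\<Sum>i\<in>Idx n. (if i \<in> Idx r then g i else 0) + (\<Sum>\<mu>\<in>UNIV. if r \<mu> \<le> i \<mu> then g i else 0))"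
  proof (rule sum_mono)
    fix i
    have g0: "0 \<le> g i" by (simp add: g_def)
    show "g i \<le> (if i \<in> Idx r then g i else 0) + (\<Sum>\<mu>\<in>UNIV. if r \<mu> \<le> i \<mu> then g i else 0)"
    proof (cases "i \<in> Idx r")
      case True
      then show ?thesis using g0 by (simp add: sum_nonneg)
    next
      case False
      then obtain \<mu> where "r \<mu> \<le> i \<mu>" by (auto simp: Idx_def not_less)
      then have "g i = (if r \<mu> \<le> i \<mu> then g i else 0)" by simp
      also have "\<dots> \<le> (\<Sum>\<mu>\<in>UNIV. if r \<mu> \<le> i \<mu> then g i else 0)"
        using g0 by (intro member_le_sum) auto
      finally show ?thesis using False by simp
    qed
  qed
  also have "\<dots> = (\<Sum>i\<in>Idx n. if i \<in> Idx r then g i else 0)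
      + (\<Sum>\<mu>\<in>UNIV. \<Sum>i\<in>Idx n. if r \<mu> \<le> i \<mu> then g i else 0)"
    unfolding sum.distrib by (subst (2) sum.swap) simp
  also have "(\<Sum>i\<in>Idx n. if i \<in> Idx r then g i else 0) = (\<Sum>i\<in>Idx r. g i)"
    by (rule sum.mono_neutral_cong_right) (auto simp: Idx_r_n)
  also have "\<dots> = (norm ((C - compress U Y) - core_variation))\<^sup>2"
    unfolding norm_core g_def by (intro sum.cong refl) (simp add: normal_part_core)
  also have "(\<Sum>\<mu>\<in>UNIV. \<Sum>i\<in>Idx n. if r \<mu> \<le> i \<mu> then g i else 0)
      = (\<Sum>\<mu>\<in>UNIV. \<Sum>i\<in>{i \<in> Idx n. r \<mu> \<le> i \<mu>}. g i)"
    by (intro sum.cong refl sum.inter_filter[symmetric]) simp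
  also have "\<dots> \<le> (\<Sum>\<mu>\<in>UNIV. ((norm (X - Y))\<^sup>2)\<^sup>2 / (smallest_singular_value \<mu> X)\<^sup>2)"
    unfolding g_def by (intro sum_mono outer_bound)
  finally show ?thesis by simp
qed

end

context core_manifold_setting
begin

lemma tangent_residual_bound:
  fixes V :: "'d \<Rightarrow> nat \<Rightarrow> nat ell2"
  assumes C: "C \<in> Mc" and U: "orthonormal_factors U" and D: "D \<in> Mc"
  defines "X \<equiv> tucker p C U" and "Y \<equiv> tucker p D V"
  shows "(norm ((X - Y) - orth_proj (tensor_tangent_space r p Mc X) (X - Y)))\<^sup>2
    \<le> (norm ((C - compress U Y) - orth_proj (tangent_space Mc C) (C - compress U Y)))\<^sup>2
      + (\<Sum>\<mu>\<in>UNIV. ((norm (X - Y))\<^sup>2)\<^sup>2 / (smallest_singular_value \<mu> X)\<^sup>2)"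
proof -
  have "\<forall>\<mu>. \<exists>nb. r \<mu> \<le> fst nb \<and> ons (fst nb) (snd nb) \<and> (\<forall>k<r \<mu>. snd nb k = U \<mu> k) \<and>
      (\<forall>k<r \<mu>. V \<mu> k = (\<Sum>l<fst nb. inner (snd nb l) (V \<mu> k) *\<^sub>R snd nb l))"
  proof
    fix \<mu>
    have "ons (r \<mu>) (U \<mu>)" using U by blast
    from gram_schmidt_extend[OF this, of "r \<mu>" "V \<mu>"] obtain n b where
      "r \<mu> \<le> n" "ons n b" "\<forall>k<r \<mu>. b k = U \<mu> k" "\<forall>k<r \<mu>. V \<mu> k = (\<Sum>l<n. inner (b l) (V \<mu> k) *\<^sub>R b l)"
      by blast
    then show "\<exists>nb. r \<mu> \<le> fst nb \<and> ons (fst nb) (snd nb) \<and> (\<forall>k<r \<mu>. snd nb k = U \<mu> k) \<and>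
      (\<forall>k<r \<mu>. V \<mu> k = (\<Sum>l<fst nb. inner (snd nb l) (V \<mu> k) *\<^sub>R snd nb l))"
      by (intro exI[of _ "(n, b)"]) simp
  qed
  from choice[OF this] obtain nb where nb: "\<And>\<mu>. r \<mu> \<le> fst (nb \<mu>)" "\<And>\<mu>. ons (fst (nb \<mu>)) (snd (nb \<mu>))"
    "\<And>\<mu> k. k < r \<mu> \<Longrightarrow> snd (nb \<mu>) k = U \<mu> k"
    "\<And>\<mu> k. k < r \<mu> \<Longrightarrow> V \<mu> k = (\<Sum>l<fst (nb \<mu>). inner (snd (nb \<mu>) l) (V \<mu> k) *\<^sub>R snd (nb \<mu>) l)"
    by blast
  have "\<forall>\<mu>. \<exists>\<gamma>. \<forall>k. \<forall>m<r \<mu>.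
      inner (slice \<mu> D V k - (\<Sum>j<r \<mu>. \<gamma> k j *\<^sub>R slice \<mu> C U j)) (slice \<mu> C U m) = 0"
    by (intro allI orthogonal_residuals slice_indep[OF U Mc_nondegenerate[OF C]])
  from choice[OF this] obtain \<gamma> where \<gamma>: "\<And>\<mu> k m. m < r \<mu> \<Longrightarrow>
      inner (slice \<mu> D V k - (\<Sum>j<r \<mu>. \<gamma> \<mu> k j *\<^sub>R slice \<mu> C U j)) (slice \<mu> C U m) = 0" by blast
  \<comment> \<open>all choices are made per mode: \<open>nb\<close> pairs the length of the basis with the basis itself\<close>
  interpret ab: adapted_basis r p Mc C D U V "\<lambda>\<mu>. snd (nb \<mu>)" "\<lambda>\<mu>. fst (nb \<mu>)" \<gamma>
    by unfold_locales (fact C D U nb | rule \<gamma>, assumption)+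
  have XY: "ab.X = X" "ab.Y = Y" by (simp_all add: ab.X_def ab.Y_def X_def Y_def)
  show ?thesis
    using ab.normal_part_bound ab.orth_proj_difference unfolding ab.normal_part_def ab.core_variation_def XY by simp
qed

end

theorem proposition4p9:
  fixes r :: "'d::finite \<Rightarrow> nat"
    and p :: "'n::finite \<Rightarrow> 'd \<Rightarrow> nat"
    and Mc :: "(real ^ 'n) set"
    and c \<sigma> :: real
    and X Y :: "('d \<Rightarrow> nat) ell2"
  assumes "\<forall>\<mu>. r \<mu> > 0"
    and "tensor_labelling r p"
    and "core_manifold r p Mc"
    and "c > 0"
    and "\<forall>C\<in>Mc. \<forall>C'\<in>closure Mc.
           norm ((C - C') - orth_proj (tangent_space Mc C) (C - C'))
             \<le> c / infdist C (closure Mc - Mc) * (norm (C - C'))\<^sup>2"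
    and "X \<in> tensor_manifold r p Mc"
    and "Y \<in> tensor_manifold r p Mc"
    and "\<sigma> = infdist X (weak_closure (tensor_manifold r p Mc) - tensor_manifold r p Mc)"
  shows "norm ((X - Y) - orth_proj (tensor_tangent_space r p Mc X) (X - Y))
           \<le> sqrt (c\<^sup>2 / \<sigma>\<^sup>2 + (\<Sum>\<mu>\<in>UNIV. 1 / (smallest_singular_value \<mu> X)\<^sup>2)) * (norm (X - Y))\<^sup>2
       \<and> sqrt (c\<^sup>2 / \<sigma>\<^sup>2 + (\<Sum>\<mu>\<in>UNIV. 1 / (smallest_singular_value \<mu> X)\<^sup>2)) * (norm (X - Y))\<^sup>2
           \<le> sqrt (real CARD('d) + c\<^sup>2) / \<sigma> * (norm (X - Y))\<^sup>2"
proof -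
  interpret core_manifold_setting r p Mc
    using assms(1-3) by unfold_locales auto
  obtain C U where C: "C \<in> Mc" and U: "orthonormal_factors U" and X: "X = tucker p C U"
    using assms(6) by (rule orthonormal_representation)
  obtain D V where D: "D \<in> Mc" and Y: "Y = tucker p D V"
    using assms(7) by (rule ME)
  note dist = distance_to_boundary[OF C U, folded X, folded assms(8)]
  define e where "e = (norm (X - Y))\<^sup>2"
  have e: "0 \<le> e" by (simp add: e_def)
  define \<sigma>c where "\<sigma>c = infdist C (closure Mc - Mc)"
  define s where "s \<mu> = smallest_singular_value \<mu> X" for \<mu>
  have \<sigma>: "\<sigma> > 0" "\<sigma> \<le> \<sigma>c" "\<And>\<mu>. \<sigma> \<le> s \<mu>"
    using dist order_trans[OF dist(2) dist(3)] by (auto simp: \<sigma>c_def s_def)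
  define Ct where "Ct = compress U Y"
  have "Ct \<in> closure Mc"
    unfolding Ct_def Y compress_tucker by (rule core_mult_in_closure[OF D])
  then have "norm ((C - Ct) - orth_proj (tangent_space Mc C) (C - Ct)) \<le> c / \<sigma>c * (norm (C - Ct))\<^sup>2"
    using assms(5) C by (simp add: \<sigma>c_def)
  also have "\<dots> \<le> c / \<sigma> * e"
  proof (intro mult_mono)
    show "c / \<sigma>c \<le> c / \<sigma>" using \<sigma> \<open>c > 0\<close> by (intro divide_left_mono) auto
    have "norm (C - Ct) \<le> norm (X - Y)"
      using norm_compress_le[OF U, of "X - Y"]
      by (simp add: compress_diff X compress_orthonormal[OF U] Ct_def)
    then show "(norm (C - Ct))\<^sup>2 \<le> e" unfolding e_def by (intro power_mono) auto
  qed (use \<sigma> \<open>c > 0\<close> in auto)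
  finally have core: "(norm ((C - Ct) - orth_proj (tangent_space Mc C) (C - Ct)))\<^sup>2 \<le> (c / \<sigma> * e)\<^sup>2"
    by (intro power_mono) auto
  \<comment> \<open>squares of the core part and of the outer parts add up\<close>
  define K where "K = c\<^sup>2 / \<sigma>\<^sup>2 + (\<Sum>\<mu>\<in>UNIV. 1 / (s \<mu>)\<^sup>2)"
  have "(norm ((X - Y) - orth_proj (tensor_tangent_space r p Mc X) (X - Y)))\<^sup>2
      \<le> (c / \<sigma> * e)\<^sup>2 + (\<Sum>\<mu>\<in>UNIV. e\<^sup>2 / (s \<mu>)\<^sup>2)"
    using tangent_residual_bound[OF C U D, of V] core
    unfolding X[symmetric] Y[symmetric] Ct_def[symmetric] e_def[symmetric] s_def[symmetric] by linarith
  also have "\<dots> = K * e\<^sup>2"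
    by (simp add: K_def distrib_right power_mult_distrib power_divide sum_distrib_right)
  finally have "norm ((X - Y) - orth_proj (tensor_tangent_space r p Mc X) (X - Y)) \<le> sqrt (K * e\<^sup>2)"
    by (rule real_le_rsqrt)
  also have "\<dots> = sqrt K * e" using e by (simp add: real_sqrt_mult)
  finally have first: "norm ((X - Y) - orth_proj (tensor_tangent_space r p Mc X) (X - Y)) \<le> sqrt K * e" .
  have "(\<Sum>\<mu>\<in>UNIV. 1 / (s \<mu>)\<^sup>2) \<le> (\<Sum>\<mu>\<in>(UNIV :: 'd set). 1 / \<sigma>\<^sup>2)"
    by (intro sum_mono frac_le power_mono) (use \<sigma> in \<open>auto simp: less_imp_le\<close>)
  then have "K \<le> (real CARD('d) + c\<^sup>2) / \<sigma>\<^sup>2" by (simp add: K_def add_divide_distrib)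
  then have "sqrt K \<le> sqrt ((real CARD('d) + c\<^sup>2) / \<sigma>\<^sup>2)" by simp
  also have "\<dots> = sqrt (real CARD('d) + c\<^sup>2) / \<sigma>" using \<sigma> by (simp add: real_sqrt_divide)
  finally have "sqrt K * e \<le> sqrt (real CARD('d) + c\<^sup>2) / \<sigma> * e"
    by (intro mult_right_mono) (auto simp: e_def)
  with first show ?thesis by (simp add: K_def e_def s_def)
qed

end
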